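(* Let $\theta$ be a non-constant inner function with $\theta(0)=0$, and let $\varphi=\varphi_1+\overline{\varphi_2}$ with $\varphi_1,\varphi_2\in K_\theta$, such that the truncated Toeplitz operator $A^\theta_\varphi$ is bounded on $K_\theta$. Then $A^{\theta}_{\varphi}$ is normal if and only if either \[ \varphi_2-\varphi_2(0)=\alpha\,(\varphi_1-\varphi_1(0)) \] or \[ \varphi_2-\varphi_2(0)=\alpha\,\theta\,\big(\overline{\varphi_1}-\overline{\varphi_1(0)}\big), \] for some unimodular constant $\alpha$.
   Context: $L^2$ is the space of square-integrable functions on the unit circle $\mathbb{T}$, $H^2\subset L^2$ the Hardy space, $P$ the orthogonal projection of $L^2$ onto $H^2$. An inner function is an analytic $\theta$ on the unit disk with $|\theta|=1$ a.e. on $\mathbb{T}$. The model space is $K_\theta=H^2\ominus\theta H^2$ and $P_\theta f=Pf-\theta P(\bar\theta f)$ is the orthogonal projection onto $K_\theta$. For $\varphi\in L^2$, the truncated Toeplitz operator $A^\theta_\varphi f=P_\theta(\varphi f)$ is defined on the dense subspace $K_\theta\cap H^\infty$ and (when bounded) extended to all of $K_\theta$. An operator $T$ is normal if $T^*T=TT^*$. *)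

theory Defs
  imports "HOL-Analysis.Analysis"
begin

text \<open>Functions on the unit circle are represented by their parametrisation
  t \<mapsto> f(e^{it}) on the interval [-pi, pi], with normalised Lebesgue measure.
  Everything is understood up to equality almost everywhere.\<close>

definition circ :: "real measure" where
  "circ = lebesgue_on {-pi..pi}"

definition L2 :: "(real \<Rightarrow> complex) set" where
  "L2 = {f. f \<in> borel_measurable circ \<and> integrable circ (\<lambda>t. (cmod (f t))\<^sup>2)}"

definition l2inner :: "(real \<Rightarrow> complex) \<Rightarrow> (real \<Rightarrow> complex) \<Rightarrow> complex" where
  "l2inner f g = (1 / (2 * pi)) * (\<integral>t. f t * cnj (g t) \<partial>circ)"

definition l2norm :: "(real \<Rightarrow> complex) \<Rightarrow> real" where
  "l2norm f = sqrt ((1 / (2 * pi)) * (\<integral>t. (cmod (f t))\<^sup>2 \<partial>circ))"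

text \<open>Fourier coefficients; fourier f 0 is the value at 0 of the analytic extension
  when f is in H^2.\<close>
definition fourier :: "(real \<Rightarrow> complex) \<Rightarrow> int \<Rightarrow> complex" where
  "fourier f n = (1 / (2 * pi)) * (\<integral>t. f t * exp (- (\<i> * of_int n * complex_of_real t)) \<partial>circ)"

definition H2 :: "(real \<Rightarrow> complex) set" where
  "H2 = {f \<in> L2. \<forall>n < 0. fourier f n = 0}"

definition Hinf :: "(real \<Rightarrow> complex) set" where
  "Hinf = {f \<in> H2. \<exists>C. AE t in circ. cmod (f t) \<le> C}"

text \<open>Inner function, via its boundary values: an H^infinity function of modulus 1 a.e.\<close>
definition inner_fun :: "(real \<Rightarrow> complex) \<Rightarrow> bool" where
  "inner_fun \<theta> \<longleftrightarrow> \<theta> \<in> H2 \<and> (AE t in circ. cmod (\<theta> t) = 1)"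

definition model_space :: "(real \<Rightarrow> complex) \<Rightarrow> (real \<Rightarrow> complex) set" where
  "model_space \<theta> = {f \<in> H2. \<forall>g \<in> H2. l2inner f (\<lambda>t. \<theta> t * g t) = 0}"

definition orth_proj :: "(real \<Rightarrow> complex) set \<Rightarrow> (real \<Rightarrow> complex) \<Rightarrow> (real \<Rightarrow> complex)" where
  "orth_proj M f = (SOME g. g \<in> M \<and> (\<forall>h \<in> M. l2inner (\<lambda>t. f t - g t) h = 0))"

definition P_theta :: "(real \<Rightarrow> complex) \<Rightarrow> (real \<Rightarrow> complex) \<Rightarrow> (real \<Rightarrow> complex)" where
  "P_theta \<theta> = orth_proj (model_space \<theta>)"

text \<open>A_phi on the dense subspace K_theta \<inter> H^infinity is bounded.\<close>
definition tto_bounded :: "(real \<Rightarrow> complex) \<Rightarrow> (real \<Rightarrow> complex) \<Rightarrow> bool" where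
  "tto_bounded \<theta> \<phi> \<longleftrightarrow> (\<exists>C. \<forall>f \<in> model_space \<theta> \<inter> Hinf.
      l2norm (P_theta \<theta> (\<lambda>t. \<phi> t * f t)) \<le> C * l2norm f)"

definition tto_ext ::
  "(real \<Rightarrow> complex) \<Rightarrow> (real \<Rightarrow> complex) \<Rightarrow> ((real \<Rightarrow> complex) \<Rightarrow> (real \<Rightarrow> complex)) \<Rightarrow> bool" where
  "tto_ext \<theta> \<phi> T \<longleftrightarrow>
     (\<forall>f \<in> model_space \<theta>. T f \<in> model_space \<theta>) \<and>
     (\<forall>f \<in> model_space \<theta>. \<forall>g \<in> model_space \<theta>. \<forall>a b.
        AE t in circ. T (\<lambda>s. a * f s + b * g s) t = a * T f t + b * T g t) \<and>
     (\<exists>C. \<forall>f \<in> model_space \<theta>. l2norm (T f) \<le> C * l2norm f) \<and>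
     (\<forall>f \<in> model_space \<theta> \<inter> Hinf. AE t in circ. T f t = P_theta \<theta> (\<lambda>s. \<phi> s * f s) t)"

definition is_adjoint_on ::
  "(real \<Rightarrow> complex) set \<Rightarrow> ((real \<Rightarrow> complex) \<Rightarrow> (real \<Rightarrow> complex)) \<Rightarrow>
   ((real \<Rightarrow> complex) \<Rightarrow> (real \<Rightarrow> complex)) \<Rightarrow> bool" where
  "is_adjoint_on K T S \<longleftrightarrow> (\<forall>g \<in> K. S g \<in> K) \<and>
     (\<forall>f \<in> K. \<forall>g \<in> K. l2inner (T f) g = l2inner f (S g))"

definition normal_on :: "(real \<Rightarrow> complex) set \<Rightarrow> ((real \<Rightarrow> complex) \<Rightarrow> (real \<Rightarrow> complex)) \<Rightarrow> bool" where
  "normal_on K T \<longleftrightarrow> (\<exists>S. is_adjoint_on K T S \<and>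
     (\<forall>f \<in> K. AE t in circ. S (T f) t = T (S f) t))"

end

theory Submission
  imports Defs
begin

text \<open>
  Write \<open>a = \<phi>\<^sub>1 - \<phi>\<^sub>1(0)\<close>, \<open>b = \<phi>\<^sub>2 - \<phi>\<^sub>2(0)\<close> and let \<open>T\<close> be the operator, \<open>S\<close> its adjoint, whose symbol
  is the conjugate one. For \<open>f\<close> in the model space with \<open>f(0) = 0\<close> and \<open>g = f / z\<close>,
  \<open>T f = z T g - \<langle>f, \<theta> cnj a\<rangle> \<theta> + \<langle>f, b\<rangle>\<close>, so that
  \<open>\<parallel>T f\<parallel>\<^sup>2 = \<parallel>T g\<parallel>\<^sup>2 - \<bar>\<langle>f, \<theta> cnj a\<rangle>\<bar>\<^sup>2 + \<bar>\<langle>f, b\<rangle>\<bar>\<^sup>2\<close>, and likewise for \<open>S\<close> with \<open>a\<close> and \<open>b\<close> exchanged.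
  If \<open>T\<close> is normal, subtracting the two identities shows that the rank two forms
  \<open>\<bar>\<langle>f, a\<rangle>\<bar>\<^sup>2 + \<bar>\<langle>f, \<theta> cnj a\<rangle>\<bar>\<^sup>2\<close> and \<open>\<bar>\<langle>f, b\<rangle>\<bar>\<^sup>2 + \<bar>\<langle>f, \<theta> cnj b\<rangle>\<bar>\<^sup>2\<close> coincide. Hence \<open>b = x a + y \<theta> cnj a\<close>, and
  comparing coefficients forces one of \<open>x\<close>, \<open>y\<close> to vanish and the other to be unimodular.
  Conversely, under either condition \<open>\<langle>T f, T g\<rangle> - \<langle>S f, S g\<rangle>\<close> is invariant under the backward shift,
  whose powers tend strongly to zero.
\<close>

subsection \<open>Square-integrable functions on the circle\<close>

text \<open>The symbol is only square integrable, so \<open>\<phi> f\<close> can leave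
  \<open>L2\<close> when \<open>f\<close> is unbounded. Operator identities are therefore proved by
  pairing with bounded \<open>k\<close> in the model space, for which \<open>cnj \<phi> * k\<close>
  is square integrable. This rests on the density of such \<open>k\<close>, which holds because
  projected monomials are bounded. The condition \<open>\<theta>(0) = 0\<close> puts the constants
  into the model space, so that subtracting values at 0 stays inside it, and makes 1 orthogonal to
  \<open>\<theta>\<close>. The middle term of the norm identity is negative because
  \<open>z T g\<close> is not orthogonal to \<open>\<theta>\<close>: their inner product is exactly
  the subtracted coefficient, which contributes 1 - 2. That identity concerns
  \<open>f(0) = 0\<close>. For the forward direction this suffices, since \<open>a\<close> and
  \<open>\<theta> cnj a\<close> vanish at 0 and serve as test vectors; for the converse the
  constants are treated separately through \<open>S T 1 = T S 1\<close>, a consequence of equal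
  moduli of \<open>a\<close> and \<open>b\<close> on the circle. Functions are not identified when
  equal almost everywhere, so linearity of the operators holds only up to null sets.\<close>

definition ce :: "int \<Rightarrow> real \<Rightarrow> complex" where
  "ce n t = exp (\<i> * of_int n * complex_of_real t)"

lemma norm_ce [simp]: "cmod (ce n t) = 1"
  unfolding ce_def by (metis (no_types, opaque_lifting) mult.assoc norm_exp_i_times of_real_mult of_real_of_int_eq)

lemma cnj_ce [simp]: "cnj (ce n t) = ce (- n) t"
  by (simp add: ce_def exp_cnj)

lemma ce_mult: "ce m t * ce n t = ce (m + n) t"
  by (simp add: ce_def exp_add[symmetric] algebra_simps)

lemma ce_0 [simp]: "ce 0 t = 1"
  by (simp add: ce_def)

lemma ce_uminus_mult [simp]: "ce (- n) t * ce n t = 1" "ce n t * ce (- n) t = 1"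
  by (simp_all add: ce_mult)

lemma space_circ [simp]: "space circ = {-pi..pi}"
  by (simp add: circ_def)

lemma finite_measure_circ: "finite_measure circ"
  unfolding circ_def by (rule finite_measure_lebesgue_on) simp

lemma measure_circ [simp]: "measure circ {-pi..pi} = 2 * pi"
  by (simp add: circ_def measure_restrict_space)

lemma continuous_on_ce [continuous_intros]: "continuous_on S (ce n)"
  unfolding ce_def by (intro continuous_intros)

lemma continuous_measurable_circ:
  fixes f :: "real \<Rightarrow> 'b::euclidean_space"
  shows "continuous_on UNIV f \<Longrightarrow> f \<in> borel_measurable circ"
  unfolding circ_def by (rule continuous_imp_measurable_on_sets_lebesgue) (auto intro: continuous_on_subset)

lemma ce_measurable [measurable]: "ce n \<in> borel_measurable circ"
  by (intro continuous_measurable_circ continuous_intros)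

lemma integrable_circ_bounded:
  fixes f :: "real \<Rightarrow> 'b::{banach, second_countable_topology}"
  assumes "f \<in> borel_measurable circ" "AE t in circ. norm (f t) \<le> C"
  shows "integrable circ f"
  using finite_measure.integrable_const_bound[OF finite_measure_circ assms(2,1)] .

lemma integral_ce: "(\<integral>t. ce n t \<partial>circ) = (if n = 0 then 2 * pi else 0)"
proof (cases "n = 0")
  case True
  then show ?thesis using finite_measure_circ
    by (simp add: scaleR_conv_of_real)
next
  case False
  have int: "integrable circ (ce n)"
    by (rule integrable_circ_bounded[where C=1]) auto
  have "((\<lambda>t. ce n t) has_integral (ce n pi / (\<i> * n) - ce n (-pi) / (\<i> * n))) {-pi..pi}"
  proof (rule fundamental_theorem_of_calculus)
    fix t :: real assume "t \<in> {-pi..pi}"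
    have "((\<lambda>z. exp (\<i> * of_int n * z) / (\<i> * n)) has_field_derivative
        ce n t) (at (complex_of_real t))"
      using False by (auto intro!: derivative_eq_intros simp: ce_def)
    then show "((\<lambda>t. ce n t / (\<i> * n)) has_vector_derivative ce n t) (at t within {-pi..pi})"
      unfolding ce_def by (rule has_vector_derivative_real_field)
  qed simp
  moreover have "ce n pi = ce n (-pi)"
  proof -
    have "\<i> * of_int n * complex_of_real pi = \<i> * of_int n * complex_of_real (-pi) + (2 * of_int n * pi) * \<i>"
      by (simp add: algebra_simps)
    then have "ce n pi = ce n (-pi) * exp ((2 * of_int n * pi) * \<i>)"
      by (simp only: ce_def exp_add)
    also have "exp ((2 * of_int n * pi) * \<i>) = 1"
      by (rule exp_integer_2pi) auto
    finally show ?thesis by simp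
  qed
  ultimately have "((\<lambda>t. ce n t) has_integral 0) {-pi..pi}" by simp
  moreover have "(\<integral>t. ce n t \<partial>circ) = integral {-pi..pi} (ce n)"
    using lebesgue_integral_eq_integral[of "{-pi..pi}" "ce n"] int by (simp add: circ_def)
  ultimately show ?thesis using False by (simp add: integral_unique)
qed

lemma L2_measurable [measurable_dest]: "f \<in> L2 \<Longrightarrow> f \<in> borel_measurable circ"
  by (simp add: L2_def)

lemma L2_integrable_sq: "f \<in> L2 \<Longrightarrow> integrable circ (\<lambda>t. (cmod (f t))\<^sup>2)"
  by (simp add: L2_def)

lemma L2_bound:
  assumes "f \<in> borel_measurable circ" "integrable circ g" "AE t in circ. (cmod (f t))\<^sup>2 \<le> g t"
  shows "f \<in> L2"
  unfolding L2_def using assms by (auto intro!: Bochner_Integration.integrable_bound[OF assms(2)])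

lemma L2_mult_bounded:
  assumes "f \<in> L2" and [measurable]: "g \<in> borel_measurable circ" and "AE t in circ. cmod (g t) \<le> C"
  shows "(\<lambda>t. f t * g t) \<in> L2" "(\<lambda>t. g t * f t) \<in> L2"
proof -
  have [measurable]: "f \<in> borel_measurable circ" using assms by measurable
  show *: "(\<lambda>t. f t * g t) \<in> L2"
  proof (rule L2_bound)
    show "integrable circ (\<lambda>t. C\<^sup>2 * (cmod (f t))\<^sup>2)"
      using L2_integrable_sq[OF assms(1)] by simp
    show "AE t in circ. (cmod (f t * g t))\<^sup>2 \<le> C\<^sup>2 * (cmod (f t))\<^sup>2"
      using assms(3) by eventually_elim
        (metis mult_right_mono norm_ge_zero norm_mult power_mono power_mult_distrib mult.commute zero_le_power2)
  qed simp
  then show "(\<lambda>t. g t * f t) \<in> L2" by (simp add: mult.commute)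
qed

lemma L2_bounded:
  assumes "g \<in> borel_measurable circ" and "AE t in circ. cmod (g t) \<le> C"
  shows "g \<in> L2"
proof (rule L2_bound[OF assms(1)])
  show "integrable circ (\<lambda>t. C\<^sup>2)"
    by (rule integrable_circ_bounded[where C="C\<^sup>2"]) auto
  show "AE t in circ. (cmod (g t))\<^sup>2 \<le> C\<^sup>2"
    using assms(2) by eventually_elim (auto intro!: power_mono)
qed

lemma L2_const [simp]: "(\<lambda>t. c) \<in> L2"
  by (rule L2_bounded[where C="cmod c"]) auto

lemma L2_ce [simp]: "ce n \<in> L2"
  by (rule L2_bounded[where C=1]) auto

lemma L2_add [intro]:
  assumes "f \<in> L2" "g \<in> L2"
  shows "(\<lambda>t. f t + g t) \<in> L2"
proof (rule L2_bound)
  show "integrable circ (\<lambda>t. 2 * (cmod (f t))\<^sup>2 + 2 * (cmod (g t))\<^sup>2)"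
    using assms L2_integrable_sq by simp
  have "(cmod (z + w))\<^sup>2 \<le> 2 * (cmod z)\<^sup>2 + 2 * (cmod w)\<^sup>2" for z w
  proof -
    have "(cmod (z + w))\<^sup>2 \<le> (cmod z + cmod w)\<^sup>2"
      by (intro power_mono norm_triangle_ineq) simp
    also have "\<dots> \<le> 2 * (cmod z)\<^sup>2 + 2 * (cmod w)\<^sup>2"
      using sum_squares_bound[of "cmod z" "cmod w"] by (simp add: power2_sum)
    finally show ?thesis .
  qed
  then show "AE t in circ. (cmod (f t + g t))\<^sup>2 \<le> 2 * (cmod (f t))\<^sup>2 + 2 * (cmod (g t))\<^sup>2"
    by simp
qed (use assms in measurable)

lemma L2_cmult [intro]: "f \<in> L2 \<Longrightarrow> (\<lambda>t. c * f t) \<in> L2"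
  by (rule L2_mult_bounded(2)[where C="cmod c"]) auto

lemma L2_uminus [intro]: "f \<in> L2 \<Longrightarrow> (\<lambda>t. - f t) \<in> L2"
  using L2_cmult[of f "-1"] by simp

lemma L2_diff [intro]: "f \<in> L2 \<Longrightarrow> g \<in> L2 \<Longrightarrow> (\<lambda>t. f t - g t) \<in> L2"
  using L2_add[of f "\<lambda>t. - g t"] L2_uminus[of g] by simp

lemma L2_cnj [intro]: "f \<in> L2 \<Longrightarrow> (\<lambda>t. cnj (f t)) \<in> L2"
  unfolding L2_def by (auto intro: borel_measurable_continuous_onI[THEN measurable_compose_rev] continuous_intros)

lemma L2_cnj_iff [simp]: "(\<lambda>t. cnj (f t)) \<in> L2 \<longleftrightarrow> f \<in> L2"
  using L2_cnj[of f] L2_cnj[of "\<lambda>t. cnj (f t)"] by auto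

lemma L2_mult_ce [intro]: "f \<in> L2 \<Longrightarrow> (\<lambda>t. ce n t * f t) \<in> L2"  "f \<in> L2 \<Longrightarrow> (\<lambda>t. f t * ce n t) \<in> L2"
  by (rule L2_mult_bounded[where C=1]; simp)+

lemma L2_mult_integrable:
  assumes "f \<in> L2" "g \<in> L2"
  shows "integrable circ (\<lambda>t. f t * g t)"
proof (rule Bochner_Integration.integrable_bound)
  show "integrable circ (\<lambda>t. (cmod (f t))\<^sup>2 + (cmod (g t))\<^sup>2)"
    using assms L2_integrable_sq by simp
  have "cmod (z * w) \<le> norm ((cmod z)\<^sup>2 + (cmod w)\<^sup>2)" for z w
  proof -
    have "2 * (cmod z * cmod w) \<le> (cmod z)\<^sup>2 + (cmod w)\<^sup>2"
      using sum_squares_bound[of "cmod z" "cmod w"] by simp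
    moreover have "0 \<le> cmod z * cmod w" by simp
    ultimately show ?thesis unfolding norm_mult real_norm_def by linarith
  qed
  then show "AE t in circ. cmod (f t * g t) \<le> norm ((cmod (f t))\<^sup>2 + (cmod (g t))\<^sup>2)"
    by simp
qed (use assms in measurable)

lemma L2_integrable: "f \<in> L2 \<Longrightarrow> integrable circ f"
  using L2_mult_integrable[of f "\<lambda>_. 1"] by simp

lemma l2inner_cong:
  "(\<And>t. f t * cnj (g t) = f' t * cnj (g' t)) \<Longrightarrow> l2inner f g = l2inner f' g'"
  by (simp add: l2inner_def)

lemma l2inner_cong_AE:
  assumes "AE t in circ. f t = f' t" "AE t in circ. g t = g' t"
    "f \<in> L2" "g \<in> L2" "f' \<in> L2" "g' \<in> L2"
  shows "l2inner f g = l2inner f' g'"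
proof -
  have "(\<integral>t. f t * cnj (g t) \<partial>circ) = (\<integral>t. f' t * cnj (g' t) \<partial>circ)"
    by (rule integral_cong_AE) (use assms in \<open>auto intro!: borel_measurable_integrable L2_mult_integrable\<close>)
  then show ?thesis by (simp add: l2inner_def)
qed

lemma fourier_eq: "fourier f n = l2inner f (ce n)"
  by (simp add: fourier_def l2inner_def ce_def exp_cnj)

lemma l2inner_commute: "l2inner f g = cnj (l2inner g f)"
  unfolding l2inner_def complex_cnj_mult Bochner_Integration.integral_cnj[symmetric] by (simp add: mult.commute)

lemma l2inner_add_left:
  "f \<in> L2 \<Longrightarrow> g \<in> L2 \<Longrightarrow> h \<in> L2 \<Longrightarrow> l2inner (\<lambda>t. f t + g t) h = l2inner f h + l2inner g h"
  by (simp add: l2inner_def distrib_right distrib_left L2_mult_integrable)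

lemma l2inner_diff_left:
  "f \<in> L2 \<Longrightarrow> g \<in> L2 \<Longrightarrow> h \<in> L2 \<Longrightarrow> l2inner (\<lambda>t. f t - g t) h = l2inner f h - l2inner g h"
  by (simp add: l2inner_def left_diff_distrib right_diff_distrib L2_mult_integrable)

lemma l2inner_scale_left: "l2inner (\<lambda>t. c * f t) h = c * l2inner f h"
  by (simp add: l2inner_def mult.assoc)

lemma l2inner_add_right:
  "f \<in> L2 \<Longrightarrow> g \<in> L2 \<Longrightarrow> h \<in> L2 \<Longrightarrow> l2inner f (\<lambda>t. g t + h t) = l2inner f g + l2inner f h"
  by (simp add: l2inner_def distrib_right distrib_left L2_mult_integrable)

lemma l2inner_diff_right:
  "f \<in> L2 \<Longrightarrow> g \<in> L2 \<Longrightarrow> h \<in> L2 \<Longrightarrow> l2inner f (\<lambda>t. g t - h t) = l2inner f g - l2inner f h"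
  by (simp add: l2inner_def left_diff_distrib right_diff_distrib L2_mult_integrable)

lemma l2inner_scale_right: "l2inner f (\<lambda>t. c * h t) = cnj c * l2inner f h"
  by (subst (1 2) l2inner_commute) (simp add: l2inner_scale_left)

lemma l2inner_const_right: "l2inner f (\<lambda>t. c) = cnj c * l2inner f (ce 0)"
  using l2inner_scale_right[of f c "ce 0"] by simp

lemma l2inner_zero [simp]: "l2inner (\<lambda>t. 0) f = 0" "l2inner f (\<lambda>t. 0) = 0"
  by (simp_all add: l2inner_def)

lemmas l2inner_simps = l2inner_add_left l2inner_diff_left l2inner_scale_left
  l2inner_add_right l2inner_diff_right l2inner_scale_right

lemma l2norm_nonneg [simp]: "0 \<le> l2norm f"
  by (simp add: l2norm_def)

lemma l2norm_sq: "(l2norm f)\<^sup>2 = (1 / (2 * pi)) * (\<integral>t. (cmod (f t))\<^sup>2 \<partial>circ)"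
  by (simp add: l2norm_def)

lemma l2inner_self: "l2inner f f = of_real ((l2norm f)\<^sup>2)"
proof -
  have "(\<integral>t. f t * cnj (f t) \<partial>circ) = (\<integral>t. complex_of_real ((cmod (f t))\<^sup>2) \<partial>circ)"
    by (simp only: complex_norm_square)
  also have "\<dots> = of_real (\<integral>t. (cmod (f t))\<^sup>2 \<partial>circ)" by (rule integral_complex_of_real)
  finally show ?thesis by (simp add: l2inner_def l2norm_sq)
qed

lemma l2norm_eq_0_iff:
  assumes "f \<in> L2"
  shows "l2norm f = 0 \<longleftrightarrow> (AE t in circ. f t = 0)"
proof -
  have "l2norm f = 0 \<longleftrightarrow> (\<integral>t. (cmod (f t))\<^sup>2 \<partial>circ) = 0"
    by (simp add: l2norm_def)
  also have "\<dots> \<longleftrightarrow> (AE t in circ. (cmod (f t))\<^sup>2 = 0)"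
    by (rule integral_nonneg_eq_0_iff_AE) (use assms in \<open>auto intro: L2_integrable_sq\<close>)
  finally show ?thesis by simp
qed

lemma l2norm_add_sq:
  assumes "f \<in> L2" "g \<in> L2"
  shows "(l2norm (\<lambda>t. f t + g t))\<^sup>2 = (l2norm f)\<^sup>2 + (l2norm g)\<^sup>2 + 2 * Re (l2inner f g)"
proof -
  have "complex_of_real ((l2norm (\<lambda>t. f t + g t))\<^sup>2) = l2inner (\<lambda>t. f t + g t) (\<lambda>t. f t + g t)"
    by (simp only: l2inner_self)
  also have "\<dots> = l2inner f f + l2inner g g + (l2inner f g + cnj (l2inner f g))"
    using assms l2inner_commute[of g f] by (simp add: l2inner_simps L2_add)
  also have "\<dots> = of_real ((l2norm f)\<^sup>2 + (l2norm g)\<^sup>2 + 2 * Re (l2inner f g))"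
    by (simp add: l2inner_self complex_add_cnj)
  finally show ?thesis using of_real_eq_iff by blast
qed

lemma l2norm_scale: "l2norm (\<lambda>t. c * f t) = cmod c * l2norm f"
proof -
  have "(l2norm (\<lambda>t. c * f t))\<^sup>2 = (cmod c * l2norm f)\<^sup>2"
    unfolding l2norm_sq power_mult_distrib by (simp add: norm_mult power_mult_distrib)
  then show ?thesis by (simp add: power2_eq_iff_nonneg)
qed

lemma l2norm_cong_cmod: "(\<And>t. cmod (f t) = cmod (g t)) \<Longrightarrow> l2norm f = l2norm g"
  by (simp add: l2norm_def)

lemma l2norm_cong_AE:
  assumes "AE t in circ. f t = g t" "f \<in> L2" "g \<in> L2"
  shows "l2norm f = l2norm g"
  using l2inner_cong_AE[OF assms(1,1,2,2,3,3)]
  by (metis l2inner_self l2norm_nonneg of_real_eq_iff power2_eq_imp_eq)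

text \<open>Expand the squared norm of \<open>f - s w g\<close> with \<open>w = l2inner f g\<close>
  and real \<open>s\<close>: the factor \<open>w\<close> makes the cross term real, leaving a
  nonnegative real polynomial in \<open>s\<close>.\<close>

lemma Cauchy_Schwarz:
  assumes "f \<in> L2" "g \<in> L2"
  shows "cmod (l2inner f g) \<le> l2norm f * l2norm g"
proof -
  define w where "w = l2inner f g"
  define r where "r = (l2norm g)\<^sup>2"
  have pos: "0 \<le> (l2norm f)\<^sup>2 + s\<^sup>2 * (cmod w)\<^sup>2 * r - 2 * s * (cmod w)\<^sup>2" for s :: real
  proof -
    have "(l2norm (\<lambda>t. f t + (- (of_real s * w)) * g t))\<^sup>2
      = (l2norm f)\<^sup>2 + (cmod (of_real s * w) * l2norm g)\<^sup>2 + 2 * Re (l2inner f (\<lambda>t. (- (of_real s * w)) * g t))"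
      using assms by (subst l2norm_add_sq) (auto simp only: L2_cmult l2norm_scale norm_minus_cancel)
    moreover have "l2inner f (\<lambda>t. (- (of_real s * w)) * g t) = - of_real (s * (cmod w)\<^sup>2)"
      unfolding l2inner_scale_right w_def[symmetric] using complex_norm_square[of w]
      by (simp add: mult_ac)
    ultimately have "(l2norm (\<lambda>t. f t + (- (of_real s * w)) * g t))\<^sup>2
      = (l2norm f)\<^sup>2 + s\<^sup>2 * (cmod w)\<^sup>2 * r - 2 * s * (cmod w)\<^sup>2"
      by (simp only: r_def Re_complex_of_real uminus_complex.simps norm_mult power_mult_distrib norm_of_real power2_abs)
    then show ?thesis by (metis zero_le_power2)
  qed
  have "(cmod w)\<^sup>2 \<le> (l2norm f)\<^sup>2 * r"
  proof (cases "r = 0")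
    case True
    show ?thesis
    proof (cases "w = 0")
      case False
      \<comment> \<open>For \<open>r = 0\<close> the polynomial is affine in \<open>s\<close>; this
        value pushes it down to \<open>- (l2norm f)\<^sup>2 - 2\<close>.\<close>
      have "0 \<le> (l2norm f)\<^sup>2 - 2 * (((l2norm f)\<^sup>2 + 1) / (cmod w)\<^sup>2) * (cmod w)\<^sup>2"
        using pos[of "((l2norm f)\<^sup>2 + 1) / (cmod w)\<^sup>2"] True by simp
      then have "0 \<le> - (l2norm f)\<^sup>2 - 2" using False by simp
      then show ?thesis by (smt (verit) zero_le_power2)
    qed (simp add: r_def)
  next
    case False
    then have r: "r > 0" by (simp add: r_def)
    \<comment> \<open>The value \<open>1 / r\<close> minimises the quadratic.\<close>
    have "0 \<le> (l2norm f)\<^sup>2 - (cmod w)\<^sup>2 / r"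
      using pos[of "1 / r"] r by (simp add: power2_eq_square field_simps)
    then show ?thesis using r by (simp add: field_simps)
  qed
  then have "(cmod w)\<^sup>2 \<le> (l2norm f * l2norm g)\<^sup>2" by (simp add: r_def power_mult_distrib)
  then show ?thesis unfolding w_def by (rule power2_le_imp_le) simp
qed

lemma l2norm_triangle:
  assumes "f \<in> L2" "g \<in> L2"
  shows "l2norm (\<lambda>t. f t + g t) \<le> l2norm f + l2norm g"
proof (rule power2_le_imp_le)
  have "Re (l2inner f g) \<le> l2norm f * l2norm g"
    using Cauchy_Schwarz[OF assms] complex_Re_le_cmod order_trans by blast
  then show "(l2norm (\<lambda>t. f t + g t))\<^sup>2 \<le> (l2norm f + l2norm g)\<^sup>2"
    using assms by (simp add: l2norm_add_sq power2_sum)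
qed simp

lemma l2norm_minus_commute: "l2norm (\<lambda>t. f t - g t) = l2norm (\<lambda>t. g t - f t)"
  by (rule l2norm_cong_cmod) (rule norm_minus_commute)

lemma l2norm_triangle_sub:
  assumes "f \<in> L2" "g \<in> L2"
  shows "l2norm f \<le> l2norm g + l2norm (\<lambda>t. f t - g t)"
  using l2norm_triangle[of g "\<lambda>t. f t - g t"] assms by (auto simp: L2_diff)

lemma l2inner_ce: "l2inner (ce m) (ce n) = (if m = n then 1 else 0)"
  by (simp add: l2inner_def ce_mult integral_ce)

subsection \<open>Completeness and the Riesz representation theorem\<close>

text \<open>Cauchy-Schwarz against the constant 1. The factor \<open>2 * pi\<close> appears because
  \<open>l2norm\<close> is normalised and the integral is not.\<close>

lemma L1_le_l2norm:
  assumes "f \<in> L2"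
  shows "(\<integral>t. cmod (f t) \<partial>circ) \<le> 2 * pi * l2norm f"
proof -
  let ?a = "\<lambda>t. complex_of_real (cmod (f t))"
  have "?a \<in> L2"
    using assms unfolding L2_def by (auto intro!: borel_measurable_of_real)
  then have "cmod (l2inner ?a (ce 0)) \<le> l2norm ?a * l2norm (ce 0)"
    by (rule Cauchy_Schwarz) simp
  moreover have "l2norm ?a = l2norm f"
    by (rule l2norm_cong_cmod) simp
  moreover have "l2norm (ce 0) = 1"
    using finite_measure_circ by (simp add: l2norm_def)
  moreover have "l2inner ?a (ce 0) = of_real ((\<integral>t. cmod (f t) \<partial>circ) / (2 * pi))"
    by (simp add: l2inner_def)
  ultimately have "\<bar>(\<integral>t. cmod (f t) \<partial>circ) / (2 * pi)\<bar> \<le> l2norm f"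
    by (metis mult.right_neutral norm_of_real)
  then have "(\<integral>t. cmod (f t) \<partial>circ) / (2 * pi) \<le> l2norm f" by linarith
  then show ?thesis by (simp add: field_simps)
qed

lemma nn_integral_sq:
  assumes "f \<in> L2"
  shows "(\<integral>\<^sup>+t. ennreal ((cmod (f t))\<^sup>2) \<partial>circ) = ennreal (2 * pi * (l2norm f)\<^sup>2)"
  using nn_integral_eq_integral[OF L2_integrable_sq[OF assms]] by (simp add: l2norm_sq)

text \<open>Riesz-Fischer: the sequence is also Cauchy in the integral norm, hence a subsequence
  converges almost everywhere, and Fatou's lemma along it bounds the distance to the pointwise
  limit.\<close>

lemma L2_complete:
  assumes f: "\<And>n. f n \<in> L2"
    and cauchy: "\<And>\<epsilon>. \<epsilon> > 0 \<Longrightarrow> \<exists>N. \<forall>m\<ge>N. \<forall>n\<ge>N. l2norm (\<lambda>t. f m t - f n t) < \<epsilon>"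
  obtains g where "g \<in> L2" "(\<lambda>n. l2norm (\<lambda>t. f n t - g t)) \<longlonglongrightarrow> 0"
proof -
  have [measurable]: "f n \<in> borel_measurable circ" for n using f by measurable
  have "\<exists>N. \<forall>i\<ge>N. \<forall>j\<ge>N. (\<integral>t. norm (f i t - f j t) \<partial>circ) < \<epsilon>" if "\<epsilon> > 0" for \<epsilon>
  proof -
    obtain N where N: "\<forall>m\<ge>N. \<forall>n\<ge>N. l2norm (\<lambda>t. f m t - f n t) < \<epsilon> / (2 * pi)"
      using cauchy[of "\<epsilon> / (2 * pi)"] \<open>\<epsilon> > 0\<close> by auto
    have "(\<integral>t. norm (f i t - f j t) \<partial>circ) < \<epsilon>" if "i \<ge> N" "j \<ge> N" for i j
    proof -
      have "(\<integral>t. norm (f i t - f j t) \<partial>circ) \<le> 2 * pi * l2norm (\<lambda>t. f i t - f j t)"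
        by (rule L1_le_l2norm) (intro L2_diff f)
      also have "\<dots> < \<epsilon>" using N that by (simp add: field_simps)
      finally show ?thesis .
    qed
    then show ?thesis by blast
  qed
  then obtain r where r: "strict_mono r" "AE t in circ. Cauchy (\<lambda>i. f (r i) t)"
    using cauchy_L1_AE_cauchy_subseq[of circ f] L2_integrable[OF f] by blast
  \<comment> \<open>Where the subsequence diverges \<open>lim\<close> is an unspecified value; this
    concerns a null set only.\<close>
  define g where "g t = lim (\<lambda>i. f (r i) t)" for t
  have [measurable]: "g \<in> borel_measurable circ"
    unfolding g_def by measurable
  have lim: "AE t in circ. (\<lambda>i. f (r i) t) \<longlonglongrightarrow> g t"
    using r(2) by eventually_elim (simp add: g_def Cauchy_convergent convergent_LIMSEQ_iff[symmetric])
  have key: "\<exists>N. \<forall>n\<ge>N. (\<integral>\<^sup>+t. ennreal ((cmod (f n t - g t))\<^sup>2) \<partial>circ) \<le> ennreal (2 * pi * \<epsilon>\<^sup>2)"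
    if "\<epsilon> > 0" for \<epsilon>
  proof -
    obtain N where N: "\<forall>m\<ge>N. \<forall>n\<ge>N. l2norm (\<lambda>t. f m t - f n t) < \<epsilon>"
      using cauchy[OF \<open>\<epsilon> > 0\<close>] by auto
    have "(\<integral>\<^sup>+t. ennreal ((cmod (f n t - g t))\<^sup>2) \<partial>circ) \<le> ennreal (2 * pi * \<epsilon>\<^sup>2)" if "n \<ge> N" for n
    proof -
      have "(\<integral>\<^sup>+t. ennreal ((cmod (f n t - g t))\<^sup>2) \<partial>circ)
        = (\<integral>\<^sup>+t. liminf (\<lambda>i. ennreal ((cmod (f n t - f (r i) t))\<^sup>2)) \<partial>circ)"
      proof (rule nn_integral_cong_AE)
        show "AE t in circ. ennreal ((cmod (f n t - g t))\<^sup>2)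
            = liminf (\<lambda>i. ennreal ((cmod (f n t - f (r i) t))\<^sup>2))"
          using lim
        proof eventually_elim
          case (elim t)
          then have "(\<lambda>i. ennreal ((cmod (f n t - f (r i) t))\<^sup>2)) \<longlonglongrightarrow> ennreal ((cmod (f n t - g t))\<^sup>2)"
            by (intro tendsto_intros tendsto_ennrealI)
          then show ?case by (rule lim_imp_Liminf[symmetric, rotated]) simp
        qed
      qed
      also have "\<dots> \<le> liminf (\<lambda>i. \<integral>\<^sup>+t. ennreal ((cmod (f n t - f (r i) t))\<^sup>2) \<partial>circ)"
        by (rule nn_integral_liminf) measurable
      also have "\<dots> \<le> liminf (\<lambda>i. ennreal (2 * pi * \<epsilon>\<^sup>2))"
      proof (rule Liminf_mono)
        show "\<forall>\<^sub>F i in sequentially. (\<integral>\<^sup>+t. ennreal ((cmod (f n t - f (r i) t))\<^sup>2) \<partial>circ) \<le> ennreal (2 * pi * \<epsilon>\<^sup>2)"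
          unfolding eventually_sequentially
        proof (intro exI[of _ N] allI impI)
          fix i assume "N \<le> i"
          then have "N \<le> r i" using seq_suble[OF r(1), of i] by simp
          then have "l2norm (\<lambda>t. f n t - f (r i) t) \<le> \<epsilon>" using N that less_imp_le by blast
          then show "(\<integral>\<^sup>+t. ennreal ((cmod (f n t - f (r i) t))\<^sup>2) \<partial>circ) \<le> ennreal (2 * pi * \<epsilon>\<^sup>2)"
            by (subst nn_integral_sq) (auto intro!: L2_diff f ennreal_leI mult_left_mono power_mono)
        qed
      qed
      finally show ?thesis by (simp add: Liminf_const)
    qed
    then show ?thesis by blast
  qed
  \<comment> \<open>Membership of the difference in \<open>L2\<close> is extracted from the
    finiteness of its nonnegative integral.\<close>
  have L2d: "(\<lambda>t. h t - g t) \<in> L2" "l2norm (\<lambda>t. h t - g t) \<le> \<epsilon>"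
    if "(\<integral>\<^sup>+t. ennreal ((cmod (h t - g t))\<^sup>2) \<partial>circ) \<le> ennreal (2 * pi * \<epsilon>\<^sup>2)" "h \<in> L2" "\<epsilon> > 0" for h \<epsilon>
  proof -
    have [measurable]: "h \<in> borel_measurable circ" using that(2) by measurable
    show *: "(\<lambda>t. h t - g t) \<in> L2"
      unfolding L2_def using that(1)
      by (auto intro!: integrableI_nonneg simp: less_top[symmetric] top_unique)
    have "2 * pi * (l2norm (\<lambda>t. h t - g t))\<^sup>2 \<le> 2 * pi * \<epsilon>\<^sup>2"
      using that(1) unfolding nn_integral_sq[OF *] by (subst (asm) ennreal_le_iff) auto
    then have "(l2norm (\<lambda>t. h t - g t))\<^sup>2 \<le> \<epsilon>\<^sup>2" by simp
    then show "l2norm (\<lambda>t. h t - g t) \<le> \<epsilon>" using that(3) by (simp add: power2_le_iff_abs_le)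
  qed
  obtain N where "\<forall>n\<ge>N. (\<integral>\<^sup>+t. ennreal ((cmod (f n t - g t))\<^sup>2) \<partial>circ) \<le> ennreal (2 * pi * 1\<^sup>2)"
    using key[of 1] by auto
  then have "(\<lambda>t. f N t - (f N t - g t)) \<in> L2"
    by (intro L2_diff f L2d(1)[of "f N" 1]) auto
  then have "g \<in> L2" by simp
  moreover have "(\<lambda>n. l2norm (\<lambda>t. f n t - g t)) \<longlonglongrightarrow> 0"
  proof (rule LIMSEQ_I)
    fix \<epsilon> :: real assume "\<epsilon> > 0"
    then obtain N where "\<forall>n\<ge>N. (\<integral>\<^sup>+t. ennreal ((cmod (f n t - g t))\<^sup>2) \<partial>circ) \<le> ennreal (2 * pi * (\<epsilon>/2)\<^sup>2)"
      using key[of "\<epsilon> / 2"] by auto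
    then have "\<forall>n\<ge>N. l2norm (\<lambda>t. f n t - g t) \<le> \<epsilon> / 2"
      using L2d(2)[OF _ f, of _ "\<epsilon> / 2"] \<open>\<epsilon> > 0\<close> by auto
    then show "\<exists>N. \<forall>n\<ge>N. norm (l2norm (\<lambda>t. f n t - g t) - 0) < \<epsilon>"
      using \<open>\<epsilon> > 0\<close> by (intro exI[of _ N]) (auto simp: field_simps)
  qed
  ultimately show ?thesis using that by blast
qed

section \<open>Subspaces, closures and orthogonality\<close>

definition l2_subspace :: "(real \<Rightarrow> complex) set \<Rightarrow> bool" where
  "l2_subspace D \<longleftrightarrow> D \<subseteq> L2 \<and> (\<lambda>t. 0) \<in> D \<and> (\<forall>f\<in>D. \<forall>g\<in>D. (\<lambda>t. f t + g t) \<in> D)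
     \<and> (\<forall>c. \<forall>f\<in>D. (\<lambda>t. c * f t) \<in> D)"

definition l2_closure :: "(real \<Rightarrow> complex) set \<Rightarrow> (real \<Rightarrow> complex) set" where
  "l2_closure D = {f \<in> L2. \<forall>\<epsilon>>0. \<exists>d\<in>D. l2norm (\<lambda>t. f t - d t) < \<epsilon>}"

lemma l2_subspaceD:
  assumes "l2_subspace D" "f \<in> D"
  shows "f \<in> L2" "g \<in> D \<Longrightarrow> (\<lambda>t. f t + g t) \<in> D" "(\<lambda>t. c * f t) \<in> D"
    "g \<in> D \<Longrightarrow> (\<lambda>t. f t - g t) \<in> D"
proof -
  show *: "f \<in> L2" "g \<in> D \<Longrightarrow> (\<lambda>t. f t + g t) \<in> D" "(\<lambda>t. c * f t) \<in> D" for c g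
    using assms unfolding l2_subspace_def by auto
  assume "g \<in> D"
  then have "(\<lambda>t. -1 * g t) \<in> D" using assms(1) unfolding l2_subspace_def by blast
  from *(2)[OF this] show "(\<lambda>t. f t - g t) \<in> D" by simp
qed

lemma l2_closure_subset_L2: "f \<in> l2_closure D \<Longrightarrow> f \<in> L2"
  by (simp add: l2_closure_def)

lemma l2_closure_seq:
  assumes "f \<in> l2_closure D"
  obtains d where "\<And>n. d n \<in> D" "(\<lambda>n. l2norm (\<lambda>t. f t - d n t)) \<longlonglongrightarrow> 0"
proof -
  have "\<exists>d\<in>D. l2norm (\<lambda>t. f t - d t) < 1 / Suc n" for n
    using assms unfolding l2_closure_def by auto
  then obtain d where d: "\<And>n. d n \<in> D" "\<And>n. l2norm (\<lambda>t. f t - d n t) < 1 / Suc n"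
    by metis
  have "(\<lambda>n. l2norm (\<lambda>t. f t - d n t)) \<longlonglongrightarrow> 0"
    by (rule tendsto_sandwich[OF _ _ tendsto_const LIMSEQ_inverse_real_of_nat])
      (auto intro!: always_eventually less_imp_le[OF d(2)] simp: inverse_eq_divide simp del: of_nat_Suc)
  with d show ?thesis using that by blast
qed

lemma l2inner_tendsto:
  assumes "f \<in> L2" "\<And>n. d n \<in> L2" "(\<lambda>n. l2norm (\<lambda>t. f t - d n t)) \<longlonglongrightarrow> 0" "g \<in> L2"
  shows "(\<lambda>n. l2inner (d n) g) \<longlonglongrightarrow> l2inner f g" "(\<lambda>n. l2inner g (d n)) \<longlonglongrightarrow> l2inner g f"
proof -
  have "(\<lambda>n. l2inner (d n) g - l2inner f g) \<longlonglongrightarrow> 0"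
  proof (rule Lim_null_comparison)
    show "\<forall>\<^sub>F n in sequentially. norm (l2inner (d n) g - l2inner f g) \<le> l2norm (\<lambda>t. f t - d n t) * l2norm g"
    proof (intro always_eventually allI)
      fix n
      have "l2inner (d n) g - l2inner f g = l2inner (\<lambda>t. d n t - f t) g"
        using assms by (simp add: l2inner_simps)
      then show "norm (l2inner (d n) g - l2inner f g) \<le> l2norm (\<lambda>t. f t - d n t) * l2norm g"
        using Cauchy_Schwarz[of "\<lambda>t. d n t - f t" g] assms l2norm_minus_commute[of f "d n"] by (simp add: L2_diff)
    qed
    show "(\<lambda>n. l2norm (\<lambda>t. f t - d n t) * l2norm g) \<longlonglongrightarrow> 0"
      using tendsto_mult_left_zero[OF assms(3)] by simp
  qed
  then show *: "(\<lambda>n. l2inner (d n) g) \<longlonglongrightarrow> l2inner f g" by (rule LIM_zero_cancel)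
  show "(\<lambda>n. l2inner g (d n)) \<longlonglongrightarrow> l2inner g f"
    using tendsto_cnj[OF *] by (simp add: l2inner_commute[symmetric])
qed

lemma l2norm_tendsto:
  assumes "f \<in> L2" "\<And>n. d n \<in> L2" "(\<lambda>n. l2norm (\<lambda>t. f t - d n t)) \<longlonglongrightarrow> 0"
  shows "(\<lambda>n. l2norm (d n)) \<longlonglongrightarrow> l2norm f"
proof -
  have "(\<lambda>n. l2norm (d n) - l2norm f) \<longlonglongrightarrow> 0"
  proof (rule Lim_null_comparison[OF _ assms(3)], intro always_eventually allI)
    fix n
    show "norm (l2norm (d n) - l2norm f) \<le> l2norm (\<lambda>t. f t - d n t)"
      using l2norm_triangle_sub[of f "d n"] l2norm_triangle_sub[of "d n" f] assms
        l2norm_minus_commute[of f "d n"] by auto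
  qed
  then show ?thesis by (rule LIM_zero_cancel)
qed

lemma l2inner_closure_eq_0:
  assumes "f \<in> l2_closure D" "D \<subseteq> L2" "g \<in> L2" "\<And>d. d \<in> D \<Longrightarrow> l2inner d g = 0"
  shows "l2inner f g = 0"
proof -
  obtain d where d: "\<And>n. d n \<in> D" "(\<lambda>n. l2norm (\<lambda>t. f t - d n t)) \<longlonglongrightarrow> 0"
    using l2_closure_seq[OF assms(1)] by blast
  have "(\<lambda>n. l2inner (d n) g) \<longlonglongrightarrow> l2inner f g"
    using d assms l2_closure_subset_L2 by (intro l2inner_tendsto) auto
  then show ?thesis using assms(4)[OF d(1)] by (simp add: LIMSEQ_const_iff)
qed

text \<open>The representing vector is the limit of a minimising sequence of \<open>\<parallel>k\<parallel>\<^sup>2 - 2 Re (F k)\<close>.\<close>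

lemma Riesz_representation:
  assumes D: "l2_subspace D"
    and F_add: "\<And>k l. k \<in> D \<Longrightarrow> l \<in> D \<Longrightarrow> F (\<lambda>t. k t + l t) = F k + F l"
    and F_scale: "\<And>c k. k \<in> D \<Longrightarrow> F (\<lambda>t. c * k t) = c * F k"
    and F_bound: "\<And>k. k \<in> D \<Longrightarrow> cmod (F k) \<le> C * l2norm k"
  obtains h where "h \<in> l2_closure D" "\<And>k. k \<in> D \<Longrightarrow> F k = l2inner k h"
proof -
  have DL: "\<And>k. k \<in> D \<Longrightarrow> k \<in> L2" and D_add: "\<And>k l. k \<in> D \<Longrightarrow> l \<in> D \<Longrightarrow> (\<lambda>t. k t + l t) \<in> D"
    and D_scale: "\<And>c k. k \<in> D \<Longrightarrow> (\<lambda>t. c * k t) \<in> D" and D_zero: "(\<lambda>t. 0) \<in> D"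
    using D unfolding l2_subspace_def by auto
  define q where "q k = (l2norm k)\<^sup>2 - 2 * Re (F k)" for k
  define m where "m = Inf (q ` D)"
  \<comment> \<open>Completing the square:
    \<open>q k \<ge> (l2norm k - C)\<^sup>2 - C\<^sup>2\<close>.\<close>
  have q_lower: "- C\<^sup>2 \<le> q k" if "k \<in> D" for k
  proof -
    have "Re (F k) \<le> C * l2norm k"
      using F_bound[OF that] complex_Re_le_cmod order_trans by blast
    moreover have "0 \<le> (l2norm k - C)\<^sup>2" by simp
    ultimately show ?thesis unfolding q_def power2_diff by (simp add: algebra_simps)
  qed
  have m_le: "m \<le> q k" if "k \<in> D" for k
    unfolding m_def using that q_lower by (intro cInf_lower) (auto intro!: bdd_belowI)
  have "\<exists>k\<in>D. q k < m + 1 / Suc n" for n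
    using cInf_lessD[of "q ` D" "m + 1 / Suc n"] D_zero unfolding m_def by auto
  then obtain k where k: "\<And>n. k n \<in> D" "\<And>n. q (k n) < m + 1 / Suc n"
    by metis
  \<comment> \<open>Parallelogram law: the midpoint \<open>z\<close> lies in \<open>D\<close>, so
    \<open>m \<le> q z\<close>, which bounds the distance of two near-minimisers.\<close>
  have par: "(l2norm (\<lambda>t. x t - y t))\<^sup>2 \<le> 2 * (q x + q y - 2 * m)" if "x \<in> D" "y \<in> D" for x y
  proof -
    define z where "z = (\<lambda>t. (1 / 2) * (x t + y t))"
    have z: "z \<in> D" unfolding z_def using that by (intro D_scale D_add)
    have "F z = (1 / 2) * (F x + F y)"
      unfolding z_def using F_scale[OF D_add[OF that], of "1 / 2"] F_add[OF that] by simp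
    then have "2 * F z = F x + F y" by (simp add: mult.commute)
    then have "2 * Re (F z) = Re (F x) + Re (F y)"
      by (metis mult_2 plus_complex.simps(1))
    moreover have "4 * (l2norm z)\<^sup>2 = (l2norm x)\<^sup>2 + (l2norm y)\<^sup>2 + 2 * Re (l2inner x y)"
      unfolding z_def l2norm_scale power_mult_distrib l2norm_add_sq[OF DL[OF that(1)] DL[OF that(2)]]
      by (simp add: power_divide)
    moreover have "(l2norm (\<lambda>t. x t - y t))\<^sup>2 = (l2norm x)\<^sup>2 + (l2norm y)\<^sup>2 - 2 * Re (l2inner x y)"
      using l2norm_add_sq[OF DL[OF that(1)] L2_cmult[OF DL[OF that(2)]], of "-1"]
        l2norm_scale[of "-1" y] l2inner_scale_right[of x "-1" y] by simp
    ultimately show ?thesis using m_le[OF z] unfolding q_def by argo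
  qed
  have "\<exists>N. \<forall>i\<ge>N. \<forall>j\<ge>N. l2norm (\<lambda>t. k i t - k j t) < \<epsilon>" if "\<epsilon> > 0" for \<epsilon>
  proof -
    obtain N where N: "4 * (1 / real (Suc N)) < \<epsilon>\<^sup>2"
      using reals_Archimedean[of "\<epsilon>\<^sup>2 / 4"] \<open>\<epsilon> > 0\<close> by (auto simp: field_simps)
    have "l2norm (\<lambda>t. k i t - k j t) < \<epsilon>" if "i \<ge> N" "j \<ge> N" for i j
    proof -
      have "1 / real (Suc i) \<le> 1 / real (Suc N)" "1 / real (Suc j) \<le> 1 / real (Suc N)"
        using that by (auto simp: field_simps)
      then have "(l2norm (\<lambda>t. k i t - k j t))\<^sup>2 < \<epsilon>\<^sup>2"
        using par[OF k(1)[of i] k(1)[of j]] k(2)[of i] k(2)[of j] N by argo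
      then show ?thesis using \<open>\<epsilon> > 0\<close> by (simp add: power2_less_imp_less)
    qed
    then show ?thesis by blast
  qed
  then obtain h where h: "h \<in> L2" "(\<lambda>n. l2norm (\<lambda>t. k n t - h t)) \<longlonglongrightarrow> 0"
    using L2_complete[of k] DL k(1) by blast
  have lim: "(\<lambda>n. l2norm (\<lambda>t. h t - k n t)) \<longlonglongrightarrow> 0"
    using h(2) by (subst l2norm_minus_commute)
  have "h \<in> l2_closure D"
    unfolding l2_closure_def
  proof (safe intro!: h)
    fix \<epsilon> :: real assume "\<epsilon> > 0"
    then have "\<forall>\<^sub>F n in sequentially. l2norm (\<lambda>t. h t - k n t) < \<epsilon>"
      using lim by (rule order_tendstoD(2)[rotated])
    then have "\<exists>n. l2norm (\<lambda>t. h t - k n t) < \<epsilon>" by (rule eventually_happens'[rotated]) simp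
    then show "\<exists>d\<in>D. l2norm (\<lambda>t. h t - d t) < \<epsilon>" using k(1) by blast
  qed
  moreover have "F x = l2inner x h" if x: "x \<in> D" for x
  proof -
    define w where "w = l2inner x h - F x"
    \<comment> \<open>First variation at the minimiser. The limit \<open>h\<close> may lie outside
      \<open>D\<close>, where nothing is known about \<open>F\<close>, so the perturbation is
      applied to each \<open>k n\<close> before passing to the limit.\<close>
    have var: "0 \<le> (cmod c)\<^sup>2 * (l2norm x)\<^sup>2 + 2 * Re (c * w)" for c
    proof (rule tendsto_lowerbound)
      show "(\<lambda>n. 1 / Suc n + ((cmod c)\<^sup>2 * (l2norm x)\<^sup>2 + 2 * Re (c * (l2inner x (k n) - F x))))
          \<longlonglongrightarrow> (cmod c)\<^sup>2 * (l2norm x)\<^sup>2 + 2 * Re (c * w)"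
      proof -
        have "(\<lambda>n. 1 / Suc n + ((cmod c)\<^sup>2 * (l2norm x)\<^sup>2 + 2 * Re (c * (l2inner x (k n) - F x))))
          \<longlonglongrightarrow> 0 + ((cmod c)\<^sup>2 * (l2norm x)\<^sup>2 + 2 * Re (c * (l2inner x h - F x)))"
          by (intro tendsto_intros l2inner_tendsto h lim DL k x
              LIMSEQ_inverse_real_of_nat[unfolded inverse_eq_divide])
        then show ?thesis by (simp add: w_def)
      qed
      show "\<forall>\<^sub>F n in sequentially. 0 \<le> 1 / Suc n + ((cmod c)\<^sup>2 * (l2norm x)\<^sup>2 + 2 * Re (c * (l2inner x (k n) - F x)))"
      proof (intro always_eventually allI)
        fix n
        let ?y = "\<lambda>t. c * x t + k n t"
        have "(l2norm ?y)\<^sup>2 = (cmod c)\<^sup>2 * (l2norm x)\<^sup>2 + (l2norm (k n))\<^sup>2 + 2 * Re (c * l2inner x (k n))"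
          using l2norm_add_sq[OF L2_cmult[OF DL[OF x]] DL[OF k(1)[of n]], of c]
          by (simp add: l2norm_scale l2inner_scale_left power_mult_distrib)
        moreover have "F ?y = c * F x + F (k n)"
          using F_add[OF D_scale[OF x] k(1)] F_scale[OF x] by simp
        moreover have "m \<le> q ?y" by (intro m_le D_add D_scale x k)
        ultimately show "0 \<le> 1 / Suc n + ((cmod c)\<^sup>2 * (l2norm x)\<^sup>2 + 2 * Re (c * (l2inner x (k n) - F x)))"
          using k(2)[of n] unfolding q_def by (simp add: algebra_simps)
      qed
    qed simp
    have "w = 0"
    proof (rule ccontr)
      assume "w \<noteq> 0"
      \<comment> \<open>With \<open>c = - s * cnj w\<close> the linear term is
        \<open>-2 s |w|^2\<close>, and this \<open>s\<close> keeps the quadratic one at most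
        \<open>s |w|^2\<close>.\<close>
      define s where "s = 1 / ((l2norm x)\<^sup>2 + 1)"
      have "s > 0" unfolding s_def by (simp add: add_nonneg_pos)
      have e: "- (of_real s * cnj w) * w = - of_real (s * (cmod w)\<^sup>2)"
        using complex_norm_square[of w] by (simp add: mult_ac)
      have "0 \<le> (cmod (- (of_real s * cnj w)))\<^sup>2 * (l2norm x)\<^sup>2 + 2 * Re (- (of_real s * cnj w) * w)"
        by (rule var)
      also have "\<dots> = s * (cmod w)\<^sup>2 * (s * (l2norm x)\<^sup>2 - 2)"
        unfolding e by (simp add: norm_mult power_mult_distrib power2_eq_square algebra_simps)
      finally have "0 \<le> s * (cmod w)\<^sup>2 * (s * (l2norm x)\<^sup>2 - 2)" .
      moreover have "0 < s * (cmod w)\<^sup>2" using \<open>s > 0\<close> \<open>w \<noteq> 0\<close> by simp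
      ultimately have "0 \<le> s * (l2norm x)\<^sup>2 - 2"
        by (meson mult_pos_neg not_le)
      moreover have "s * (l2norm x)\<^sup>2 \<le> 1"
        unfolding s_def by (simp add: divide_le_eq add_nonneg_pos)
      ultimately show False by linarith
    qed
    then show ?thesis by (simp add: w_def)
  qed
  ultimately show ?thesis using that by blast
qed

text \<open>The Riesz vector \<open>h\<close> of the functional \<open>l2inner k f\<close> on
  \<open>D\<close> lies in the closure of \<open>D\<close>, and \<open>f - h\<close> belongs to
  \<open>M\<close> and is orthogonal to \<open>D\<close>, hence vanishes almost everywhere. Density
  questions thus become uniqueness questions.\<close>

lemma dense_if_orthogonal_trivial:
  assumes D: "l2_subspace D" and M: "l2_subspace M" and "D \<subseteq> M"
    and clM: "l2_closure M \<subseteq> M"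
    and triv: "\<And>f. f \<in> M \<Longrightarrow> (\<And>d. d \<in> D \<Longrightarrow> l2inner f d = 0) \<Longrightarrow> AE t in circ. f t = 0"
    and f: "f \<in> M"
  shows "f \<in> l2_closure D"
proof -
  have subM: "M \<subseteq> L2" and DL: "D \<subseteq> L2" using D M unfolding l2_subspace_def by auto
  then have fL: "f \<in> L2" using f by auto
  obtain h where h: "h \<in> l2_closure D" "\<And>k. k \<in> D \<Longrightarrow> l2inner k f = l2inner k h"
  proof (rule Riesz_representation[OF D, of "\<lambda>k. l2inner k f" "l2norm f"])
    show "\<And>k. k \<in> D \<Longrightarrow> cmod (l2inner k f) \<le> l2norm f * l2norm k"
      using Cauchy_Schwarz[OF _ fL] DL by (auto simp: mult.commute)
    show "\<And>k l. k \<in> D \<Longrightarrow> l \<in> D \<Longrightarrow> l2inner (\<lambda>t. k t + l t) f = l2inner k f + l2inner l f"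
      using DL fL by (intro l2inner_add_left) auto
  qed (auto simp: l2inner_scale_left)
  have "h \<in> l2_closure M" using h(1) \<open>D \<subseteq> M\<close> unfolding l2_closure_def by blast
  then have hM: "h \<in> M" using clM by auto
  then have hL: "h \<in> L2" using subM by auto
  have dM: "(\<lambda>t. f t - h t) \<in> M"
    by (rule l2_subspaceD(4)[OF M f hM])
  have "AE t in circ. f t - h t = 0"
  proof (rule triv[OF dM])
    fix d assume d: "d \<in> D"
    then have dL: "d \<in> L2" using DL by auto
    have "l2inner (\<lambda>t. f t - h t) d = l2inner f d - l2inner h d" using fL hL dL by (simp add: l2inner_simps)
    also have "\<dots> = 0"
      using h(2)[OF d] by (subst (1 2) l2inner_commute) simp
    finally show "l2inner (\<lambda>t. f t - h t) d = 0" .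
  qed
  then have "l2norm (\<lambda>t. f t - k t) = l2norm (\<lambda>t. h t - k t)" if "k \<in> D" for k
    using fL hL DL that by (intro l2norm_cong_AE) (auto intro: L2_diff)
  note eq = this
  have "\<exists>k\<in>D. l2norm (\<lambda>t. f t - k t) < \<epsilon>" if "\<epsilon> > 0" for \<epsilon>
  proof -
    have "\<exists>k\<in>D. l2norm (\<lambda>t. h t - k t) < \<epsilon>"
      using h(1) that unfolding l2_closure_def by auto
    then show ?thesis using eq by auto
  qed
  then show ?thesis by (simp add: l2_closure_def fL)
qed

subsection \<open>Completeness of the trigonometric system\<close>

text \<open>Trigonometric polynomials for \<open>A = UNIV\<close>, analytic polynomials for
  \<open>A = {0..}\<close>.\<close>

inductive_set trig_span :: "int set \<Rightarrow> (real \<Rightarrow> complex) set" for A where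
  zero: "(\<lambda>t. 0) \<in> trig_span A"
| ce: "n \<in> A \<Longrightarrow> ce n \<in> trig_span A"
| add: "f \<in> trig_span A \<Longrightarrow> g \<in> trig_span A \<Longrightarrow> (\<lambda>t. f t + g t) \<in> trig_span A"
| scale: "f \<in> trig_span A \<Longrightarrow> (\<lambda>t. c * f t) \<in> trig_span A"

lemma trig_span_L2: "f \<in> trig_span A \<Longrightarrow> f \<in> L2"
  by (induction rule: trig_span.induct) auto

lemma l2_subspace_trig_span: "l2_subspace (trig_span A)"
  unfolding l2_subspace_def by (auto intro: trig_span.intros trig_span_L2)

lemma trig_span_const: "(\<lambda>t. c) \<in> trig_span UNIV"
  using trig_span.scale[OF trig_span.ce[of 0 UNIV], of c] by simp

lemma trig_span_ce_mult:
  "g \<in> trig_span UNIV \<Longrightarrow> (\<lambda>t. ce n t * g t) \<in> trig_span UNIV"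
proof (induction rule: trig_span.induct)
  case (ce m)
  then show ?case using trig_span.ce[of "n + m" UNIV] by (simp add: ce_mult)
next
  case (add f g)
  then show ?case using trig_span.add by (fastforce simp: distrib_left)
next
  case (scale f c)
  then show ?case using trig_span.scale[OF scale.IH, of c] by (simp add: mult.left_commute)
qed (use trig_span.zero in simp)

lemma trig_span_mult:
  "f \<in> trig_span UNIV \<Longrightarrow> g \<in> trig_span UNIV \<Longrightarrow> (\<lambda>t. f t * g t) \<in> trig_span UNIV"
proof (induction rule: trig_span.induct)
  case (ce m)
  then show ?case by (intro trig_span_ce_mult)
next
  case (add f h)
  then show ?case using trig_span.add by (fastforce simp: distrib_right)
next
  case (scale f c)
  then show ?case using trig_span.scale[OF scale.IH[OF scale.prems], of c] by (simp add: mult.assoc)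
qed (use trig_span.zero in simp)

text \<open>Links Stone-Weierstrass, which supplies polynomials in the two real coordinates, with
  characters: by Euler's formulas a real linear functional of \<open>cis t\<close> is a combination
  of \<open>ce 1\<close> and \<open>ce (-1)\<close>.\<close>

lemma real_polynomial_function_trig_span:
  "real_polynomial_function p \<Longrightarrow> (\<lambda>t. complex_of_real (p (cis t))) \<in> trig_span UNIV"
proof (induction rule: real_polynomial_function.induct)
  case (linear f)
  have "complex_of_real (f (cis t)) = ((f 1 / 2 - \<i> * f \<i> / 2) * ce 1 t) + ((f 1 / 2 + \<i> * f \<i> / 2) * ce (-1) t)" for t
  proof -
    have "cis t = cos t *\<^sub>R 1 + sin t *\<^sub>R \<i>"
      by (simp add: complex_eq_iff)
    then have "f (cis t) = cos t * f 1 + sin t * f \<i>"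
      using linear by (simp add: linear_simps)
    moreover have "ce 1 t = cos t + \<i> * sin t" "ce (-1) t = cos t - \<i> * sin t"
      by (simp_all add: ce_def exp_eq_polar cis_conv_exp[symmetric] complex_eq_iff)
    ultimately show ?thesis
      by (simp add: complex_eq_iff algebra_simps)
  qed
  then show ?case by (simp only:) (intro trig_span.add trig_span.scale trig_span.ce UNIV_I)
next
  case (const c)
  show ?case by (rule trig_span_const)
next
  case (add f g)
  then show ?case using trig_span.add by fastforce
next
  case (mult f g)
  then show ?case using trig_span_mult by fastforce
qed

lemma polynomial_function_trig_span:
  fixes p :: "complex \<Rightarrow> complex"
  assumes "polynomial_function p"
  shows "(\<lambda>t. p (cis t)) \<in> trig_span UNIV"
proof -
  have "real_polynomial_function (\<lambda>x. Re (p x))" "real_polynomial_function (\<lambda>x. Im (p x))"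
    using assms bounded_linear_Re bounded_linear_Im unfolding polynomial_function_def o_def by blast+
  then have "(\<lambda>t. complex_of_real (Re (p (cis t))) + \<i> * complex_of_real (Im (p (cis t)))) \<in> trig_span UNIV"
    by (intro trig_span.add trig_span.scale real_polynomial_function_trig_span)
  then show ?thesis by (simp add: complex_eq[symmetric])
qed

text \<open>The only obstacle is the jump of \<open>Arg\<close> at -1, and there the composition
  vanishes on a whole neighbourhood.\<close>

lemma continuous_on_circle_cutoff:
  fixes u :: "real \<Rightarrow> 'a::real_normed_vector"
  assumes "continuous_on UNIV u" "0 < \<delta>" "\<delta> < pi" "\<And>t. \<bar>t\<bar> \<ge> pi - \<delta> \<Longrightarrow> u t = 0"
  shows "continuous_on (sphere 0 1) (\<lambda>z. u (Arg z))"
  unfolding continuous_on_eq_continuous_within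
proof
  fix z :: complex assume z: "z \<in> sphere 0 1"
  show "continuous (at z within sphere 0 1) (\<lambda>z. u (Arg z))"
  proof (cases "z \<in> \<real>\<^sub>\<le>\<^sub>0")
    case False
    have "isCont u (Arg z)" using assms(1) by (simp add: continuous_on_eq_continuous_at)
    then have "isCont (\<lambda>z. u (Arg z)) z"
      using continuous_at_Arg[OF False] by (rule isCont_o2[rotated])
    then show ?thesis by (rule continuous_at_imp_continuous_at_within)
  next
    case True
    have vanish: "u (Arg w) = 0" if w: "w \<in> sphere 0 1" "Re w < cos (pi - \<delta>)" for w
    proof (rule assms(4), rule ccontr)
      assume "\<not> pi - \<delta> \<le> \<bar>Arg w\<bar>"
      then have "cos (pi - \<delta>) \<le> cos \<bar>Arg w\<bar>"
        using assms(2,3) by (intro cos_monotone_0_pi_le) auto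
      moreover have "w = cis (Arg w)"
        using w(1) Arg_eq[of w] by (cases "w = 0") (auto simp: cis_conv_exp)
      then have "Re w = cos (Arg w)" by (metis cis.simps(1))
      ultimately show False using w(2) by simp
    qed
    have "z = -1"
      using True z by (auto simp: complex_nonpos_Reals_iff complex_eq_iff cmod_def)
    have "cos pi < cos (pi - \<delta>)"
      using assms(2,3) by (intro cos_monotone_0_pi) auto
    then have lt: "Re z < cos (pi - \<delta>)" by (simp add: \<open>z = -1\<close>)
    have "\<forall>\<^sub>F w in at z within sphere 0 1. u (Arg w) = 0"
      unfolding eventually_at_topological
    proof (intro exI[of _ "{w. Re w < cos (pi - \<delta>)}"] conjI)
      show "open {w. Re w < cos (pi - \<delta>)}" by (rule open_halfspace_Re_lt)
    qed (use lt vanish in auto)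
    then have "((\<lambda>w. u (Arg w)) \<longlongrightarrow> 0) (at z within sphere 0 1)"
      by (rule tendsto_eventually)
    then show ?thesis using vanish[OF z lt] by (simp add: continuous_within)
  qed
qed

lemma AE_circ_negligible:
  assumes "negligible N"
  shows "AE t in circ. t \<notin> N"
proof -
  have "AE t in lebesgue. t \<notin> N"
    using assms by (intro AE_not_in) (simp add: negligible_iff_null_sets)
  then show ?thesis unfolding circ_def by (subst AE_restrict_space_iff) auto
qed

text \<open>Such a \<open>u\<close> is a continuous function on the circle, hence a uniform limit of
  trigonometric polynomials, and the error in the integral is controlled by the integral of
  \<open>cmod (f t)\<close>.\<close>

lemma integral_zero_of_trig_orthogonal:
  assumes f: "f \<in> L2" and orth: "\<And>n. (\<integral>t. f t * ce n t \<partial>circ) = 0"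
    and u: "continuous_on UNIV u" "0 < \<delta>" "\<delta> < pi" "\<And>t. \<bar>t\<bar> \<ge> pi - \<delta> \<Longrightarrow> u t = (0::complex)"
  shows "(\<integral>t. f t * u t \<partial>circ) = 0"
proof -
  have trig: "(\<integral>t. f t * p t \<partial>circ) = 0" if "p \<in> trig_span UNIV" for p
    using that
  proof (induction rule: trig_span.induct)
    case (add g h)
    then show ?case using f by (simp add: distrib_left L2_mult_integrable trig_span_L2)
  next
    case (scale g c)
    have "(\<integral>t. f t * (c * g t) \<partial>circ) = (\<integral>t. c * (f t * g t) \<partial>circ)"
      by (simp add: mult_ac)
    then show ?case using scale by simp
  qed (use orth in auto)
  have [measurable]: "u \<in> borel_measurable circ" by (rule continuous_measurable_circ[OF u(1)])
  define C where "C = (\<integral>t. cmod (f t) \<partial>circ)"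
  have "C \<ge> 0" unfolding C_def by simp
  have "cmod (\<integral>t. f t * u t \<partial>circ) \<le> \<epsilon>" if "\<epsilon> > 0" for \<epsilon>
  proof -
    define e where "e = \<epsilon> / (C + 1)"
    have e: "e > 0" using that \<open>C \<ge> 0\<close> by (simp add: e_def)
    obtain p where p: "polynomial_function p" "\<forall>z\<in>sphere 0 1. cmod (u (Arg z) - p z) < e"
      using Stone_Weierstrass_polynomial_function[OF compact_sphere continuous_on_circle_cutoff[OF u] e] by blast
    let ?p = "\<lambda>t. p (cis t)"
    have pt: "?p \<in> trig_span UNIV" using p(1) by (rule polynomial_function_trig_span)
    then have pL: "?p \<in> L2" by (rule trig_span_L2)
    have close: "cmod (u t - ?p t) \<le> e" if t: "t \<in> {-pi..pi}" for t
    proof -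
      have "u (Arg (cis t)) = u t"
      \<comment> \<open>\<open>Arg (cis (-pi))\<close> is \<open>pi\<close>, not \<open>-pi\<close>;
        both values give 0 under \<open>u\<close>.\<close>
      proof (cases "t = -pi")
        case True
        then have "cis t = cis pi" by (simp add: complex_eq_iff)
        then have "Arg (cis t) = pi" using Arg_cis[of pi] by simp
        then show ?thesis using u(4)[of t] u(4)[of pi] u(2) True by simp
      next
        case False
        then show ?thesis using t by (simp add: Arg_cis)
      qed
      then show ?thesis using p(2) by (metis less_imp_le mem_sphere_0 norm_cis)
    qed
    have du: "(\<lambda>t. u t - ?p t) \<in> L2"
    proof (rule L2_bounded[where C=e])
      show "(\<lambda>t. u t - ?p t) \<in> borel_measurable circ" using pL by measurable
      show "AE t in circ. cmod (u t - ?p t) \<le> e" by (rule AE_I2) (use close in simp)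
    qed
    have "(\<lambda>t. (u t - ?p t) + ?p t) \<in> L2" using du pL by (rule L2_add)
    then have uL: "u \<in> L2" by simp
    have "(\<integral>t. f t * u t \<partial>circ) = (\<integral>t. f t * u t - f t * ?p t \<partial>circ)"
      using trig[OF pt] f uL pL by (simp add: L2_mult_integrable)
    also have "\<dots> = (\<integral>t. f t * (u t - ?p t) \<partial>circ)" by (simp add: right_diff_distrib)
    finally have "cmod (\<integral>t. f t * u t \<partial>circ) \<le> (\<integral>t. cmod (f t * (u t - ?p t)) \<partial>circ)"
      by (simp only: integral_norm_bound)
    also have "\<dots> \<le> (\<integral>t. e * cmod (f t) \<partial>circ)"
    proof (rule integral_mono)
      show "integrable circ (\<lambda>t. cmod (f t * (u t - ?p t)))"
        using f du by (intro integrable_norm L2_mult_integrable)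
      show "integrable circ (\<lambda>t. e * cmod (f t))"
        using f by (intro integrable_mult_right integrable_norm L2_integrable)
      show "cmod (f t * (u t - ?p t)) \<le> e * cmod (f t)" if "t \<in> space circ" for t
        using mult_left_mono[OF close[of t] norm_ge_zero[of "f t"]] that by (simp add: norm_mult mult.commute)
    qed
    also have "\<dots> = e * C" by (simp add: C_def)
    also have "\<dots> \<le> \<epsilon>" using \<open>C \<ge> 0\<close> that by (simp add: e_def field_simps)
    finally show ?thesis .
  qed
  then have "cmod (\<integral>t. f t * u t \<partial>circ) \<le> 0" by (rule field_le_epsilon) simp
  then show ?thesis by simp
qed

text \<open>Test functions bounded by 1 and converging almost everywhere to
  \<open>cnj (sgn (f t))\<close> yield, by dominated convergence, that the integral of
  \<open>cmod (f t)\<close> is 0.\<close>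

lemma trig_complete:
  assumes f: "f \<in> L2" and "\<And>n. l2inner f (ce n) = 0"
  shows "AE t in circ. f t = 0"
proof -
  have orth: "(\<integral>t. f t * ce n t \<partial>circ) = 0" for n
    using assms(2)[of "-n"] by (simp add: l2inner_def)
  have [measurable]: "f \<in> borel_measurable circ" using f by measurable
  define h where "h t = cnj (sgn (f t))" for t
  have "h \<in> borel_measurable circ"
  proof -
    have [measurable]: "cnj \<in> borel_measurable borel"
      by (intro borel_measurable_continuous_onI continuous_intros)
    show ?thesis unfolding h_def sgn_div_norm by measurable
  qed
  \<comment> \<open>This notion of measurability supplies continuous functions converging to
    \<open>h\<close> off a negligible set.\<close>
  then have "h measurable_on {-pi..pi}"
    unfolding circ_def by (subst measurable_on_iff_borel_measurable) auto
  then obtain N g where N: "negligible N" and g: "\<And>n. continuous_on UNIV (g n)"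
    and lim: "\<And>t. t \<notin> N \<Longrightarrow> (\<lambda>n. g n t) \<longlonglongrightarrow> (if t \<in> {-pi..pi} then h t else 0)"
    unfolding measurable_on_def by blast
  \<comment> \<open>A trapezoid: 0 within distance \<open>1 / Suc n\<close> of the endpoints, 1 from
    distance \<open>2 / Suc n\<close> on.\<close>
  define cut where "cut n t = max 0 (min 1 (real (Suc n) * (pi - \<bar>t\<bar>) - 1))" for n t
  \<comment> \<open>Dividing by the maximum truncates \<open>g n\<close> to the unit disk; the limit
    \<open>h\<close> is unaffected, having modulus at most 1.\<close>
  define u where "u n t = complex_of_real (cut n t) * (g n t / of_real (max 1 (cmod (g n t))))" for n t
  have cont: "continuous_on UNIV (u n)" for n
    unfolding u_def cut_def by (intro continuous_intros g) auto
  have u_bound: "cmod (u n t) \<le> 1" for n t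
  proof -
    have "cmod (u n t) = cut n t * (cmod (g n t) / max 1 (cmod (g n t)))"
      by (simp add: u_def norm_mult norm_divide cut_def)
    also have "\<dots> \<le> 1 * 1"
      by (intro mult_mono) (auto simp: cut_def divide_simps)
    finally show ?thesis by simp
  qed
  have zero: "(\<integral>t. f t * u n t \<partial>circ) = 0" for n
  proof (rule integral_zero_of_trig_orthogonal[OF f orth cont])
    show "0 < 1 / real (Suc n)" by simp
    have "1 / real (Suc n) \<le> 1" by simp
    then show "1 / real (Suc n) < pi" using pi_gt3 by linarith
    show "u n t = 0" if "pi - 1 / real (Suc n) \<le> \<bar>t\<bar>" for t
    proof -
      have "real (Suc n) * (pi - \<bar>t\<bar>) \<le> 1" using that by (simp add: field_simps)
      then have "cut n t = 0" by (simp add: cut_def)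
      then show ?thesis by (simp add: u_def)
    qed
  qed
  have "(\<lambda>n. \<integral>t. f t * u n t \<partial>circ) \<longlonglongrightarrow> (\<integral>t. of_real (cmod (f t)) \<partial>circ)"
  proof (rule integral_dominated_convergence[where w="\<lambda>t. cmod (f t)"])
    have "AE t in circ. t \<notin> N \<union> {-pi, pi}"
      using N by (intro AE_circ_negligible negligible_Un) auto
    then show "AE t in circ. (\<lambda>n. f t * u n t) \<longlonglongrightarrow> of_real (cmod (f t))"
    proof (rule AE_mp, intro AE_I2 impI)
      fix t assume t: "t \<in> space circ" "t \<notin> N \<union> {-pi, pi}"
      then have "\<bar>t\<bar> < pi" by auto
      have "\<forall>\<^sub>F n in sequentially. 2 / (pi - \<bar>t\<bar>) < real n"
        by (simp add: filterlim_real_sequentially[unfolded filterlim_at_top_dense])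
      then have "\<forall>\<^sub>F n in sequentially. cut n t = 1"
      proof eventually_elim
        case (elim n)
        then have "2 < real n * (pi - \<bar>t\<bar>)" using \<open>\<bar>t\<bar> < pi\<close> by (simp add: field_simps)
        then have "2 < real (Suc n) * (pi - \<bar>t\<bar>)" using \<open>\<bar>t\<bar> < pi\<close> by (simp add: algebra_simps)
        then show ?case by (simp add: cut_def)
      qed
      then have 1: "(\<lambda>n. cut n t) \<longlonglongrightarrow> 1" by (rule tendsto_eventually)
      have "(\<lambda>n. g n t) \<longlonglongrightarrow> h t" using lim[of t] t by simp
      then have "(\<lambda>n. f t * u n t) \<longlonglongrightarrow> f t * (of_real 1 * (h t / of_real (max 1 (cmod (h t)))))"
        unfolding u_def by (intro tendsto_intros 1) auto
      moreover have "max 1 (cmod (h t)) = 1" by (simp add: h_def norm_sgn)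
      moreover have "f t * h t = of_real (cmod (f t))"
        using complex_norm_square[of "f t"]
        by (cases "f t = 0") (auto simp: h_def sgn_div_norm scaleR_conv_of_real field_simps power2_eq_square)
      ultimately show "(\<lambda>n. f t * u n t) \<longlonglongrightarrow> of_real (cmod (f t))" by simp
    qed
    show "integrable circ (\<lambda>t. cmod (f t))" using f by (intro integrable_norm L2_integrable)
    show "(\<lambda>t. f t * u n t) \<in> borel_measurable circ" for n
      using continuous_measurable_circ[OF cont] by measurable
    show "AE t in circ. norm (f t * u n t) \<le> cmod (f t)" for n
      using u_bound by (auto simp: norm_mult intro!: mult_left_le)
  qed (use f in auto)
  then have "(\<integral>t. complex_of_real (cmod (f t)) \<partial>circ) = 0"
    unfolding zero by (simp add: LIMSEQ_const_iff)
  then have "(\<integral>t. cmod (f t) \<partial>circ) = 0"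
    unfolding integral_complex_of_real by simp
  then have "AE t in circ. cmod (f t) = 0"
    using f by (subst (asm) integral_nonneg_eq_0_iff_AE) (auto intro: L2_integrable)
  then show ?thesis by simp
qed

subsection \<open>Hardy space and model space\<close>

lemma l2_subspace_perp:
  assumes "W \<subseteq> L2"
  shows "l2_subspace {f \<in> L2. \<forall>w\<in>W. l2inner f w = 0}"
  unfolding l2_subspace_def using assms by (auto simp: l2inner_add_left l2inner_scale_left subset_iff)

lemma l2_closure_perp:
  assumes "W \<subseteq> L2"
  shows "l2_closure {f \<in> L2. \<forall>w\<in>W. l2inner f w = 0} \<subseteq> {f \<in> L2. \<forall>w\<in>W. l2inner f w = 0}"
  (is "l2_closure ?M \<subseteq> ?M")
proof
  fix f assume f: "f \<in> l2_closure ?M"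
  have "l2inner f w = 0" if "w \<in> W" for w
    using that assms by (intro l2inner_closure_eq_0[OF f]) auto
  then show "f \<in> ?M" using l2_closure_subset_L2[OF f] by simp
qed

text \<open>As an annihilator the space is a closed subspace by the two preceding lemmas;
  \<open>K_perp\<close> plays the same role for the model space.\<close>

lemma H2_perp: "H2 = {f \<in> L2. \<forall>w\<in>ce ` {..<0}. l2inner f w = 0}"
  by (auto simp: H2_def fourier_eq)

lemma l2_subspace_H2: "l2_subspace H2"
  unfolding H2_perp by (rule l2_subspace_perp) auto

lemma l2_closure_H2: "l2_closure H2 \<subseteq> H2"
  unfolding H2_perp by (rule l2_closure_perp) auto

lemma H2_L2: "f \<in> H2 \<Longrightarrow> f \<in> L2"
  by (simp add: H2_def)

lemma H2_coeff: "f \<in> H2 \<Longrightarrow> n < 0 \<Longrightarrow> l2inner f (ce n) = 0"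
  by (simp add: H2_def fourier_eq)

lemma H2I: "f \<in> L2 \<Longrightarrow> (\<And>n. n < 0 \<Longrightarrow> l2inner f (ce n) = 0) \<Longrightarrow> f \<in> H2"
  by (simp add: H2_def fourier_eq)

lemma ce_H2: "n \<ge> 0 \<Longrightarrow> ce n \<in> H2"
  by (rule H2I) (auto simp: l2inner_ce)

lemma const_H2 [simp]: "(\<lambda>t. c) \<in> H2"
  using l2_subspaceD(3)[OF l2_subspace_H2 ce_H2, of 0 c] by simp

lemma l2inner_const_left_ce: "l2inner (\<lambda>t. c) (ce n) = (if n = 0 then c else 0)"
  using l2inner_scale_left[of c "ce 0" "ce n"] by (auto simp: l2inner_ce)

lemma H2_dense:
  assumes "f \<in> H2"
  shows "f \<in> l2_closure (trig_span {0..})"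
proof (rule dense_if_orthogonal_trivial[OF l2_subspace_trig_span l2_subspace_H2 _ l2_closure_H2 _ assms])
  show "trig_span {0..} \<subseteq> H2"
  proof
    fix f :: "real \<Rightarrow> complex" assume "f \<in> trig_span {0..}"
    then show "f \<in> H2"
      by (induction rule: trig_span.induct) (auto intro: ce_H2 l2_subspaceD(2,3)[OF l2_subspace_H2])
  qed
  fix f assume f: "f \<in> H2" "\<And>d. d \<in> trig_span {0..} \<Longrightarrow> l2inner f d = 0"
  show "AE t in circ. f t = 0"
  proof (rule trig_complete)
    show "f \<in> L2" using f(1) by (rule H2_L2)
    show "l2inner f (ce n) = 0" for n
      using f(2)[OF trig_span.ce] H2_coeff[OF f(1)] by (cases "n < 0") auto
  qed
qed

lemma H2_l2inner_eq_0:
  assumes "f \<in> H2" "w \<in> L2" "\<And>m. m \<ge> 0 \<Longrightarrow> l2inner (ce m) w = 0"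
  shows "l2inner f w = 0"
proof (rule l2inner_closure_eq_0[OF H2_dense[OF assms(1)] _ assms(2)])
  fix d :: "real \<Rightarrow> complex" assume "d \<in> trig_span {0..}"
  then show "l2inner d w = 0"
    by (induction rule: trig_span.induct)
      (use assms in \<open>auto simp: l2inner_scale_left l2inner_add_left trig_span_L2\<close>)
qed (auto intro: trig_span_L2)

text \<open>The pairing is the mean of \<open>f g\<close>, formally \<open>f(0) g(0)\<close>. By
  density \<open>f\<close> may be a monomial \<open>ce m\<close>, and then the mean is the
  coefficient of \<open>g\<close> at \<open>-m\<close>.\<close>

lemma H2_mult_integral:
  assumes "f \<in> H2" "g \<in> H2" "l2inner g (ce 0) = 0"
  shows "l2inner f (\<lambda>t. cnj (g t)) = 0"
proof (rule H2_l2inner_eq_0[OF assms(1)])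
  show "(\<lambda>t. cnj (g t)) \<in> L2" using assms by (auto intro: H2_L2)
  fix m :: int assume "0 \<le> m"
  have "l2inner (ce m) (\<lambda>t. cnj (g t)) = l2inner g (ce (- m))"
    by (rule l2inner_cong) (simp add: mult.commute)
  then show "l2inner (ce m) (\<lambda>t. cnj (g t)) = 0"
    using \<open>0 \<le> m\<close> assms H2_coeff[of g "-m"] by (cases "m = 0") auto
qed

lemma H2_ce_mult:
  assumes "f \<in> H2" "k \<ge> 0"
  shows "(\<lambda>t. ce k t * f t) \<in> H2"
proof (rule H2I)
  fix n :: int assume "n < 0"
  have "l2inner (\<lambda>t. ce k t * f t) (ce n) = l2inner f (ce (n - k))"
    by (rule l2inner_cong) (simp add: mult.commute mult.left_commute ce_mult)
  then show "l2inner (\<lambda>t. ce k t * f t) (ce n) = 0"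
    using H2_coeff[OF assms(1)] \<open>n < 0\<close> assms(2) by simp
qed (use assms in \<open>auto intro: H2_L2\<close>)

lemma H2_div_z:
  assumes "f \<in> H2" "l2inner f (ce 0) = 0"
  shows "(\<lambda>t. ce (-1) t * f t) \<in> H2"
proof (rule H2I)
  fix n :: int assume "n < 0"
  have "l2inner (\<lambda>t. ce (-1) t * f t) (ce n) = l2inner f (ce (n + 1))"
  proof (rule l2inner_cong)
    fix t
    have "ce (-1) t * f t * cnj (ce n t) = f t * (ce (-1) t * ce (-n) t)" by (simp add: mult_ac)
    also have "ce (-1) t * ce (-n) t = ce (- (n + 1)) t" unfolding ce_mult by (rule arg_cong[where f="\<lambda>k. ce k t"]) simp
    finally show "ce (-1) t * f t * cnj (ce n t) = f t * cnj (ce (n + 1) t)" by simp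
  qed
  then show "l2inner (\<lambda>t. ce (-1) t * f t) (ce n) = 0"
    using H2_coeff[OF assms(1), of "n + 1"] \<open>n < 0\<close> assms(2) by (cases "n = -1") auto
qed (use assms in \<open>auto intro: H2_L2\<close>)

section \<open>The backward shift, which sends f to (f - f(0)) / z, and its powers\<close>

definition bshift :: "(real \<Rightarrow> complex) \<Rightarrow> real \<Rightarrow> complex" where
  "bshift f t = ce (-1) t * (f t - l2inner f (ce 0))"

lemma H2_diff_const:
  assumes "f \<in> H2"
  shows "(\<lambda>t. f t - l2inner f (ce 0)) \<in> H2" "l2inner (\<lambda>t. f t - l2inner f (ce 0)) (ce 0) = 0"
  using l2_subspaceD(4)[OF l2_subspace_H2 assms const_H2] H2_L2[OF assms]
  by (auto simp: l2inner_diff_left l2inner_const_left_ce)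

lemma bshift_H2: "f \<in> H2 \<Longrightarrow> bshift f \<in> H2"
  unfolding bshift_def[abs_def] by (intro H2_div_z H2_diff_const)

text \<open>Pythagoras: \<open>f - f(0)\<close> is orthogonal to the constants, and multiplication
  by \<open>ce (-1)\<close> is isometric.\<close>

lemma l2norm_bshift:
  assumes "f \<in> L2"
  shows "l2norm (bshift f) \<le> l2norm f"
proof (rule power2_le_imp_le)
  let ?c = "l2inner f (ce 0)"
  have "l2norm (bshift f) = l2norm (\<lambda>t. f t - ?c)"
    by (rule l2norm_cong_cmod) (simp add: bshift_def norm_mult)
  moreover have "(l2norm (\<lambda>t. (f t - ?c) + ?c))\<^sup>2 = (l2norm (\<lambda>t. f t - ?c))\<^sup>2 + (l2norm (\<lambda>t. ?c))\<^sup>2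
     + 2 * Re (l2inner (\<lambda>t. f t - ?c) (\<lambda>t. ?c))"
    using assms by (intro l2norm_add_sq) auto
  moreover have "l2inner (\<lambda>t. f t - ?c) (\<lambda>t. ?c) = 0"
    using assms by (subst l2inner_const_right) (simp add: l2inner_diff_left l2inner_const_left_ce)
  ultimately show "(l2norm (bshift f))\<^sup>2 \<le> (l2norm f)\<^sup>2" by simp
qed simp

lemma bshift_add: "f \<in> L2 \<Longrightarrow> g \<in> L2 \<Longrightarrow> bshift (\<lambda>t. f t + g t) = (\<lambda>t. bshift f t + bshift g t)"
  by (auto simp: bshift_def l2inner_add_left algebra_simps)

lemma bshift_scale: "bshift (\<lambda>t. c * f t) = (\<lambda>t. c * bshift f t)"
  by (auto simp: bshift_def l2inner_scale_left algebra_simps)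

lemma bshift_ce: "bshift (ce m) = (if m = 0 then (\<lambda>t. 0) else ce (m - 1))"
  by (auto simp: bshift_def l2inner_ce ce_mult)

lemma bshift_L2: "f \<in> L2 \<Longrightarrow> bshift f \<in> L2"
  unfolding bshift_def[abs_def] by (intro L2_mult_ce L2_diff L2_const)

lemma bshift_iter_L2: "f \<in> L2 \<Longrightarrow> (bshift ^^ n) f \<in> L2"
  by (induction n) (auto intro: bshift_L2)

lemma bshift_iter_add:
  "f \<in> L2 \<Longrightarrow> g \<in> L2 \<Longrightarrow> (bshift ^^ n) (\<lambda>t. f t + g t) = (\<lambda>t. (bshift ^^ n) f t + (bshift ^^ n) g t)"
  by (induction n) (auto simp: bshift_add bshift_iter_L2)

lemma bshift_iter_scale: "(bshift ^^ n) (\<lambda>t. c * f t) = (\<lambda>t. c * (bshift ^^ n) f t)"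
  by (induction n) (auto simp: bshift_scale)

lemma l2norm_bshift_iter: "f \<in> L2 \<Longrightarrow> l2norm ((bshift ^^ n) f) \<le> l2norm f"
  by (induction n) (auto intro: order_trans[OF l2norm_bshift] bshift_iter_L2)

lemma bshift_iter_zero: "(bshift ^^ n) (\<lambda>t. 0) = (\<lambda>t. 0)"
  using bshift_iter_scale[of n 0 "\<lambda>t. 0"] by simp

lemma bshift_iter_ce: "int n > m \<Longrightarrow> m \<ge> 0 \<Longrightarrow> (bshift ^^ n) (ce m) = (\<lambda>t. 0)"
proof (induction n arbitrary: m)
  case (Suc n)
  show ?case
  proof (cases "m = 0")
    case True
    then have "bshift (ce m) = (\<lambda>t. 0)" by (subst bshift_ce) simp
    then show ?thesis by (simp only: funpow_Suc_right o_apply bshift_iter_zero)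
  next
    case False
    then have "(bshift ^^ Suc n) (ce m) = (bshift ^^ n) (ce (m - 1))"
      by (simp only: funpow_Suc_right o_apply bshift_ce if_False)
    then show ?thesis using Suc.IH[of "m - 1"] Suc.prems False by simp
  qed
qed simp

lemma bshift_iter_trig_span:
  "p \<in> trig_span {0..} \<Longrightarrow> \<exists>N. \<forall>n\<ge>N. (bshift ^^ n) p = (\<lambda>t. 0)"
proof (induction rule: trig_span.induct)
  case (ce m)
  then show ?case by (intro exI[of _ "nat m + 1"]) (auto intro!: bshift_iter_ce)
next
  case (add f g)
  then obtain N1 N2 where "\<forall>n\<ge>N1. (bshift ^^ n) f = (\<lambda>t. 0)" "\<forall>n\<ge>N2. (bshift ^^ n) g = (\<lambda>t. 0)"
    by blast
  then show ?case using add.hyps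
    by (intro exI[of _ "max N1 N2"]) (simp add: bshift_iter_add trig_span_L2)
next
  case (scale f c)
  then obtain N where "\<forall>n\<ge>N. (bshift ^^ n) f = (\<lambda>t. 0)" by blast
  then show ?case by (intro exI[of _ N]) (simp add: bshift_iter_scale)
qed (simp add: bshift_iter_zero)

text \<open>The powers are contractions and eventually annihilate every analytic polynomial, and
  these are dense in \<open>H2\<close>.\<close>

lemma bshift_iter_tendsto_0:
  assumes "f \<in> H2"
  shows "(\<lambda>n. l2norm ((bshift ^^ n) f)) \<longlonglongrightarrow> 0"
proof (rule LIMSEQ_I)
  fix \<epsilon> :: real assume "\<epsilon> > 0"
  then obtain p where p: "p \<in> trig_span {0..}" "l2norm (\<lambda>t. f t - p t) < \<epsilon>"
    using H2_dense[OF assms] unfolding l2_closure_def by auto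
  then obtain N where N: "\<And>n. n \<ge> N \<Longrightarrow> (bshift ^^ n) p = (\<lambda>t. 0)"
    using bshift_iter_trig_span by blast
  have fL: "f \<in> L2" using assms by (rule H2_L2)
  have "l2norm ((bshift ^^ n) f) < \<epsilon>" if "n \<ge> N" for n
  proof -
    have "(bshift ^^ n) (\<lambda>t. (f t - p t) + p t) = (\<lambda>t. (bshift ^^ n) (\<lambda>t. f t - p t) t + (bshift ^^ n) p t)"
      using fL p trig_span_L2 by (intro bshift_iter_add) auto
    then have "(bshift ^^ n) f = (bshift ^^ n) (\<lambda>t. f t - p t)"
      by (simp add: N[OF that])
    moreover have "l2norm ((bshift ^^ n) (\<lambda>t. f t - p t)) \<le> l2norm (\<lambda>t. f t - p t)"
      using fL p trig_span_L2 by (intro l2norm_bshift_iter) auto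
    ultimately show ?thesis using p(2) by simp
  qed
  then show "\<exists>N. \<forall>n\<ge>N. norm (l2norm ((bshift ^^ n) f) - 0) < \<epsilon>" by auto
qed

section \<open>Inner functions vanishing at the origin and their model spaces\<close>

locale inner_vanishing =
  fixes \<theta> :: "real \<Rightarrow> complex"
  assumes inner: "inner_fun \<theta>" and vanish: "l2inner \<theta> (ce 0) = 0"
begin

abbreviation "K \<equiv> model_space \<theta>"
abbreviation "Kinf \<equiv> model_space \<theta> \<inter> Hinf"

lemma theta_H2: "\<theta> \<in> H2" and theta_AE: "AE t in circ. cmod (\<theta> t) = 1"
  using inner by (auto simp: inner_fun_def)

lemma theta_bound: "AE t in circ. cmod (\<theta> t) \<le> 1"
  using theta_AE by eventually_elim simp

lemma theta_L2: "\<theta> \<in> L2"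
  using theta_H2 by (rule H2_L2)

lemma theta_measurable: "\<theta> \<in> borel_measurable circ"
  using theta_L2 by (rule L2_measurable)

lemma theta_mult_L2: "f \<in> L2 \<Longrightarrow> (\<lambda>t. \<theta> t * f t) \<in> L2"
  by (rule L2_mult_bounded(2)[OF _ theta_measurable theta_bound])

lemma l2inner_theta_mult:
  assumes "f \<in> L2" "g \<in> L2"
  shows "l2inner (\<lambda>t. \<theta> t * f t) (\<lambda>t. \<theta> t * g t) = l2inner f g"
proof -
  have "(\<integral>t. (\<theta> t * f t) * cnj (\<theta> t * g t) \<partial>circ) = (\<integral>t. f t * cnj (g t) \<partial>circ)"
  proof (rule integral_cong_AE)
    show "AE t in circ. \<theta> t * f t * cnj (\<theta> t * g t) = f t * cnj (g t)"
      using theta_AE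
    proof eventually_elim
      case (elim t)
      have "\<theta> t * f t * cnj (\<theta> t * g t) = (\<theta> t * cnj (\<theta> t)) * (f t * cnj (g t))" by (simp add: mult_ac)
      also have "\<theta> t * cnj (\<theta> t) = 1" using complex_norm_square[of "\<theta> t"] elim by simp
      finally show ?case by simp
    qed
    show "(\<lambda>t. \<theta> t * f t * cnj (\<theta> t * g t)) \<in> borel_measurable circ"
      by (intro borel_measurable_integrable L2_mult_integrable L2_cnj theta_mult_L2 assms)
    show "(\<lambda>t. f t * cnj (g t)) \<in> borel_measurable circ"
      by (intro borel_measurable_integrable L2_mult_integrable L2_cnj assms)
  qed
  then show ?thesis by (simp add: l2inner_def)
qed

text \<open>The case \<open>n = 0\<close> is included because \<open>\<theta>\<close> vanishes at 0;
  it is what places the constants in \<open>K\<close>.\<close>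

lemma theta_mult_coeff:
  assumes "g \<in> H2" "n \<le> 0"
  shows "l2inner (\<lambda>t. \<theta> t * g t) (ce n) = 0"
proof -
  have "l2inner (\<lambda>t. \<theta> t * g t) (ce n) = l2inner g (\<lambda>t. cnj (\<theta> t) * ce n t)"
    by (rule l2inner_cong) (simp add: mult_ac)
  also have "\<dots> = 0"
  proof (rule H2_l2inner_eq_0[OF assms(1)])
    show "(\<lambda>t. cnj (\<theta> t) * ce n t) \<in> L2" using theta_L2 by auto
    fix m :: int assume "0 \<le> m"
    have "l2inner (ce m) (\<lambda>t. cnj (\<theta> t) * ce n t) = l2inner \<theta> (ce (n - m))"
      by (rule l2inner_cong) (simp add: mult.left_commute ce_mult)
    then show "l2inner (ce m) (\<lambda>t. cnj (\<theta> t) * ce n t) = 0"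
      using H2_coeff[OF theta_H2, of "n - m"] vanish \<open>0 \<le> m\<close> assms(2) by (cases "n - m = 0") auto
  qed
  finally show ?thesis .
qed

lemma KI: "f \<in> H2 \<Longrightarrow> (\<And>g. g \<in> H2 \<Longrightarrow> l2inner f (\<lambda>t. \<theta> t * g t) = 0) \<Longrightarrow> f \<in> K"
  by (simp add: model_space_def)

lemma K_H2: "f \<in> K \<Longrightarrow> f \<in> H2"
  by (simp add: model_space_def)

lemma K_L2: "f \<in> K \<Longrightarrow> f \<in> L2"
  by (simp add: model_space_def H2_L2)

lemma K_orth: "f \<in> K \<Longrightarrow> g \<in> H2 \<Longrightarrow> l2inner f (\<lambda>t. \<theta> t * g t) = 0"
  by (simp add: model_space_def)

lemma K_orth_theta: "f \<in> K \<Longrightarrow> l2inner f \<theta> = 0"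
  using K_orth[of f "\<lambda>t. 1"] by simp

lemma K_perp: "K = {f \<in> L2. \<forall>w \<in> ce ` {..<0} \<union> (\<lambda>g t. \<theta> t * g t) ` H2. l2inner f w = 0}"
proof (intro set_eqI iffI)
  fix f assume "f \<in> K"
  then show "f \<in> {f \<in> L2. \<forall>w \<in> ce ` {..<0} \<union> (\<lambda>g t. \<theta> t * g t) ` H2. l2inner f w = 0}"
    by (auto simp: model_space_def H2_L2 H2_coeff)
next
  fix f assume "f \<in> {f \<in> L2. \<forall>w \<in> ce ` {..<0} \<union> (\<lambda>g t. \<theta> t * g t) ` H2. l2inner f w = 0}"
  then have "f \<in> L2" "\<And>n. n < 0 \<Longrightarrow> l2inner f (ce n) = 0"
    "\<And>g. g \<in> H2 \<Longrightarrow> l2inner f (\<lambda>t. \<theta> t * g t) = 0"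
    by auto
  then show "f \<in> K" by (intro KI H2I)
qed

lemma l2_subspace_K: "l2_subspace K" and l2_closure_K: "l2_closure K \<subseteq> K"
proof -
  have *: "ce ` {..<0} \<union> (\<lambda>g t. \<theta> t * g t) ` H2 \<subseteq> L2"
  proof
    fix w assume "w \<in> ce ` {..<0} \<union> (\<lambda>g t. \<theta> t * g t) ` H2"
    then consider n where "w = ce n" | g where "g \<in> H2" "w = (\<lambda>t. \<theta> t * g t)" by auto
    then show "w \<in> L2" by cases (simp_all add: theta_mult_L2 H2_L2)
  qed
  show "l2_subspace K" unfolding K_perp by (rule l2_subspace_perp[OF *])
  show "l2_closure K \<subseteq> K" unfolding K_perp by (rule l2_closure_perp[OF *])
qed

lemmas K_add = l2_subspaceD(2)[OF l2_subspace_K]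
  and K_scale = l2_subspaceD(3)[OF l2_subspace_K]
  and K_diff = l2_subspaceD(4)[OF l2_subspace_K]

lemma const_K [simp]: "(\<lambda>t. c) \<in> K"
proof (rule KI)
  fix g assume "g \<in> H2"
  then show "l2inner (\<lambda>t. c) (\<lambda>t. \<theta> t * g t) = 0"
    by (subst l2inner_commute) (simp add: l2inner_const_right theta_mult_coeff)
qed simp

lemma div_z_K:
  assumes "f \<in> K" "l2inner f (ce 0) = 0"
  shows "(\<lambda>t. ce (-1) t * f t) \<in> K"
proof (rule KI)
  show "(\<lambda>t. ce (-1) t * f t) \<in> H2" by (rule H2_div_z[OF K_H2[OF assms(1)] assms(2)])
  fix g assume "g \<in> H2"
  have "l2inner (\<lambda>t. ce (-1) t * f t) (\<lambda>t. \<theta> t * g t) = l2inner f (\<lambda>t. \<theta> t * (ce 1 t * g t))"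
    by (rule l2inner_cong) (simp add: mult_ac)
  then show "l2inner (\<lambda>t. ce (-1) t * f t) (\<lambda>t. \<theta> t * g t) = 0"
    using K_orth[OF assms(1) H2_ce_mult[OF \<open>g \<in> H2\<close>]] by simp
qed

lemma diff_const_K: "f \<in> K \<Longrightarrow> (\<lambda>t. f t - l2inner f (ce 0)) \<in> K"
  by (intro K_diff const_K)

lemma bshift_K: "f \<in> K \<Longrightarrow> bshift f \<in> K"
  unfolding bshift_def[abs_def] by (intro div_z_K diff_const_K H2_diff_const K_H2)

text \<open>The compressed shift. Against \<open>\<theta> g\<close> with \<open>g(0) = 0\<close> the
  factor \<open>z\<close> cancels and \<open>h\<close> is already orthogonal, so the only part of
  \<open>z h\<close> in \<open>\<theta> H2\<close> is its component along
  \<open>\<theta>\<close>.\<close>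

lemma shift_K:
  assumes "h \<in> K"
  shows "(\<lambda>t. ce 1 t * h t - l2inner (\<lambda>t. ce 1 t * h t) \<theta> * \<theta> t) \<in> K"
proof (rule KI)
  let ?c = "l2inner (\<lambda>t. ce 1 t * h t) \<theta>"
  have zh: "(\<lambda>t. ce 1 t * h t) \<in> H2" by (rule H2_ce_mult[OF K_H2[OF assms]]) simp
  show "(\<lambda>t. ce 1 t * h t - ?c * \<theta> t) \<in> H2"
    by (rule l2_subspaceD(4)[OF l2_subspace_H2 zh l2_subspaceD(3)[OF l2_subspace_H2 theta_H2]])
  fix g assume g: "g \<in> H2"
  let ?g0 = "l2inner g (ce 0)"
  have zhL: "(\<lambda>t. ce 1 t * h t) \<in> L2" and gL: "g \<in> L2" using zh g by (simp_all add: H2_L2)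
  have "l2inner (\<lambda>t. ce 1 t * h t) (\<lambda>t. \<theta> t * (g t - ?g0)) = l2inner h (\<lambda>t. \<theta> t * bshift g t)"
    by (rule l2inner_cong) (simp add: bshift_def mult_ac)
  also have "\<dots> = 0" using assms g by (intro K_orth bshift_H2)
  finally have 0: "l2inner (\<lambda>t. ce 1 t * h t) (\<lambda>t. \<theta> t * (g t - ?g0)) = 0" .
  have "l2inner (\<lambda>t. ce 1 t * h t) (\<lambda>t. \<theta> t * (g t - ?g0) + ?g0 * \<theta> t)
      = l2inner (\<lambda>t. ce 1 t * h t) (\<lambda>t. \<theta> t * (g t - ?g0)) + cnj ?g0 * ?c"
    by (simp only: l2inner_add_right[OF zhL theta_mult_L2[OF L2_diff[OF gL L2_const]] L2_cmult[OF theta_L2]] l2inner_scale_right)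
  then have 1: "l2inner (\<lambda>t. ce 1 t * h t) (\<lambda>t. \<theta> t * g t) = cnj ?g0 * ?c"
    using 0 by (simp add: algebra_simps)
  have "l2inner (\<lambda>t. \<theta> t * ce 0 t) (\<lambda>t. \<theta> t * g t) = l2inner (ce 0) g"
    using g by (intro l2inner_theta_mult) (auto intro: H2_L2)
  also have "\<dots> = cnj ?g0" by (rule l2inner_commute)
  finally have 2: "l2inner \<theta> (\<lambda>t. \<theta> t * g t) = cnj ?g0" by simp
  have "l2inner (\<lambda>t. ce 1 t * h t - ?c * \<theta> t) (\<lambda>t. \<theta> t * g t)
      = l2inner (\<lambda>t. ce 1 t * h t) (\<lambda>t. \<theta> t * g t) - ?c * l2inner \<theta> (\<lambda>t. \<theta> t * g t)"
    by (simp only: l2inner_diff_left[OF zhL L2_cmult[OF theta_L2] theta_mult_L2[OF gL]] l2inner_scale_left)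
  then show "l2inner (\<lambda>t. ce 1 t * h t - ?c * \<theta> t) (\<lambda>t. \<theta> t * g t) = 0"
    using 1 2 by simp
qed

text \<open>Writing \<open>a = z g\<close> with \<open>g = bshift a\<close>, the function
  \<open>\<theta> cnj a\<close> is the image of \<open>g\<close> under the natural conjugation
  \<open>f \<mapsto> \<theta> cnj (z f)\<close> of the model space. Its value at 0 is a conjugated
  pairing of \<open>a\<close> with \<open>\<theta>\<close>.\<close>

lemma conjugation_K:
  assumes "a \<in> K" "l2inner a (ce 0) = 0"
  shows "(\<lambda>t. \<theta> t * cnj (a t)) \<in> K" "l2inner (\<lambda>t. \<theta> t * cnj (a t)) (ce 0) = 0"
proof -
  have aL: "a \<in> L2" using assms(1) by (rule K_L2)
  have coeff: "l2inner (\<lambda>t. \<theta> t * cnj (a t)) (ce n) = 0" if "n \<le> 0" for n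
  proof -
    have "l2inner a (\<lambda>t. \<theta> t * ce (-n) t) = l2inner (ce n) (\<lambda>t. \<theta> t * cnj (a t))"
      by (rule l2inner_cong) (simp add: mult_ac)
    moreover have "l2inner a (\<lambda>t. \<theta> t * ce (-n) t) = 0"
      using that by (intro K_orth assms ce_H2) simp
    ultimately show ?thesis using l2inner_commute[of "\<lambda>t. \<theta> t * cnj (a t)" "ce n"] by simp
  qed
  then show "l2inner (\<lambda>t. \<theta> t * cnj (a t)) (ce 0) = 0" by simp
  show "(\<lambda>t. \<theta> t * cnj (a t)) \<in> K"
  proof (rule KI)
    show "(\<lambda>t. \<theta> t * cnj (a t)) \<in> H2"
      using coeff aL by (intro H2I theta_mult_L2) auto
    fix g assume g: "g \<in> H2"
    have "l2inner (\<lambda>t. \<theta> t * cnj (a t)) (\<lambda>t. \<theta> t * g t) = l2inner (\<lambda>t. cnj (a t)) g"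
      using aL g by (intro l2inner_theta_mult) (auto intro: H2_L2)
    also have "\<dots> = cnj (l2inner g (\<lambda>t. cnj (a t)))" by (rule l2inner_commute)
    also have "\<dots> = 0" using H2_mult_integral[OF g K_H2[OF assms(1)] assms(2)] by simp
    finally show "l2inner (\<lambda>t. \<theta> t * cnj (a t)) (\<lambda>t. \<theta> t * g t) = 0" .
  qed
qed

section \<open>Bounded functions in the model space and the orthogonal projection\<close>

lemma KinfI: "f \<in> K \<Longrightarrow> AE t in circ. cmod (f t) \<le> C \<Longrightarrow> f \<in> Kinf"
  by (auto simp: Hinf_def K_H2)

lemma Kinf_bound: "f \<in> Kinf \<Longrightarrow> \<exists>C. AE t in circ. cmod (f t) \<le> C"
  by (auto simp: Hinf_def)

lemma Kinf_mult_L2: "f \<in> Kinf \<Longrightarrow> g \<in> L2 \<Longrightarrow> (\<lambda>t. g t * f t) \<in> L2"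
  using Kinf_bound[of f] L2_mult_bounded(1)[of g f] K_L2[of f] L2_measurable[of f] by auto

lemma Kinf_add:
  assumes "f \<in> Kinf" "g \<in> Kinf"
  shows "(\<lambda>t. f t + g t) \<in> Kinf"
proof -
  obtain C D where "AE t in circ. cmod (f t) \<le> C" "AE t in circ. cmod (g t) \<le> D"
    using assms Kinf_bound by blast
  then have "AE t in circ. cmod (f t + g t) \<le> C + D"
    by eventually_elim (rule norm_triangle_mono)
  then show ?thesis using assms by (intro KinfI K_add) auto
qed

lemma Kinf_scale:
  assumes "f \<in> Kinf"
  shows "(\<lambda>t. c * f t) \<in> Kinf"
proof -
  obtain C where "AE t in circ. cmod (f t) \<le> C"
    using assms Kinf_bound by blast
  then have "AE t in circ. cmod (c * f t) \<le> cmod c * C"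
    by eventually_elim (simp add: norm_mult mult_left_mono)
  then show ?thesis using assms by (intro KinfI K_scale) auto
qed

lemma const_Kinf [simp]: "(\<lambda>t. c) \<in> Kinf"
  by (rule KinfI[where C = "cmod c"]) auto

lemma l2_subspace_Kinf: "l2_subspace Kinf"
  unfolding l2_subspace_def
  by (intro conjI ballI allI Kinf_add Kinf_scale const_Kinf subsetI) (auto intro: K_L2)

lemma bshift_Kinf:
  assumes "f \<in> Kinf"
  shows "bshift f \<in> Kinf"
proof -
  obtain C where "AE t in circ. cmod (f t) \<le> C"
    using assms Kinf_bound by blast
  then have "AE t in circ. cmod (bshift f t) \<le> C + cmod (l2inner f (ce 0))"
  proof eventually_elim
    case (elim t)
    have "cmod (bshift f t) \<le> cmod (f t) + cmod (l2inner f (ce 0))"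
      by (simp add: bshift_def norm_mult norm_triangle_ineq4)
    then show ?case using elim by simp
  qed
  then show ?thesis using assms by (intro KinfI bshift_K) auto
qed

lemma shift_Kinf:
  assumes "h \<in> Kinf"
  shows "(\<lambda>t. ce 1 t * h t - l2inner (\<lambda>t. ce 1 t * h t) \<theta> * \<theta> t) \<in> Kinf"
proof -
  let ?c = "l2inner (\<lambda>t. ce 1 t * h t) \<theta>"
  obtain C where "AE t in circ. cmod (h t) \<le> C"
    using assms Kinf_bound by blast
  then have "AE t in circ. cmod (ce 1 t * h t - ?c * \<theta> t) \<le> C + cmod ?c"
    using theta_AE
  proof eventually_elim
    case (elim t)
    have "cmod (ce 1 t * h t - ?c * \<theta> t) \<le> cmod (ce 1 t * h t) + cmod (?c * \<theta> t)"
      by (rule norm_triangle_ineq4)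
    then show ?case using elim by (simp add: norm_mult)
  qed
  then show ?thesis using assms by (intro KinfI shift_K) auto
qed

text \<open>This is the natural conjugate of 1. As a bounded test function it reads off the
  component along \<open>\<theta>\<close> in \<open>shift_coefficient\<close>.\<close>

lemma zbar_theta_Kinf: "(\<lambda>t. ce (-1) t * \<theta> t) \<in> Kinf"
proof (rule KinfI)
  show "(\<lambda>t. ce (-1) t * \<theta> t) \<in> K"
  proof (rule KI)
    show "(\<lambda>t. ce (-1) t * \<theta> t) \<in> H2" by (intro H2_div_z theta_H2 vanish)
    fix g assume g: "g \<in> H2"
    have "l2inner (\<lambda>t. ce (-1) t * \<theta> t) (\<lambda>t. \<theta> t * g t) = l2inner (\<lambda>t. \<theta> t * ce (-1) t) (\<lambda>t. \<theta> t * g t)"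
      by (simp add: mult.commute)
    also have "\<dots> = l2inner (ce (-1)) g"
      using g by (intro l2inner_theta_mult) (auto intro: H2_L2)
    also have "\<dots> = cnj (l2inner g (ce (-1)))" by (rule l2inner_commute)
    also have "\<dots> = 0" using H2_coeff[OF g] by simp
    finally show "l2inner (\<lambda>t. ce (-1) t * \<theta> t) (\<lambda>t. \<theta> t * g t) = 0" .
  qed
  show "AE t in circ. cmod (ce (-1) t * \<theta> t) \<le> 1"
    using theta_AE by eventually_elim (simp add: norm_mult)
qed

text \<open>The representing functions are \<open>P\<^sub>\<theta> z\<^sup>n\<close>, obtained by iterating the compressed shift on \<open>1\<close>.\<close>

lemma coefficient_functional_Kinf:
  "\<exists>k\<in>Kinf. \<forall>f\<in>K. l2inner f k = l2inner f (ce (int n))"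
proof (induction n)
  case 0
  then show ?case using const_Kinf[of 1] by (intro bexI[of _ "\<lambda>t. 1"]) (auto simp: l2inner_const_right)
next
  case (Suc n)
  then obtain k where k: "k \<in> Kinf" "\<And>f. f \<in> K \<Longrightarrow> l2inner f k = l2inner f (ce (int n))" by blast
  let ?c = "l2inner (\<lambda>t. ce 1 t * k t) \<theta>"
  have "l2inner f (\<lambda>t. ce 1 t * k t - ?c * \<theta> t) = l2inner f (ce (int (Suc n)))" if f: "f \<in> K" for f
  proof -
    let ?f0 = "l2inner f (ce 0)"
    have kL: "k \<in> L2" and fL: "f \<in> L2" using k(1) f by (auto intro: K_L2)
    have "l2inner f (\<lambda>t. ce 1 t * k t - ?c * \<theta> t) = l2inner f (\<lambda>t. ce 1 t * k t)"
      using kL fL theta_L2 K_orth_theta[OF f] by (subst l2inner_diff_right) (auto simp: l2inner_scale_right)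
    \<comment> \<open>The factor \<open>z\<close> moves to the other side as \<open>ce (-1)\<close>,
      and \<open>ce (-1) * f\<close> is \<open>bshift f\<close> plus a multiple of
      \<open>ce (-1)\<close>, which is orthogonal to \<open>k\<close>.\<close>
    also have "\<dots> = l2inner (\<lambda>t. bshift f t + ?f0 * ce (-1) t) k"
      by (rule l2inner_cong) (simp add: bshift_def algebra_simps)
    also have "\<dots> = l2inner (bshift f) k + ?f0 * l2inner (ce (-1)) k"
      using kL fL by (subst l2inner_add_left) (auto simp: l2inner_scale_left bshift_L2)
    also have "l2inner (ce (-1)) k = cnj (l2inner k (ce (-1)))" by (rule l2inner_commute)
    also have "l2inner k (ce (-1)) = 0" using k(1) by (intro H2_coeff K_H2) auto
    also have "l2inner (bshift f) k = l2inner (bshift f) (ce (int n))"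
      using bshift_K[OF f] by (rule k(2))
    also have "\<dots> = l2inner (\<lambda>t. f t - ?f0) (ce (int (Suc n)))"
      by (rule l2inner_cong) (simp add: bshift_def ce_mult mult.commute mult.left_commute)
    also have "\<dots> = l2inner f (ce (int (Suc n)))"
      using fL by (simp add: l2inner_diff_left l2inner_const_left_ce)
    finally show ?thesis by simp
  qed
  then show ?case using shift_Kinf[OF k(1)] by blast
qed

text \<open>Every Fourier coefficient of nonnegative index is a pairing with a bounded representing
  function, so all coefficients vanish.\<close>

lemma K_zero_if_orth_Kinf:
  assumes "f \<in> K" "\<And>k. k \<in> Kinf \<Longrightarrow> l2inner f k = 0"
  shows "AE t in circ. f t = 0"
proof (rule trig_complete)
  show "f \<in> L2" using assms(1) by (rule K_L2)
  fix n :: int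
  show "l2inner f (ce n) = 0"
  proof (cases "n < 0")
    case True
    then show ?thesis using H2_coeff K_H2 assms(1) by blast
  next
    case False
    then show ?thesis using coefficient_functional_Kinf[of "nat n"] assms by force
  qed
qed

lemma K_eq_if_Kinf:
  assumes "f \<in> K" "g \<in> K" "\<And>k. k \<in> Kinf \<Longrightarrow> l2inner f k = l2inner g k"
  shows "AE t in circ. f t = g t"
proof -
  have "AE t in circ. f t - g t = 0"
    using assms by (intro K_zero_if_orth_Kinf K_diff) (auto simp: l2inner_diff_left K_L2)
  then show ?thesis by simp
qed

lemma Kinf_dense: "f \<in> K \<Longrightarrow> f \<in> l2_closure Kinf"
  by (rule dense_if_orthogonal_trivial[OF l2_subspace_Kinf l2_subspace_K Int_lower1 l2_closure_K K_zero_if_orth_Kinf])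

text \<open>\<open>orth_proj\<close> is a choice operator, so a projection must first be exhibited:
  the Riesz vector of \<open>l2inner k f\<close> on the closed subspace \<open>K\<close>.\<close>

lemma P_theta:
  assumes "f \<in> L2"
  shows "P_theta \<theta> f \<in> K" "h \<in> K \<Longrightarrow> l2inner (P_theta \<theta> f) h = l2inner f h"
proof -
  obtain p where p: "p \<in> l2_closure K" "\<And>k. k \<in> K \<Longrightarrow> l2inner k f = l2inner k p"
  proof (rule Riesz_representation[OF l2_subspace_K, of "\<lambda>k. l2inner k f" "l2norm f"])
    show "\<And>k. k \<in> K \<Longrightarrow> cmod (l2inner k f) \<le> l2norm f * l2norm k"
      using Cauchy_Schwarz[OF _ assms] K_L2 by (simp add: mult.commute)
    show "\<And>k l. k \<in> K \<Longrightarrow> l \<in> K \<Longrightarrow> l2inner (\<lambda>t. k t + l t) f = l2inner k f + l2inner l f"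
      using assms by (simp add: l2inner_add_left K_L2)
  qed (auto simp: l2inner_scale_left)
  have pK: "p \<in> K" using p(1) l2_closure_K by blast
  have "l2inner (\<lambda>t. f t - p t) h = 0" if "h \<in> K" for h
  proof -
    have "l2inner (\<lambda>t. f t - p t) h = l2inner f h - l2inner p h"
      using assms pK that by (simp add: l2inner_diff_left K_L2)
    also have "l2inner f h = l2inner p h"
      using p(2)[OF that] l2inner_commute[of f h] l2inner_commute[of p h] by simp
    finally show ?thesis by simp
  qed
  then have "\<exists>g. g \<in> K \<and> (\<forall>h\<in>K. l2inner (\<lambda>t. f t - g t) h = 0)"
    using pK by auto
  then have "P_theta \<theta> f \<in> K \<and> (\<forall>h\<in>K. l2inner (\<lambda>t. f t - P_theta \<theta> f t) h = 0)"
    unfolding P_theta_def orth_proj_def by (rule someI_ex)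
  then show "P_theta \<theta> f \<in> K" "h \<in> K \<Longrightarrow> l2inner (P_theta \<theta> f) h = l2inner f h"
    using assms by (auto simp: l2inner_diff_left K_L2)
qed

end

subsection \<open>Truncated Toeplitz operators\<close>

context inner_vanishing
begin

text \<open>Testing only against bounded functions makes the right-hand side meaningful for all
  \<open>f\<close> in the model space, although \<open>\<phi> f\<close> need not be square integrable.\<close>

definition weak_tto :: "(real \<Rightarrow> complex) \<Rightarrow> ((real \<Rightarrow> complex) \<Rightarrow> (real \<Rightarrow> complex)) \<Rightarrow> bool" where
  "weak_tto \<phi> T \<longleftrightarrow> (\<forall>f\<in>K. T f \<in> K) \<and>
     (\<forall>f\<in>K. \<forall>k\<in>Kinf. l2inner (T f) k = l2inner f (\<lambda>t. cnj (\<phi> t) * k t))"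

lemma weak_ttoD:
  assumes "weak_tto \<phi> T" "f \<in> K"
  shows "T f \<in> K" "k \<in> Kinf \<Longrightarrow> l2inner (T f) k = l2inner f (\<lambda>t. cnj (\<phi> t) * k t)"
  using assms unfolding weak_tto_def by auto

lemma Kinf_K: "k \<in> Kinf \<Longrightarrow> k \<in> K" and Kinf_L2: "k \<in> Kinf \<Longrightarrow> k \<in> L2"
  by (auto intro: K_L2)

lemma cnj_symbol_L2: "\<phi> \<in> L2 \<Longrightarrow> k \<in> Kinf \<Longrightarrow> (\<lambda>t. cnj (\<phi> t) * k t) \<in> L2"
  by (intro Kinf_mult_L2 L2_cnj)

lemma weak_tto_linear:
  assumes \<phi>: "\<phi> \<in> L2" and T: "weak_tto \<phi> T" and f: "f \<in> K" and g: "g \<in> K"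
  shows "AE t in circ. T (\<lambda>s. a * f s + b * g s) t = a * T f t + b * T g t"
proof (rule K_eq_if_Kinf)
  have lin: "(\<lambda>s. a * f s + b * g s) \<in> K" by (intro K_add K_scale f g)
  show "T (\<lambda>s. a * f s + b * g s) \<in> K" by (rule weak_ttoD(1)[OF T lin])
  show "(\<lambda>t. a * T f t + b * T g t) \<in> K" by (intro K_add K_scale weak_ttoD(1)[OF T] f g)
  fix k assume k: "k \<in> Kinf"
  have "l2inner (T (\<lambda>s. a * f s + b * g s)) k = l2inner (\<lambda>s. a * f s + b * g s) (\<lambda>t. cnj (\<phi> t) * k t)"
    by (rule weak_ttoD(2)[OF T lin k])
  also have "\<dots> = a * l2inner (T f) k + b * l2inner (T g) k"
    using weak_ttoD(2)[OF T f k] weak_ttoD(2)[OF T g k] K_L2[OF f] K_L2[OF g] cnj_symbol_L2[OF \<phi> k]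
    by (simp add: l2inner_add_left l2inner_scale_left L2_cmult)
  also have "\<dots> = l2inner (\<lambda>t. a * T f t + b * T g t) k"
    using K_L2[OF weak_ttoD(1)[OF T f]] K_L2[OF weak_ttoD(1)[OF T g]] Kinf_L2[OF k]
    by (simp add: l2inner_add_left l2inner_scale_left L2_cmult)
  finally show "l2inner (T (\<lambda>s. a * f s + b * g s)) k = l2inner (\<lambda>t. a * T f t + b * T g t) k" .
qed

text \<open>For bounded \<open>f\<close> the product \<open>\<phi> f\<close> is itself square
  integrable, so the pairing extends from bounded test functions to all \<open>g\<close> in
  \<open>K\<close>.\<close>

lemma weak_tto_Kinf:
  assumes \<phi>: "\<phi> \<in> L2" and T: "weak_tto \<phi> T" and f: "f \<in> Kinf"
  shows "AE t in circ. T f t = P_theta \<theta> (\<lambda>s. \<phi> s * f s) t"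
    "g \<in> K \<Longrightarrow> l2inner (T f) g = l2inner (\<lambda>t. \<phi> t * f t) g"
proof -
  have fK: "f \<in> K" using f by (rule Kinf_K)
  have \<phi>f: "(\<lambda>t. \<phi> t * f t) \<in> L2" by (rule Kinf_mult_L2[OF f \<phi>])
  show AE: "AE t in circ. T f t = P_theta \<theta> (\<lambda>s. \<phi> s * f s) t"
  proof (rule K_eq_if_Kinf)
    fix k assume k: "k \<in> Kinf"
    have "l2inner (T f) k = l2inner f (\<lambda>t. cnj (\<phi> t) * k t)" by (rule weak_ttoD(2)[OF T fK k])
    also have "\<dots> = l2inner (\<lambda>t. \<phi> t * f t) k" by (rule l2inner_cong) (simp add: mult_ac)
    finally show "l2inner (T f) k = l2inner (P_theta \<theta> (\<lambda>s. \<phi> s * f s)) k"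
      using P_theta(2)[OF \<phi>f Kinf_K[OF k]] by simp
  qed (rule weak_ttoD(1)[OF T fK], rule P_theta(1)[OF \<phi>f])
  assume g: "g \<in> K"
  have "l2inner (T f) g = l2inner (P_theta \<theta> (\<lambda>s. \<phi> s * f s)) g"
    by (rule l2inner_cong_AE[OF AE]) (simp_all add: K_L2 weak_ttoD(1)[OF T fK] P_theta(1)[OF \<phi>f] g)
  also have "\<dots> = l2inner (\<lambda>t. \<phi> t * f t) g" by (rule P_theta(2)[OF \<phi>f g])
  finally show "l2inner (T f) g = l2inner (\<lambda>t. \<phi> t * f t) g" .
qed

text \<open>For fixed bounded \<open>k\<close> both sides depend continuously on \<open>f\<close>,
  the left one because \<open>T\<close> is bounded and linear almost everywhere; they agree on the
  dense subspace \<open>Kinf\<close>.\<close>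

lemma tto_ext_imp_weak_tto:
  assumes \<phi>: "\<phi> \<in> L2" and T: "tto_ext \<theta> \<phi> T"
  shows "weak_tto \<phi> T"
proof -
  have TK: "\<And>f. f \<in> K \<Longrightarrow> T f \<in> K" using T by (simp add: tto_ext_def)
  have lin: "\<And>f g a b. f \<in> K \<Longrightarrow> g \<in> K \<Longrightarrow> AE t in circ. T (\<lambda>s. a * f s + b * g s) t = a * T f t + b * T g t"
    using T by (simp add: tto_ext_def)
  obtain C where C: "\<And>f. f \<in> K \<Longrightarrow> l2norm (T f) \<le> C * l2norm f"
    using T unfolding tto_ext_def by blast
  have Tinf: "\<And>f. f \<in> Kinf \<Longrightarrow> AE t in circ. T f t = P_theta \<theta> (\<lambda>s. \<phi> s * f s) t"
    using T by (simp add: tto_ext_def)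
  have "l2inner (T f) k = l2inner f (\<lambda>t. cnj (\<phi> t) * k t)" if f: "f \<in> K" and k: "k \<in> Kinf" for f k
  proof -
    obtain d where d: "\<And>n. d n \<in> Kinf" "(\<lambda>n. l2norm (\<lambda>t. f t - d n t)) \<longlonglongrightarrow> 0"
      using l2_closure_seq[OF Kinf_dense[OF f]] by blast
    have dK: "d n \<in> K" for n using d(1) by (rule Kinf_K)
    have dist: "l2norm (\<lambda>t. T f t - T (d n) t) \<le> C * l2norm (\<lambda>t. f t - d n t)" for n
    proof -
      have fd: "(\<lambda>t. f t - d n t) \<in> K" by (intro K_diff f dK)
      have "AE t in circ. T (\<lambda>t. f t - d n t) t = T f t - T (d n) t"
        using lin[OF f dK[of n], of 1 "-1"] by simp
      then have "l2norm (\<lambda>t. T f t - T (d n) t) = l2norm (T (\<lambda>t. f t - d n t))"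
        using K_L2[OF TK[OF fd]] K_L2[OF TK[OF f]] K_L2[OF TK[OF dK]]
        by (intro l2norm_cong_AE) (auto elim: eventually_mono)
      then show ?thesis using C[OF fd] by simp
    qed
    have "(\<lambda>n. l2norm (\<lambda>t. T f t - T (d n) t)) \<longlonglongrightarrow> 0"
    proof (rule tendsto_sandwich[OF _ _ tendsto_const])
      show "(\<lambda>n. C * l2norm (\<lambda>t. f t - d n t)) \<longlonglongrightarrow> 0"
        using tendsto_mult_right_zero[OF d(2)] .
    qed (use dist in auto)
    then have 1: "(\<lambda>n. l2inner (T (d n)) k) \<longlonglongrightarrow> l2inner (T f) k"
      by (intro l2inner_tendsto K_L2 TK f dK Kinf_K k)
    have 2: "(\<lambda>n. l2inner (d n) (\<lambda>t. cnj (\<phi> t) * k t)) \<longlonglongrightarrow> l2inner f (\<lambda>t. cnj (\<phi> t) * k t)"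
      by (rule l2inner_tendsto(1)[OF K_L2[OF f] K_L2[OF dK] d(2) cnj_symbol_L2[OF \<phi> k]])
    have "l2inner (T (d n)) k = l2inner (d n) (\<lambda>t. cnj (\<phi> t) * k t)" for n
    proof -
      have \<phi>d: "(\<lambda>t. \<phi> t * d n t) \<in> L2" by (rule Kinf_mult_L2[OF d(1) \<phi>])
      have "l2inner (T (d n)) k = l2inner (P_theta \<theta> (\<lambda>s. \<phi> s * d n s)) k"
        by (rule l2inner_cong_AE[OF Tinf[OF d(1)]])
          (simp_all add: K_L2 TK[OF dK] P_theta(1)[OF \<phi>d] Kinf_L2[OF k])
      also have "\<dots> = l2inner (\<lambda>t. \<phi> t * d n t) k" by (rule P_theta(2)[OF \<phi>d Kinf_K[OF k]])
      also have "\<dots> = l2inner (d n) (\<lambda>t. cnj (\<phi> t) * k t)" by (rule l2inner_cong) (simp add: mult_ac)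
      finally show ?thesis .
    qed
    with 1 have "(\<lambda>n. l2inner (d n) (\<lambda>t. cnj (\<phi> t) * k t)) \<longlonglongrightarrow> l2inner (T f) k" by simp
    then show ?thesis using 2 by (rule LIMSEQ_unique)
  qed
  then show ?thesis using TK unfolding weak_tto_def by blast
qed

section \<open>Existence of the bounded extension and of its adjoint\<close>

lemma tto_form_bounded:
  assumes \<phi>: "\<phi> \<in> L2" and bdd: "tto_bounded \<theta> \<phi>"
  obtains C where "C \<ge> 0"
    "\<And>f k. f \<in> K \<Longrightarrow> k \<in> Kinf \<Longrightarrow> cmod (l2inner f (\<lambda>t. cnj (\<phi> t) * k t)) \<le> C * l2norm f * l2norm k"
proof -
  obtain C0 where C0: "\<And>f. f \<in> Kinf \<Longrightarrow> l2norm (P_theta \<theta> (\<lambda>t. \<phi> t * f t)) \<le> C0 * l2norm f"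
    using bdd unfolding tto_bounded_def by blast
  define C where "C = max C0 0"
  have C: "l2norm (P_theta \<theta> (\<lambda>t. \<phi> t * f t)) \<le> C * l2norm f" if "f \<in> Kinf" for f
    using C0[OF that] mult_right_mono[of C0 C "l2norm f"] by (simp add: C_def)
  have inf: "cmod (l2inner f (\<lambda>t. cnj (\<phi> t) * k t)) \<le> C * l2norm f * l2norm k"
    if f: "f \<in> Kinf" and k: "k \<in> Kinf" for f k
  proof -
    have \<phi>f: "(\<lambda>t. \<phi> t * f t) \<in> L2" by (rule Kinf_mult_L2[OF f \<phi>])
    have "l2inner f (\<lambda>t. cnj (\<phi> t) * k t) = l2inner (\<lambda>t. \<phi> t * f t) k"
      by (rule l2inner_cong) (simp add: mult_ac)
    also have "\<dots> = l2inner (P_theta \<theta> (\<lambda>t. \<phi> t * f t)) k"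
      by (rule P_theta(2)[OF \<phi>f Kinf_K[OF k], symmetric])
    also have "cmod \<dots> \<le> l2norm (P_theta \<theta> (\<lambda>t. \<phi> t * f t)) * l2norm k"
      by (rule Cauchy_Schwarz[OF K_L2[OF P_theta(1)[OF \<phi>f]] Kinf_L2[OF k]])
    also have "\<dots> \<le> C * l2norm f * l2norm k"
      by (rule mult_right_mono[OF C[OF f]]) simp
    finally show ?thesis .
  qed
  show ?thesis
  proof (rule that)
    show "C \<ge> 0" by (simp add: C_def)
    fix f k assume f: "f \<in> K" and k: "k \<in> Kinf"
    \<comment> \<open>Only \<open>f\<close> is approximated: \<open>k\<close> stays fixed, so
      \<open>cnj \<phi> * k\<close> is one fixed square-integrable function.\<close>
    obtain d where d: "\<And>n. d n \<in> Kinf" "(\<lambda>n. l2norm (\<lambda>t. f t - d n t)) \<longlonglongrightarrow> 0"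
      using l2_closure_seq[OF Kinf_dense[OF f]] by blast
    show "cmod (l2inner f (\<lambda>t. cnj (\<phi> t) * k t)) \<le> C * l2norm f * l2norm k"
    proof (rule LIMSEQ_le)
      show "(\<lambda>n. cmod (l2inner (d n) (\<lambda>t. cnj (\<phi> t) * k t))) \<longlonglongrightarrow> cmod (l2inner f (\<lambda>t. cnj (\<phi> t) * k t))"
        by (intro tendsto_norm l2inner_tendsto(1)[OF K_L2[OF f] Kinf_L2[OF d(1)] d(2) cnj_symbol_L2[OF \<phi> k]])
      show "(\<lambda>n. C * l2norm (d n) * l2norm k) \<longlonglongrightarrow> C * l2norm f * l2norm k"
        by (intro tendsto_intros l2norm_tendsto[OF K_L2[OF f] Kinf_L2[OF d(1)] d(2)])
      show "\<exists>N. \<forall>n\<ge>N. cmod (l2inner (d n) (\<lambda>t. cnj (\<phi> t) * k t)) \<le> C * l2norm (d n) * l2norm k"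
        using inf[OF d(1) k] by blast
    qed
  qed
qed

text \<open>The vector \<open>h\<close> lies in the closure of \<open>D\<close>, perhaps not in
  \<open>D\<close>, so \<open>F_bound\<close> is carried to it by a limit. The norm estimate is left
  undivided because \<open>l2norm h\<close> may be 0 and \<open>C\<close> has no prescribed
  sign.\<close>

lemma Riesz_representation_K:
  assumes D: "l2_subspace D" "D \<subseteq> K"
    and F_add: "\<And>k l. k \<in> D \<Longrightarrow> l \<in> D \<Longrightarrow> F (\<lambda>t. k t + l t) = F k + F l"
    and F_scale: "\<And>c k. k \<in> D \<Longrightarrow> F (\<lambda>t. c * k t) = c * F k"
    and F_bound: "\<And>k. k \<in> D \<Longrightarrow> cmod (F k) \<le> C * l2norm k"
  obtains h where "h \<in> K" "\<And>k. k \<in> D \<Longrightarrow> F k = l2inner k h" "(l2norm h)\<^sup>2 \<le> C * l2norm h"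
proof -
  obtain h where h: "h \<in> l2_closure D" "\<And>k. k \<in> D \<Longrightarrow> F k = l2inner k h"
    by (metis Riesz_representation[OF D(1) F_add F_scale F_bound])
  have "h \<in> l2_closure K" using h(1) D(2) unfolding l2_closure_def by blast
  then have hK: "h \<in> K" using l2_closure_K by blast
  obtain d where d: "\<And>n. d n \<in> D" "(\<lambda>n. l2norm (\<lambda>t. h t - d n t)) \<longlonglongrightarrow> 0"
    using l2_closure_seq[OF h(1)] by blast
  have dL: "d n \<in> L2" for n by (rule l2_subspaceD(1)[OF D(1) d(1)])
  have "cmod (l2inner h h) \<le> C * l2norm h"
  proof (rule LIMSEQ_le)
    show "(\<lambda>n. cmod (l2inner (d n) h)) \<longlonglongrightarrow> cmod (l2inner h h)"
      by (intro tendsto_norm l2inner_tendsto(1)[OF K_L2[OF hK] dL d(2) K_L2[OF hK]])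
    show "(\<lambda>n. C * l2norm (d n)) \<longlonglongrightarrow> C * l2norm h"
      by (intro tendsto_intros l2norm_tendsto[OF K_L2[OF hK] dL d(2)])
    show "\<exists>N. \<forall>n\<ge>N. cmod (l2inner (d n) h) \<le> C * l2norm (d n)"
      using F_bound[OF d(1)] h(2)[OF d(1)] by auto
  qed
  then have "(l2norm h)\<^sup>2 \<le> C * l2norm h" by (simp add: l2inner_self norm_power)
  from that[OF hK _ this] show ?thesis using h(2) by blast
qed

text \<open>For each \<open>f\<close>, \<open>T f\<close> is the Riesz vector of a functional on
  \<open>Kinf\<close>, with the arguments in the order that makes it linear in \<open>k\<close>.
  Linearity in \<open>f\<close> and agreement with \<open>P_theta\<close> then follow from the weak
  identity alone.\<close>

lemma tto_ext_exists:
  assumes \<phi>: "\<phi> \<in> L2" and bdd: "tto_bounded \<theta> \<phi>"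
  shows "\<exists>T. tto_ext \<theta> \<phi> T"
proof -
  obtain C where C: "C \<ge> 0"
    "\<And>f k. f \<in> K \<Longrightarrow> k \<in> Kinf \<Longrightarrow> cmod (l2inner f (\<lambda>t. cnj (\<phi> t) * k t)) \<le> C * l2norm f * l2norm k"
    by (rule tto_form_bounded[OF \<phi> bdd]) blast
  have "\<exists>h. h \<in> K \<and> (\<forall>k\<in>Kinf. l2inner h k = l2inner f (\<lambda>t. cnj (\<phi> t) * k t)) \<and> l2norm h \<le> C * l2norm f"
    if f: "f \<in> K" for f
  proof -
    have comm: "l2inner (\<lambda>t. cnj (\<phi> t) * k t) f = cnj (l2inner f (\<lambda>t. cnj (\<phi> t) * k t))" for k
      by (rule l2inner_commute)
    obtain h where h: "h \<in> K" "\<And>k. k \<in> Kinf \<Longrightarrow> l2inner (\<lambda>t. cnj (\<phi> t) * k t) f = l2inner k h"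
      "(l2norm h)\<^sup>2 \<le> (C * l2norm f) * l2norm h"
    proof (rule Riesz_representation_K[OF l2_subspace_Kinf Int_lower1, of "\<lambda>k. l2inner (\<lambda>t. cnj (\<phi> t) * k t) f" "C * l2norm f"])
      show "l2inner (\<lambda>t. cnj (\<phi> t) * (k t + l t)) f
          = l2inner (\<lambda>t. cnj (\<phi> t) * k t) f + l2inner (\<lambda>t. cnj (\<phi> t) * l t) f"
        if k: "k \<in> Kinf" and l: "l \<in> Kinf" for k l
        using l2inner_add_left[OF cnj_symbol_L2[OF \<phi> k] cnj_symbol_L2[OF \<phi> l] K_L2[OF f]]
        by (simp add: distrib_left)
      show "l2inner (\<lambda>t. cnj (\<phi> t) * (c * k t)) f = c * l2inner (\<lambda>t. cnj (\<phi> t) * k t) f" for c k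
        unfolding l2inner_scale_left[symmetric] by (simp add: mult.left_commute)
      show "cmod (l2inner (\<lambda>t. cnj (\<phi> t) * k t) f) \<le> C * l2norm f * l2norm k" if "k \<in> Kinf" for k
        using C(2)[OF f that] by (simp add: comm)
    qed blast
    have "l2norm h \<le> C * l2norm f"
    proof (cases "l2norm h = 0")
      case True
      then show ?thesis using C(1) by simp
    next
      case False
      then have "l2norm h > 0" by (simp add: less_le)
      then show ?thesis using h(3) by (simp add: power2_eq_square)
    qed
    moreover have "l2inner h k = l2inner f (\<lambda>t. cnj (\<phi> t) * k t)" if "k \<in> Kinf" for k
      using h(2)[OF that] l2inner_commute[of h k] comm[of k] by (metis complex_cnj_cnj)
    ultimately show ?thesis using h(1) by blast
  qed
  then obtain T where T: "\<And>f. f \<in> K \<Longrightarrow> T f \<in> K"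
    "\<And>f k. f \<in> K \<Longrightarrow> k \<in> Kinf \<Longrightarrow> l2inner (T f) k = l2inner f (\<lambda>t. cnj (\<phi> t) * k t)"
    "\<And>f. f \<in> K \<Longrightarrow> l2norm (T f) \<le> C * l2norm f"
    by metis
  then have weak: "weak_tto \<phi> T" unfolding weak_tto_def by blast
  show ?thesis
    unfolding tto_ext_def using T(1,3) weak_tto_linear[OF \<phi> weak] weak_tto_Kinf(1)[OF \<phi> weak] by blast
qed

lemma adjoint_exists:
  assumes T: "tto_ext \<theta> \<phi> T"
  shows "\<exists>S. is_adjoint_on K T S"
proof -
  have TK: "\<And>f. f \<in> K \<Longrightarrow> T f \<in> K" using T by (simp add: tto_ext_def)
  have lin: "\<And>f g a b. f \<in> K \<Longrightarrow> g \<in> K \<Longrightarrow> AE t in circ. T (\<lambda>s. a * f s + b * g s) t = a * T f t + b * T g t"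
    using T by (simp add: tto_ext_def)
  obtain C where C: "\<And>f. f \<in> K \<Longrightarrow> l2norm (T f) \<le> C * l2norm f"
    using T unfolding tto_ext_def by blast
  have "\<exists>h. h \<in> K \<and> (\<forall>f\<in>K. l2inner (T f) g = l2inner f h)" if g: "g \<in> K" for g
  proof -
    have inner_lin: "l2inner (T (\<lambda>s. a * k s + b * l s)) g = a * l2inner (T k) g + b * l2inner (T l) g"
      if k: "k \<in> K" and l: "l \<in> K" for k l a b
    proof -
      have "l2inner (T (\<lambda>s. a * k s + b * l s)) g = l2inner (\<lambda>t. a * T k t + b * T l t) g"
        by (rule l2inner_cong_AE[OF lin[OF k l]]) (auto intro!: K_L2 TK K_add K_scale k l g)
      also have "\<dots> = a * l2inner (T k) g + b * l2inner (T l) g"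
        using K_L2[OF TK[OF k]] K_L2[OF TK[OF l]] K_L2[OF g]
        by (simp add: l2inner_add_left l2inner_scale_left L2_cmult)
      finally show ?thesis .
    qed
    obtain h where "h \<in> K" "\<And>k. k \<in> K \<Longrightarrow> l2inner (T k) g = l2inner k h"
    proof (rule Riesz_representation_K[OF l2_subspace_K subset_refl, of "\<lambda>k. l2inner (T k) g" "C * l2norm g"])
      show "l2inner (T (\<lambda>t. k t + l t)) g = l2inner (T k) g + l2inner (T l) g" if "k \<in> K" "l \<in> K" for k l
        using inner_lin[OF that, of 1 1] by simp
      show "l2inner (T (\<lambda>t. c * k t)) g = c * l2inner (T k) g" if "k \<in> K" for c k
        using inner_lin[OF that that, of c 0] by simp
      show "cmod (l2inner (T k) g) \<le> C * l2norm g * l2norm k" if k: "k \<in> K" for k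
      proof -
        have "cmod (l2inner (T k) g) \<le> l2norm (T k) * l2norm g"
          by (rule Cauchy_Schwarz[OF K_L2[OF TK[OF k]] K_L2[OF g]])
        also have "\<dots> \<le> C * l2norm k * l2norm g"
          by (rule mult_right_mono[OF C[OF k]]) simp
        finally show ?thesis by (simp add: mult_ac)
      qed
    qed blast
    then show ?thesis by blast
  qed
  then obtain S where "\<And>g. g \<in> K \<Longrightarrow> S g \<in> K \<and> (\<forall>f\<in>K. l2inner (T f) g = l2inner f (S g))"
    by metis
  then show ?thesis unfolding is_adjoint_on_def by blast
qed

text \<open>With \<open>k\<close> bounded, \<open>T k\<close> may be replaced by
  \<open>\<phi> k\<close> in a pairing with any \<open>g\<close> in \<open>K\<close>; taking
  conjugates gives the symbol of \<open>S\<close>.\<close>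

lemma adjoint_weak_tto:
  assumes \<phi>: "\<phi> \<in> L2" and T: "weak_tto \<phi> T" and S: "is_adjoint_on K T S"
  shows "weak_tto (\<lambda>t. cnj (\<phi> t)) S"
proof -
  have "l2inner (S g) k = l2inner g (\<lambda>t. cnj (cnj (\<phi> t)) * k t)" if g: "g \<in> K" and k: "k \<in> Kinf" for g k
  proof -
    have "l2inner (S g) k = cnj (l2inner k (S g))" by (rule l2inner_commute)
    also have "l2inner k (S g) = l2inner (T k) g"
      using S g Kinf_K[OF k] unfolding is_adjoint_on_def by auto
    also have "\<dots> = l2inner (\<lambda>t. \<phi> t * k t) g" by (rule weak_tto_Kinf(2)[OF \<phi> T k g])
    also have "cnj \<dots> = l2inner g (\<lambda>t. \<phi> t * k t)" by (rule l2inner_commute[symmetric])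
    finally show ?thesis by simp
  qed
  then show ?thesis using S unfolding weak_tto_def is_adjoint_on_def by blast
qed


section \<open>Rank-two defect of commutation with the shift\<close>

lemma symbol_L2: "a \<in> L2 \<Longrightarrow> b \<in> L2 \<Longrightarrow> (\<lambda>t. a t + cnj (b t) + c) \<in> L2"
  by (intro L2_add L2_cnj L2_const)

text \<open>One part of the symbol survives in each pairing: the mean of \<open>f a\<close> and the
  value \<open>f(0)\<close> vanish in the first, while \<open>\<theta> b\<close> and
  \<open>\<theta>\<close> lie in \<open>\<theta> H2\<close> in the second.\<close>

lemma symbol_pairing:
  assumes a: "a \<in> K" "l2inner a (ce 0) = 0" and b: "b \<in> K" and f: "f \<in> K" "l2inner f (ce 0) = 0"
  shows "l2inner f (\<lambda>t. cnj (a t + cnj (b t) + c)) = l2inner f b"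
    "l2inner f (\<lambda>t. cnj (a t + cnj (b t) + c) * \<theta> t) = l2inner f (\<lambda>t. \<theta> t * cnj (a t))"
proof -
  note L2s = K_L2[OF a(1)] K_L2[OF b] K_L2[OF f(1)]
  have "l2inner f (\<lambda>t. cnj (a t) + b t + cnj c) = l2inner f (\<lambda>t. cnj (a t)) + l2inner f b + l2inner f (\<lambda>t. cnj c)"
    using L2s by (simp add: l2inner_add_right L2_add)
  moreover have "l2inner f (\<lambda>t. cnj (a t)) = 0"
    by (rule H2_mult_integral[OF K_H2[OF f(1)] K_H2[OF a(1)] a(2)])
  ultimately show "l2inner f (\<lambda>t. cnj (a t + cnj (b t) + c)) = l2inner f b"
    using f(2) by (simp add: l2inner_const_right)
  have "l2inner f (\<lambda>t. \<theta> t * cnj (a t) + \<theta> t * b t + cnj c * \<theta> t)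
      = l2inner f (\<lambda>t. \<theta> t * cnj (a t)) + l2inner f (\<lambda>t. \<theta> t * b t) + l2inner f (\<lambda>t. cnj c * \<theta> t)"
    using L2s by (simp add: l2inner_add_right L2_add L2_cmult theta_mult_L2 theta_L2)
  also have "\<dots> = l2inner f (\<lambda>t. \<theta> t * cnj (a t))"
    using K_orth[OF f(1) K_H2[OF b]] K_orth_theta[OF f(1)] by (simp add: l2inner_scale_right)
  finally show "l2inner f (\<lambda>t. cnj (a t + cnj (b t) + c) * \<theta> t) = l2inner f (\<lambda>t. \<theta> t * cnj (a t))"
    by (simp add: algebra_simps)
qed

lemma l2inner_ce_bshift:
  assumes "h \<in> K" "k \<in> K"
  shows "l2inner (\<lambda>t. ce 1 t * h t) k = l2inner h (bshift k)"
proof -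
  have "l2inner (\<lambda>t. ce 1 t * h t) k = l2inner h (\<lambda>t. bshift k t + l2inner k (ce 0) * ce (-1) t)"
    by (rule l2inner_cong) (simp add: bshift_def algebra_simps)
  also have "\<dots> = l2inner h (bshift k) + cnj (l2inner k (ce 0)) * l2inner h (ce (-1))"
    using assms K_L2 by (simp add: l2inner_add_right l2inner_scale_right L2_cmult bshift_L2)
  also have "l2inner h (ce (-1)) = 0" using assms K_H2 by (intro H2_coeff) auto
  finally show ?thesis by simp
qed

context
  fixes a b :: "real \<Rightarrow> complex" and c :: complex and \<phi> and T
  assumes a: "a \<in> K" "l2inner a (ce 0) = 0" and b: "b \<in> K"
    and \<phi>: "\<phi> = (\<lambda>t. a t + cnj (b t) + c)" and T: "weak_tto \<phi> T"
begin

lemma weak_tto_symbol_L2: "\<phi> \<in> L2"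
  unfolding \<phi> using a(1) b by (intro symbol_L2 K_L2)

text \<open>Moving \<open>z\<close> across turns \<open>\<theta>\<close> into the bounded test
  function \<open>ce (-1) * \<theta>\<close>. Since \<open>f(0) = 0\<close>, \<open>bshift f\<close>
  is \<open>f / z\<close>, and the two factors \<open>ce (-1)\<close> cancel in the pairing.\<close>

lemma shift_coefficient:
  assumes "f \<in> K" "l2inner f (ce 0) = 0"
  shows "l2inner (\<lambda>t. ce 1 t * T (bshift f) t) \<theta> = l2inner f (\<lambda>t. \<theta> t * cnj (a t))"
proof -
  have "l2inner (\<lambda>t. ce 1 t * T (bshift f) t) \<theta> = l2inner (T (bshift f)) (\<lambda>t. ce (-1) t * \<theta> t)"
    by (rule l2inner_cong) (simp add: mult_ac)
  also have "\<dots> = l2inner (bshift f) (\<lambda>t. cnj (\<phi> t) * (ce (-1) t * \<theta> t))"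
    by (rule weak_ttoD(2)[OF T bshift_K[OF assms(1)] zbar_theta_Kinf])
  also have "\<dots> = l2inner f (\<lambda>t. cnj (\<phi> t) * \<theta> t)"
  proof (rule l2inner_cong)
    fix t
    have "bshift f t * cnj (cnj (\<phi> t) * (ce (-1) t * \<theta> t)) = (ce (-1) t * ce 1 t) * (f t * cnj (cnj (\<phi> t) * \<theta> t))"
      unfolding bshift_def assms(2) by (simp add: mult_ac del: ce_uminus_mult)
    then show "bshift f t * cnj (cnj (\<phi> t) * (ce (-1) t * \<theta> t)) = f t * cnj (cnj (\<phi> t) * \<theta> t)"
      by simp
  qed
  also have "\<dots> = l2inner f (\<lambda>t. \<theta> t * cnj (a t))"
    unfolding \<phi> by (rule symbol_pairing(2)[OF a b assms])
  finally show ?thesis .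
qed

text \<open>The defect of the commutation of \<open>T\<close> with the compressed shift has rank two.\<close>

lemma tto_shift_relation:
  assumes f: "f \<in> K" "l2inner f (ce 0) = 0"
  shows "AE t in circ. T f t = (ce 1 t * T (bshift f) t - l2inner f (\<lambda>t. \<theta> t * cnj (a t)) * \<theta> t) + l2inner f b"
proof (rule K_eq_if_Kinf)
  define g where "g = bshift f"
  have g: "g \<in> K" unfolding g_def by (rule bshift_K[OF f(1)])
  define h where "h = T g"
  have h: "h \<in> K" unfolding h_def by (rule weak_ttoD(1)[OF T g])
  let ?\<alpha> = "l2inner f (\<lambda>t. \<theta> t * cnj (a t))"
  have \<alpha>: "l2inner (\<lambda>t. ce 1 t * h t) \<theta> = ?\<alpha>"
    unfolding h_def g_def by (rule shift_coefficient[OF f])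
  show "T f \<in> K" by (rule weak_ttoD(1)[OF T f(1)])
  \<comment> \<open>By \<open>\<alpha>\<close> the coefficient in the claim is the one that projects
    \<open>z h\<close> into \<open>K\<close>.\<close>
  have uK: "(\<lambda>t. ce 1 t * h t - ?\<alpha> * \<theta> t) \<in> K" using shift_K[OF h] unfolding \<alpha> .
  then show "(\<lambda>t. (ce 1 t * T (bshift f) t - ?\<alpha> * \<theta> t) + l2inner f b) \<in> K"
    unfolding h_def g_def by (rule K_add) simp
  fix k assume k: "k \<in> Kinf"
  have kK: "k \<in> K" using k by simp
  let ?k0 = "l2inner k (ce 0)"
  have \<phi>L: "(\<lambda>t. cnj (\<phi> t)) \<in> L2" using weak_tto_symbol_L2 by (rule L2_cnj)
  have "l2inner (T f) k = l2inner f (\<lambda>t. cnj (\<phi> t) * k t)" by (rule weak_ttoD(2)[OF T f(1) k])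
  \<comment> \<open>The split \<open>k = z * bshift k + k(0)\<close>: the first part gives the
    bounded test function \<open>bshift k\<close> for \<open>T g\<close>, the constant gives the
    term with \<open>b\<close>.\<close>
  also have "\<dots> = l2inner g (\<lambda>t. cnj (\<phi> t) * bshift k t + ?k0 * (ce (-1) t * cnj (\<phi> t)))"
  proof (rule l2inner_cong)
    fix t
    have "g t * cnj (cnj (\<phi> t) * bshift k t + ?k0 * (ce (-1) t * cnj (\<phi> t)))
       = g t * cnj (ce (-1) t * cnj (\<phi> t) * k t)"
      by (simp add: bshift_def algebra_simps)
    also have "\<dots> = (ce (-1) t * ce 1 t) * (f t * cnj (cnj (\<phi> t) * k t))"
      unfolding g_def bshift_def f(2) by (simp add: mult_ac del: ce_uminus_mult)
    finally show "f t * cnj (cnj (\<phi> t) * k t) = g t * cnj (cnj (\<phi> t) * bshift k t + ?k0 * (ce (-1) t * cnj (\<phi> t)))"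
      by simp
  qed
  also have "\<dots> = l2inner g (\<lambda>t. cnj (\<phi> t) * bshift k t) + cnj ?k0 * l2inner g (\<lambda>t. ce (-1) t * cnj (\<phi> t))"
    using K_L2[OF g] cnj_symbol_L2[OF weak_tto_symbol_L2 bshift_Kinf[OF k]] \<phi>L
    by (simp add: l2inner_add_right l2inner_scale_right L2_cmult L2_mult_ce)
  also have "l2inner g (\<lambda>t. cnj (\<phi> t) * bshift k t) = l2inner h (bshift k)"
    unfolding h_def by (rule weak_ttoD(2)[OF T g bshift_Kinf[OF k], symmetric])
  also have "l2inner h (bshift k) = l2inner (\<lambda>t. ce 1 t * h t) k"
    by (rule l2inner_ce_bshift[OF h kK, symmetric])
  also have "l2inner g (\<lambda>t. ce (-1) t * cnj (\<phi> t)) = l2inner f (\<lambda>t. cnj (\<phi> t))"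
  proof (rule l2inner_cong)
    fix t
    have "g t * cnj (ce (-1) t * cnj (\<phi> t)) = (ce (-1) t * ce 1 t) * (f t * cnj (cnj (\<phi> t)))"
      unfolding g_def bshift_def f(2) by (simp add: mult_ac del: ce_uminus_mult)
    then show "g t * cnj (ce (-1) t * cnj (\<phi> t)) = f t * cnj (cnj (\<phi> t))" by simp
  qed
  also have "\<dots> = l2inner f b" unfolding \<phi> by (rule symbol_pairing(1)[OF a b f])
  finally have lhs: "l2inner (T f) k = l2inner (\<lambda>t. ce 1 t * h t) k + cnj ?k0 * l2inner f b" .
  have "l2inner (\<lambda>t. (ce 1 t * h t - ?\<alpha> * \<theta> t) + l2inner f b) k
      = l2inner (\<lambda>t. ce 1 t * h t) k - ?\<alpha> * l2inner \<theta> k + l2inner (\<lambda>t. l2inner f b) k"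
    using K_L2[OF h] K_L2[OF kK] theta_L2
    by (simp add: l2inner_add_left l2inner_diff_left l2inner_scale_left L2_mult_ce L2_cmult L2_diff)
  also have "l2inner \<theta> k = 0" using K_orth_theta[OF kK] by (subst l2inner_commute) simp
  also have "l2inner (\<lambda>t. l2inner f b) k = l2inner f b * cnj ?k0"
    by (subst l2inner_commute) (simp add: l2inner_const_right)
  finally show "l2inner (T f) k = l2inner (\<lambda>t. (ce 1 t * T (bshift f) t - ?\<alpha> * \<theta> t) + l2inner f b) k"
    unfolding lhs h_def g_def by (simp add: mult.commute)
qed

text \<open>Polarised form of the norm identity. Of \<open>z T g\<close>, \<open>\<theta>\<close>
  and 1 only the first two fail to be orthogonal; their two cross terms each contribute minus the
  product of coefficients and the square of \<open>\<theta>\<close> contributes plus one.\<close>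

lemma tto_inner_recursion:
  assumes f: "f \<in> K" "l2inner f (ce 0) = 0" and g: "g \<in> K" "l2inner g (ce 0) = 0"
  shows "l2inner (T f) (T g) = l2inner (T (bshift f)) (T (bshift g))
    - l2inner f (\<lambda>t. \<theta> t * cnj (a t)) * cnj (l2inner g (\<lambda>t. \<theta> t * cnj (a t)))
    + l2inner f b * cnj (l2inner g b)"
proof -
  define F where "F = (\<lambda>t. ce 1 t * T (bshift f) t)"
  define G where "G = (\<lambda>t. ce 1 t * T (bshift g) t)"
  define u where "u = l2inner f (\<lambda>t. \<theta> t * cnj (a t))"
  define v where "v = l2inner g (\<lambda>t. \<theta> t * cnj (a t))"
  define x where "x = l2inner f b"
  define y where "y = l2inner g b"
  have TK: "T (bshift f) \<in> K" "T (bshift g) \<in> K"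
    by (rule weak_ttoD(1)[OF T bshift_K[OF f(1)]], rule weak_ttoD(1)[OF T bshift_K[OF g(1)]])
  have L2s: "F \<in> L2" "G \<in> L2" unfolding F_def G_def by (intro L2_mult_ce K_L2 TK)+
  have AE: "AE t in circ. T f t = (F t - u * \<theta> t) + x" "AE t in circ. T g t = (G t - v * \<theta> t) + y"
    using tto_shift_relation[OF f] tto_shift_relation[OF g] by (simp_all add: F_def G_def u_def v_def x_def y_def)
  have F\<theta>: "l2inner F \<theta> = u" and G\<theta>: "l2inner G \<theta> = v"
    unfolding F_def G_def u_def v_def by (rule shift_coefficient[OF f], rule shift_coefficient[OF g])
  have const: "l2inner (\<lambda>t. ce 1 t * h t) (ce 0) = 0" if "h \<in> K" for h
  proof -
    have "l2inner (\<lambda>t. ce 1 t * h t) (ce 0) = l2inner h (ce (-1))"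
      by (rule l2inner_cong) simp
    then show ?thesis using H2_coeff[OF K_H2[OF that]] by simp
  qed
  have F1: "l2inner F (ce 0) = 0" and G1: "l2inner G (ce 0) = 0"
    unfolding F_def G_def using const TK by auto
  have FG: "l2inner F G = l2inner (T (bshift f)) (T (bshift g))"
  proof -
    have "ce 1 t * p * (cnj (ce 1 t) * q) = p * q" for t p q
      using ce_uminus_mult(2)[of 1 t] by (simp add: mult_ac del: ce_uminus_mult)
    then show ?thesis unfolding F_def G_def by (intro l2inner_cong) simp
  qed
  have \<theta>\<theta>: "l2inner \<theta> \<theta> = 1"
    using l2inner_theta_mult[of "ce 0" "ce 0"] by (simp add: l2inner_ce[of 0 0, simplified])
  have \<theta>G: "l2inner \<theta> G = cnj v" using G\<theta> l2inner_commute[of \<theta> G] by simp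
  have xG: "l2inner (\<lambda>t. x) G = 0"
    using G1 l2inner_commute[of "\<lambda>t. x" G] by (simp add: l2inner_const_right)
  have x\<theta>: "l2inner (\<lambda>t. x) \<theta> = 0"
    using vanish l2inner_commute[of "\<lambda>t. x" \<theta>] by (simp add: l2inner_const_right)
  have "l2inner (T f) (T g) = l2inner (\<lambda>t. (F t - u * \<theta> t) + x) (\<lambda>t. (G t - v * \<theta> t) + y)"
    by (rule l2inner_cong_AE[OF AE])
      (intro K_L2 weak_ttoD(1)[OF T] f g L2_add L2_diff L2_cmult L2_const L2s theta_L2)+
  also have "\<dots> = l2inner F G - cnj v * l2inner F \<theta> + cnj y * l2inner F (ce 0)
     - u * (l2inner \<theta> G - cnj v * l2inner \<theta> \<theta> + cnj y * l2inner \<theta> (ce 0))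
     + (l2inner (\<lambda>t. x) G - cnj v * l2inner (\<lambda>t. x) \<theta> + cnj y * l2inner (\<lambda>t. x) (ce 0))"
  proof -
    have R: "l2inner p (\<lambda>t. (G t - v * \<theta> t) + y) = l2inner p G - cnj v * l2inner p \<theta> + cnj y * l2inner p (ce 0)"
      if "p \<in> L2" for p
      using that L2s theta_L2
      by (simp add: l2inner_add_right l2inner_diff_right l2inner_scale_right l2inner_const_right L2_diff L2_cmult)
    have "l2inner (\<lambda>t. (F t - u * \<theta> t) + x) q = l2inner F q - u * l2inner \<theta> q + l2inner (\<lambda>t. x) q"
      if "q \<in> L2" for q
      using that L2s theta_L2
      by (simp add: l2inner_add_left l2inner_diff_left l2inner_scale_left L2_diff L2_cmult)
    moreover have "(\<lambda>t. (G t - v * \<theta> t) + y) \<in> L2"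
      by (intro L2_add L2_diff L2_cmult L2_const L2s theta_L2)
    ultimately have "l2inner (\<lambda>t. (F t - u * \<theta> t) + x) (\<lambda>t. (G t - v * \<theta> t) + y)
      = l2inner F (\<lambda>t. (G t - v * \<theta> t) + y) - u * l2inner \<theta> (\<lambda>t. (G t - v * \<theta> t) + y)
        + l2inner (\<lambda>t. x) (\<lambda>t. (G t - v * \<theta> t) + y)" by blast
    then show ?thesis
      unfolding R[OF L2s(1)] R[OF theta_L2] R[OF L2_const] .
  qed
  also have "\<dots> = l2inner F G - u * cnj v + x * cnj y"
    using F1 G1 vanish xG x\<theta> by (simp add: F\<theta> \<theta>G \<theta>\<theta> l2inner_const_left_ce)
  finally show ?thesis unfolding FG u_def v_def x_def y_def .
qed

end


section \<open>Rigidity of the rank-two forms\<close>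

lemma conjugate_pairing:
  assumes "a \<in> K" "b \<in> K" "f \<in> K"
    and bxy: "AE t in circ. b t = x * a t + y * (\<theta> t * cnj (a t))"
  shows "l2inner f b = cnj x * l2inner f a + cnj y * l2inner f (\<lambda>t. \<theta> t * cnj (a t))"
    "l2inner f (\<lambda>t. \<theta> t * cnj (b t)) = x * l2inner f (\<lambda>t. \<theta> t * cnj (a t)) + y * l2inner f a"
proof -
  define a' where "a' = (\<lambda>t. \<theta> t * cnj (a t))"
  define b' where "b' = (\<lambda>t. \<theta> t * cnj (b t))"
  have L2s: "a \<in> L2" "b \<in> L2" "f \<in> L2" using assms by (simp_all add: K_L2)
  then have L2s': "a' \<in> L2" "b' \<in> L2" unfolding a'_def b'_def by (simp_all add: theta_mult_L2)
  have "l2inner f b = l2inner f (\<lambda>t. x * a t + y * a' t)"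
    by (rule l2inner_cong_AE) (use bxy L2s L2s' in \<open>auto simp: a'_def\<close>)
  then show "l2inner f b = cnj x * l2inner f a + cnj y * l2inner f (\<lambda>t. \<theta> t * cnj (a t))"
    unfolding a'_def[symmetric] using L2s L2s' by (simp add: l2inner_add_right l2inner_scale_right L2_cmult)
  \<comment> \<open>Multiplying the conjugate by \<open>\<theta>\<close> is an antilinear involution
    that exchanges \<open>a\<close> and \<open>a'\<close>.\<close>
  have "AE t in circ. b' t = cnj x * a' t + cnj y * a t"
    using bxy theta_AE
  proof eventually_elim
    case (elim t)
    have "\<theta> t * cnj (\<theta> t) = 1" using complex_norm_square[of "\<theta> t"] elim(2) by simp
    have "b' t = cnj x * a' t + cnj y * (\<theta> t * cnj (\<theta> t)) * a t"
      unfolding b'_def elim(1) a'_def by (simp add: algebra_simps)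
    then show ?case using \<open>\<theta> t * cnj (\<theta> t) = 1\<close> by simp
  qed
  then have "l2inner f b' = l2inner f (\<lambda>t. cnj x * a' t + cnj y * a t)"
    by (intro l2inner_cong_AE) (use L2s L2s' in auto)
  then show "l2inner f (\<lambda>t. \<theta> t * cnj (b t)) = x * l2inner f (\<lambda>t. \<theta> t * cnj (a t)) + y * l2inner f a"
    unfolding a'_def[symmetric] b'_def[symmetric]
    using L2s L2s' by (simp add: l2inner_add_right l2inner_scale_right L2_cmult)
qed

text \<open>If \<open>a\<close> and \<open>a'\<close> are independent, \<open>f\<close> in their
  span realises every pair \<open>(l2inner f a, l2inner f a')\<close>, and the equality of forms
  becomes an identity on pairs of complex numbers. If they are dependent, \<open>b\<close> is a
  multiple of \<open>a\<close> and one test vector fixes its modulus.\<close>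

lemma two_dim_rigidity:
  assumes a: "a \<in> K" "l2inner a (ce 0) = 0" and b: "b \<in> K" "l2inner b (ce 0) = 0"
    and forms: "\<And>f. f \<in> K \<Longrightarrow> l2inner f (ce 0) = 0 \<Longrightarrow>
      (cmod (l2inner f a))\<^sup>2 + (cmod (l2inner f (\<lambda>t. \<theta> t * cnj (a t))))\<^sup>2
      = (cmod (l2inner f b))\<^sup>2 + (cmod (l2inner f (\<lambda>t. \<theta> t * cnj (b t))))\<^sup>2"
  shows "\<exists>\<alpha>. cmod \<alpha> = 1 \<and>
    ((AE t in circ. b t = \<alpha> * a t) \<or> (AE t in circ. b t = \<alpha> * (\<theta> t * cnj (a t))))"
proof -
  define a' where "a' = (\<lambda>t. \<theta> t * cnj (a t))"
  have a': "a' \<in> K" "l2inner a' (ce 0) = 0"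
    unfolding a'_def by (rule conjugation_K[OF a])+
  note L2s = K_L2[OF a(1)] K_L2[OF a'(1)] K_L2[OF b(1)]
  define N where "N = (l2norm a)\<^sup>2"
  define s where "s = l2inner a a'"
  have aa: "l2inner a a = of_real N" by (simp add: N_def l2inner_self)
  have a'a: "l2inner a' a = cnj s" unfolding s_def by (rule l2inner_commute)
  have a'a': "l2inner a' a' = of_real N"
  proof -
    have "l2inner a' a' = l2inner (\<lambda>t. cnj (a t)) (\<lambda>t. cnj (a t))"
      unfolding a'_def using L2s by (intro l2inner_theta_mult) auto
    also have "\<dots> = l2inner a a" by (rule l2inner_cong) (simp add: mult.commute)
    finally show ?thesis using aa by simp
  qed
  have lin: "(\<lambda>t. p * a t + q * a' t) \<in> K" "l2inner (\<lambda>t. p * a t + q * a' t) (ce 0) = 0"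
    "l2inner (\<lambda>t. p * a t + q * a' t) h = p * l2inner a h + q * l2inner a' h" if "h \<in> L2" for p q h
    using that a a' L2s by (auto intro!: K_add K_scale simp: l2inner_add_left l2inner_scale_left L2_cmult)
  \<comment> \<open>The left-hand form vanishes at such \<open>f\<close>, hence so does each summand
    on the right. This forces \<open>b\<close> into the span of \<open>a\<close> and
    \<open>a'\<close>.\<close>
  have orth: "l2inner f b = 0" if "f \<in> K" "l2inner f (ce 0) = 0" "l2inner f a = 0" "l2inner f a' = 0" for f
    using forms[OF that(1,2)] that(3,4) by (simp add: a'_def sum_power2_eq_zero_iff)
  have span: "AE t in circ. b t = x * a t + y * a' t"
    if eqs: "l2inner b a = x * N + y * cnj s" "l2inner b a' = x * s + y * N" for x y :: complex
  proof -
    define f where "f = (\<lambda>t. b t - (x * a t + y * a' t))"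
    have f: "f \<in> K" "l2inner f (ce 0) = 0"
      unfolding f_def using b lin[OF L2_const] L2s by (auto intro!: K_diff simp: l2inner_diff_left L2_cmult L2_add lin)
    have fh: "l2inner f h = l2inner b h - (x * l2inner a h + y * l2inner a' h)" if "h \<in> L2" for h
      unfolding f_def using that L2s by (simp add: l2inner_diff_left L2_add L2_cmult lin(3))
    have 0: "l2inner f a = 0" "l2inner f a' = 0"
      using eqs L2s by (simp_all add: fh aa a'a a'a' s_def[symmetric])
    have "l2inner f f = l2inner f b - (cnj x * l2inner f a + cnj y * l2inner f a')"
      using K_L2[OF f(1)] L2s unfolding f_def
      by (simp add: l2inner_diff_right l2inner_add_right l2inner_scale_right L2_add L2_cmult)
    then have "l2inner f f = 0" using 0 orth[OF f 0] by simp
    then have "l2norm f = 0" by (simp add: l2inner_self)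
    then have "AE t in circ. f t = 0" using l2norm_eq_0_iff[OF K_L2[OF f(1)]] by simp
    then show ?thesis unfolding f_def by simp
  qed
  have form': "(cmod (l2inner f a))\<^sup>2 + (cmod (l2inner f a'))\<^sup>2
      = (cmod (cnj x * l2inner f a + cnj y * l2inner f a'))\<^sup>2 + (cmod (x * l2inner f a' + y * l2inner f a))\<^sup>2"
    if "AE t in circ. b t = x * a t + y * a' t" "f \<in> K" "l2inner f (ce 0) = 0" for x y f
    using forms[OF that(2,3)] conjugate_pairing[OF a(1) b(1) that(2) that(1)[unfolded a'_def]]
    by (simp only: a'_def[symmetric])
  have unit: "cmod z = 1" if "(cmod z)\<^sup>2 = 1" for z
    using that power2_eq_imp_eq[of "cmod z" 1] by simp
  \<comment> \<open>The Gram determinant. Cramer's rule is used twice below: for the coefficients of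
    \<open>b\<close>, and to realise arbitrary values \<open>u\<close> and \<open>v\<close>.\<close>
  define D where "D = complex_of_real N * N - s * cnj s"
  have gram: "\<exists>p q. p * complex_of_real N + q * cnj s = u \<and> p * s + q * complex_of_real N = v"
    if "D \<noteq> 0" for u v
  proof (intro exI conjI)
    have "((N * u - cnj s * v) * N + (N * v - s * u) * cnj s) = u * D"
      unfolding D_def by (simp add: algebra_simps)
    then show "(N * u - cnj s * v) / D * N + (N * v - s * u) / D * cnj s = u"
      using that by (simp add: add_divide_distrib[symmetric])
    have "((N * u - cnj s * v) * s + (N * v - s * u) * N) = v * D"
      unfolding D_def by (simp add: algebra_simps)
    then show "(N * u - cnj s * v) / D * s + (N * v - s * u) / D * N = v"
      using that by (simp add: add_divide_distrib[symmetric])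
  qed
  show ?thesis
  proof (cases "D = 0")
    case False
    obtain x y where "x * complex_of_real N + y * cnj s = l2inner b a" "x * s + y * complex_of_real N = l2inner b a'"
      using gram[OF False] by blast
    then have bxy: "AE t in circ. b t = x * a t + y * a' t" by (intro span) simp_all
    have quad: "(cmod u)\<^sup>2 + (cmod v)\<^sup>2 = (cmod (cnj x * u + cnj y * v))\<^sup>2 + (cmod (x * v + y * u))\<^sup>2" for u v
    proof -
      obtain p q where pq: "p * complex_of_real N + q * cnj s = u" "p * s + q * complex_of_real N = v"
        using gram[OF False] by blast
      define f where "f = (\<lambda>t. p * a t + q * a' t)"
      have "l2inner f a = u" "l2inner f a' = v"
        unfolding f_def using pq L2s by (simp_all add: lin aa a'a a'a' s_def[symmetric])
      then show ?thesis
        using form'[OF bxy, of f] lin[OF L2_const] unfolding f_def by metis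
    qed
    define X where "X = (cmod x)\<^sup>2"
    define Y where "Y = (cmod y)\<^sup>2"
    have XY: "X + Y = 1" using quad[of 1 0] by (simp add: X_def Y_def)
    \<comment> \<open>The cross terms of \<open>quad\<close> add up to
      \<open>4 * Re (cnj x * y * u * cnj v)\<close>; \<open>u = 1\<close>,
      \<open>v = cnj x * y\<close> turns them into \<open>4 * X * Y\<close>. With
      \<open>X + Y = 1\<close> the identity becomes
      \<open>1 + X * Y = 1 + 5 * (X * Y)\<close>.\<close>
    have "cnj x * 1 + cnj y * (cnj x * y) = cnj x * of_real (1 + Y)"
      unfolding Y_def using complex_norm_square[of y] by (simp add: algebra_simps)
    moreover have "x * (cnj x * y) + y * 1 = y * of_real (1 + X)"
      unfolding X_def using complex_norm_square[of x] by (simp add: algebra_simps)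
    ultimately have "1 + (cmod (cnj x * y))\<^sup>2 = (cmod (cnj x * of_real (1 + Y)))\<^sup>2 + (cmod (y * of_real (1 + X)))\<^sup>2"
      using quad[of 1 "cnj x * y"] by simp
    then have "1 + X * Y = X * (1 + Y)\<^sup>2 + Y * (1 + X)\<^sup>2"
      unfolding norm_mult power_mult_distrib norm_of_real power2_abs by (simp add: X_def Y_def)
    also have "\<dots> = (X + Y) + X * Y * (4 + (X + Y))"
      by (simp add: power2_eq_square algebra_simps)
    finally have "X * Y = 0" using XY by simp
    then have "x = 0 \<or> y = 0" by (simp add: X_def Y_def)
    then show ?thesis
    proof
      assume "x = 0"
      then have "cmod y = 1" using XY by (intro unit) (simp add: X_def Y_def)
      then show ?thesis using bxy \<open>x = 0\<close> by (intro exI[of _ y]) (simp add: a'_def)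
    next
      assume "y = 0"
      then have "cmod x = 1" using XY by (intro unit) (simp add: X_def Y_def)
      then show ?thesis using bxy \<open>y = 0\<close> by (intro exI[of _ x]) simp
    qed
  next
    case True
    show ?thesis
    proof (cases "N = 0")
      \<comment> \<open>Here \<open>a\<close> vanishes almost everywhere, and so does
        \<open>b\<close>; any unimodular constant would serve.\<close>
      case True
      have s0: "s = 0" using \<open>D = 0\<close> True by (simp add: D_def)
      have a0: "AE t in circ. a t = 0" using True l2norm_eq_0_iff[OF L2s(1)] by (simp add: N_def)
      then have a'0: "AE t in circ. a' t = 0" by (auto simp: a'_def elim: eventually_mono)
      have "l2inner b a = l2inner b (\<lambda>t. 0)" "l2inner b a' = l2inner b (\<lambda>t. 0)"
        by (rule l2inner_cong_AE; use a0 a'0 L2s in simp)+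
      then have "AE t in circ. b t = 0 * a t + 0 * a' t" by (intro span) simp_all
      then have "AE t in circ. b t = 1 * a t"
        using a0 by eventually_elim simp
      then show ?thesis by (intro exI[of _ 1]) simp
    next
      case False
      \<comment> \<open>The coefficient of the projection of \<open>a'\<close> onto
        \<open>a\<close>. Its remainder \<open>d\<close> is zero because \<open>D = 0\<close> is
        equality in Cauchy-Schwarz.\<close>
      define \<mu> where "\<mu> = cnj s / N"
      define d where "d = (\<lambda>t. a' t - \<mu> * a t)"
      have dL: "d \<in> L2" unfolding d_def using L2s by auto
      have dh: "l2inner d h = l2inner a' h - \<mu> * l2inner a h" if "h \<in> L2" for h
        unfolding d_def using that L2s by (simp add: l2inner_diff_left l2inner_scale_left L2_cmult)
      have "l2inner d d = l2inner d a' - cnj \<mu> * l2inner d a"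
        using dL L2s unfolding d_def by (simp add: l2inner_diff_right l2inner_scale_right L2_cmult)
      also have "l2inner d a = 0"
        using False L2s by (simp add: dh aa a'a \<mu>_def)
      also have "l2inner d a' = 0"
        using \<open>D = 0\<close> False L2s by (simp add: dh a'a' s_def[symmetric] \<mu>_def D_def field_simps)
      finally have "l2norm d = 0" by (simp add: l2inner_self)
      then have "AE t in circ. a' t = \<mu> * a t"
        using l2norm_eq_0_iff[OF dL] by (simp add: d_def)
      then have a'\<mu>: "l2inner h a' = cnj \<mu> * l2inner h a" if "h \<in> L2" for h
        using that L2s l2inner_cong_AE[of h h a' "\<lambda>t. \<mu> * a t"] by (simp add: l2inner_scale_right L2_cmult)
      define x where "x = l2inner b a / N"
      have sN: "s = cnj \<mu> * N" using a'\<mu>[OF L2s(1)] by (simp add: s_def aa)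
      have bx: "AE t in circ. b t = x * a t + 0 * a' t"
        using False L2s by (intro span) (simp_all add: x_def a'\<mu> sN)
      \<comment> \<open>The equality of forms evaluated at \<open>f = a\<close>.\<close>
      have "(cmod N)\<^sup>2 + (cmod s)\<^sup>2 = (cmod (cnj x * N))\<^sup>2 + (cmod (x * s))\<^sup>2"
        using form'[OF bx a] by (simp add: aa s_def[symmetric])
      also have "\<dots> = (cmod x)\<^sup>2 * (N\<^sup>2 + (cmod s)\<^sup>2)"
        by (simp add: norm_mult power_mult_distrib algebra_simps)
      finally have "1 * (N\<^sup>2 + (cmod s)\<^sup>2) = (cmod x)\<^sup>2 * (N\<^sup>2 + (cmod s)\<^sup>2)" by simp
      moreover have "N\<^sup>2 + (cmod s)\<^sup>2 \<noteq> 0" using False by (simp add: sum_power2_eq_zero_iff)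
      ultimately have "cmod x = 1" by (intro unit) (metis mult_right_cancel)
      then show ?thesis using bx by (intro exI[of _ x]) simp
    qed
  qed
qed


section \<open>Normality and the coefficient conditions\<close>

lemma weak_tto_const_1:
  assumes a: "a \<in> K" and b: "b \<in> K" "l2inner b (ce 0) = 0"
    and \<phi>: "\<phi> = (\<lambda>t. a t + cnj (b t) + c)" and T: "weak_tto \<phi> T"
  shows "AE t in circ. T (\<lambda>t. 1) t = a t + c"
proof (rule K_eq_if_Kinf)
  show "T (\<lambda>t. 1) \<in> K" by (rule weak_ttoD(1)[OF T const_K])
  show "(\<lambda>t. a t + c) \<in> K" by (intro K_add a const_K)
  fix k assume k: "k \<in> Kinf"
  have L2s: "a \<in> L2" "b \<in> L2" "k \<in> L2" using a b k by (auto intro: K_L2)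
  have "l2inner (T (\<lambda>t. 1)) k = l2inner (\<lambda>t. 1) (\<lambda>t. cnj (\<phi> t) * k t)"
    by (rule weak_ttoD(2)[OF T const_K k])
  also have "\<dots> = l2inner (\<lambda>t. (a t + c) + cnj (b t)) k"
    by (rule l2inner_cong) (simp add: \<phi> algebra_simps)
  also have "\<dots> = l2inner (\<lambda>t. a t + c) k + l2inner (\<lambda>t. cnj (b t)) k"
    using L2s by (intro l2inner_add_left) auto
  also have "l2inner (\<lambda>t. cnj (b t)) k = cnj (l2inner k (\<lambda>t. cnj (b t)))" by (rule l2inner_commute)
  \<comment> \<open>Since \<open>b(0) = 0\<close>, the antianalytic part of the symbol is orthogonal
    to \<open>H2\<close>.\<close>
  also have "l2inner k (\<lambda>t. cnj (b t)) = 0"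
    by (rule H2_mult_integral[OF K_H2[OF Kinf_K[OF k]] K_H2[OF b(1)] b(2)])
  finally show "l2inner (T (\<lambda>t. 1)) k = l2inner (\<lambda>t. a t + c) k" by simp
qed

context
  fixes a b :: "real \<Rightarrow> complex" and c :: complex and \<phi> and T S
  assumes a: "a \<in> K" "l2inner a (ce 0) = 0" and b: "b \<in> K" "l2inner b (ce 0) = 0"
    and \<phi>: "\<phi> = (\<lambda>t. a t + cnj (b t) + c)"
    and ext: "tto_ext \<theta> \<phi> T" and adj: "is_adjoint_on K T S"
begin

lemma \<phi>_L2: "\<phi> \<in> L2"
  unfolding \<phi> using a(1) b(1) by (intro symbol_L2 K_L2)

lemma T_weak: "weak_tto \<phi> T"
  by (rule tto_ext_imp_weak_tto[OF \<phi>_L2 ext])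

lemma S_weak: "weak_tto (\<lambda>t. cnj (\<phi> t)) S"
  by (rule adjoint_weak_tto[OF \<phi>_L2 T_weak adj])

lemma cnj_\<phi>: "(\<lambda>t. cnj (\<phi> t)) = (\<lambda>t. b t + cnj (a t) + cnj c)"
  by (simp add: \<phi> add_ac)

lemma TK: "f \<in> K \<Longrightarrow> T f \<in> K" and SK: "f \<in> K \<Longrightarrow> S f \<in> K"
  using weak_ttoD(1)[OF T_weak] weak_ttoD(1)[OF S_weak] by auto

lemma adjoint: "f \<in> K \<Longrightarrow> g \<in> K \<Longrightarrow> l2inner (T f) g = l2inner f (S g)"
  using adj unfolding is_adjoint_on_def by auto

lemma adjoint': "f \<in> K \<Longrightarrow> g \<in> K \<Longrightarrow> l2inner (S f) g = l2inner f (T g)"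
  using adjoint[of g f] l2inner_commute[of "S f" g] l2inner_commute[of f "T g"] by simp

lemma normal_imp_coefficients:
  assumes normal: "\<And>f. f \<in> K \<Longrightarrow> AE t in circ. S (T f) t = T (S f) t"
  shows "\<exists>\<alpha>. cmod \<alpha> = 1 \<and>
    ((AE t in circ. b t = \<alpha> * a t) \<or> (AE t in circ. b t = \<alpha> * (\<theta> t * cnj (a t))))"
proof (rule two_dim_rigidity[OF a b])
  have eq: "l2inner (T f) (T f) = l2inner (S f) (S f)" if f: "f \<in> K" for f
  proof -
    have "l2inner (T f) (T f) = l2inner f (S (T f))" by (rule adjoint[OF f TK[OF f]])
    also have "\<dots> = l2inner f (T (S f))"
      using normal[OF f] by (intro l2inner_cong_AE) (simp_all add: K_L2 TK SK f)
    also have "\<dots> = l2inner (S f) (S f)" by (rule adjoint'[OF f SK[OF f], symmetric])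
    finally show ?thesis .
  qed
  fix f assume f: "f \<in> K" "l2inner f (ce 0) = 0"
  let ?a' = "\<lambda>t. \<theta> t * cnj (a t)" and ?b' = "\<lambda>t. \<theta> t * cnj (b t)"
  \<comment> \<open>The identity \<open>eq\<close> enters at \<open>f\<close> and at
    \<open>bshift f\<close>, cancelling everything but the rank-two terms.\<close>
  have "l2inner f a * cnj (l2inner f a) + l2inner f ?a' * cnj (l2inner f ?a')
      = l2inner f b * cnj (l2inner f b) + l2inner f ?b' * cnj (l2inner f ?b')"
    using tto_inner_recursion[OF a b(1) \<phi> T_weak f f] tto_inner_recursion[OF b a(1) cnj_\<phi> S_weak f f]
      eq[OF f(1)] eq[OF bshift_K[OF f(1)]] by (simp add: algebra_simps)
  then have "complex_of_real ((cmod (l2inner f a))\<^sup>2 + (cmod (l2inner f ?a'))\<^sup>2)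
      = complex_of_real ((cmod (l2inner f b))\<^sup>2 + (cmod (l2inner f ?b'))\<^sup>2)"
    by (simp only: complex_norm_square of_real_add)
  then show "(cmod (l2inner f a))\<^sup>2 + (cmod (l2inner f ?a'))\<^sup>2
      = (cmod (l2inner f b))\<^sup>2 + (cmod (l2inner f ?b'))\<^sup>2"
    by (simp only: of_real_eq_iff)
qed

text \<open>\<open>T 1 = a + c\<close> and \<open>S 1 = b + cnj c\<close>. The difference
  \<open>(a + c) cnj \<phi> - (b + cnj c) \<phi>\<close> equals \<open>|a|^2 - |b|^2\<close> plus
  \<open>r\<close>, which is antianalytic with mean zero and hence orthogonal to
  \<open>K\<close>.\<close>

lemma commute_at_1:
  assumes mod: "AE t in circ. cmod (a t) = cmod (b t)"
  shows "AE t in circ. S (T (\<lambda>t. 1)) t = T (S (\<lambda>t. 1)) t"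
proof (rule K_eq_if_Kinf)
  have T1: "T (\<lambda>t. 1) \<in> K" and S1: "S (\<lambda>t. 1) \<in> K" by (rule TK[OF const_K], rule SK[OF const_K])
  show "S (T (\<lambda>t. 1)) \<in> K" "T (S (\<lambda>t. 1)) \<in> K" by (rule SK[OF T1], rule TK[OF S1])
  fix k assume k: "k \<in> Kinf"
  have L2s: "a \<in> L2" "b \<in> L2" "k \<in> L2" using a b k by (auto intro: K_L2)
  have \<phi>k: "(\<lambda>t. \<phi> t * k t) \<in> L2" "(\<lambda>t. cnj (\<phi> t) * k t) \<in> L2"
    by (rule Kinf_mult_L2[OF k \<phi>_L2], rule cnj_symbol_L2[OF \<phi>_L2 k])
  have aL: "(\<lambda>t. a t + c) \<in> L2" and bL: "(\<lambda>t. b t + cnj c) \<in> L2" using L2s by auto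
  define r where "r = (\<lambda>t. c * cnj (a t) + (- cnj c) * cnj (b t))"
  have rL: "r \<in> L2" unfolding r_def using L2s by (intro L2_add L2_cmult L2_cnj)
  have r0: "l2inner r k = 0"
  proof -
    have "l2inner r k = c * l2inner (\<lambda>t. cnj (a t)) k + (- cnj c) * l2inner (\<lambda>t. cnj (b t)) k"
      unfolding r_def using L2s
      by (simp only: l2inner_add_left[OF L2_cmult[OF L2_cnj] L2_cmult[OF L2_cnj]] l2inner_scale_left)
    moreover have "l2inner (\<lambda>t. cnj (a t)) k = cnj (l2inner k (\<lambda>t. cnj (a t)))" by (rule l2inner_commute)
    moreover have "l2inner (\<lambda>t. cnj (b t)) k = cnj (l2inner k (\<lambda>t. cnj (b t)))" by (rule l2inner_commute)
    moreover have "l2inner k (\<lambda>t. cnj (a t)) = 0" "l2inner k (\<lambda>t. cnj (b t)) = 0"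
      by (rule H2_mult_integral[OF K_H2[OF Kinf_K[OF k]] K_H2[OF a(1)] a(2)],
          rule H2_mult_integral[OF K_H2[OF Kinf_K[OF k]] K_H2[OF b(1)] b(2)])
    ultimately show ?thesis by simp
  qed
  have "l2inner (S (T (\<lambda>t. 1))) k = l2inner (T (\<lambda>t. 1)) (\<lambda>t. \<phi> t * k t)"
    using weak_ttoD(2)[OF S_weak T1 k] by simp
  also have "\<dots> = l2inner (\<lambda>t. a t + c) (\<lambda>t. \<phi> t * k t)"
    by (rule l2inner_cong_AE[OF weak_tto_const_1[OF a(1) b \<phi> T_weak] _ K_L2[OF T1] \<phi>k(1) aL \<phi>k(1)]) simp
  also have "\<dots> = l2inner (\<lambda>t. b t + cnj c) (\<lambda>t. cnj (\<phi> t) * k t) + l2inner r k"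
  proof -
    \<comment> \<open>Products such as \<open>(a + c) cnj \<phi>\<close> are only integrable, so the
      comparison is made under the integral, with the bounded \<open>k\<close> attached to
      \<open>\<phi>\<close>.\<close>
    have "(\<integral>t. (a t + c) * cnj (\<phi> t * k t) \<partial>circ)
        = (\<integral>t. (b t + cnj c) * cnj (cnj (\<phi> t) * k t) + r t * cnj (k t) \<partial>circ)"
    proof (rule integral_cong_AE)
      show "AE t in circ. (a t + c) * cnj (\<phi> t * k t) = (b t + cnj c) * cnj (cnj (\<phi> t) * k t) + r t * cnj (k t)"
        using mod
      proof eventually_elim
        case (elim t)
        have ab: "a t * cnj (a t) = b t * cnj (b t)"
          using complex_norm_square[of "a t"] complex_norm_square[of "b t"] elim by simp
        have "(a t + c) * cnj (\<phi> t) - (b t + cnj c) * \<phi> t = (a t * cnj (a t) - b t * cnj (b t)) + r t"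
          unfolding \<phi> r_def by (simp add: algebra_simps)
        then have "(a t + c) * cnj (\<phi> t) = (b t + cnj c) * \<phi> t + r t" unfolding ab by (simp add: algebra_simps)
        then have "(a t + c) * cnj (\<phi> t) * cnj (k t) = ((b t + cnj c) * \<phi> t + r t) * cnj (k t)" by simp
        then show ?case by (simp add: algebra_simps)
      qed
      show "(\<lambda>t. (a t + c) * cnj (\<phi> t * k t)) \<in> borel_measurable circ"
        by (intro borel_measurable_integrable L2_mult_integrable aL L2_cnj \<phi>k)
      show "(\<lambda>t. (b t + cnj c) * cnj (cnj (\<phi> t) * k t) + r t * cnj (k t)) \<in> borel_measurable circ"
        by (intro borel_measurable_integrable Bochner_Integration.integrable_add L2_mult_integrable bL rL L2_cnj \<phi>k L2s)
    qed
    also have "\<dots> = (\<integral>t. (b t + cnj c) * cnj (cnj (\<phi> t) * k t) \<partial>circ) + (\<integral>t. r t * cnj (k t) \<partial>circ)"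
      by (intro Bochner_Integration.integral_add L2_mult_integrable bL rL L2_cnj \<phi>k L2s)
    finally show ?thesis unfolding l2inner_def by (simp only: distrib_left)
  qed
  also have "l2inner (\<lambda>t. b t + cnj c) (\<lambda>t. cnj (\<phi> t) * k t) = l2inner (S (\<lambda>t. 1)) (\<lambda>t. cnj (\<phi> t) * k t)"
    by (rule l2inner_cong_AE[OF _ _ bL \<phi>k(2) K_L2[OF S1] \<phi>k(2)])
      (use weak_tto_const_1[OF b(1) a cnj_\<phi> S_weak] in \<open>auto elim: eventually_mono\<close>)
  also have "\<dots> = l2inner (T (S (\<lambda>t. 1))) k" by (rule weak_ttoD(2)[OF T_weak S1 k, symmetric])
  finally show "l2inner (S (T (\<lambda>t. 1))) k = l2inner (T (S (\<lambda>t. 1))) k" using r0 by simp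
qed

text \<open>The form \<open>\<langle>T f, T g\<rangle> - \<langle>S f, S g\<rangle>\<close> is invariant under the backward shift, whose powers
  tend strongly to zero, so it vanishes.\<close>

lemma coefficients_imp_normal:
  assumes mod: "AE t in circ. cmod (a t) = cmod (b t)"
    and forms: "\<And>f g. f \<in> K \<Longrightarrow> g \<in> K \<Longrightarrow>
      l2inner f a * cnj (l2inner g a) + l2inner f (\<lambda>t. \<theta> t * cnj (a t)) * cnj (l2inner g (\<lambda>t. \<theta> t * cnj (a t)))
      = l2inner f b * cnj (l2inner g b) + l2inner f (\<lambda>t. \<theta> t * cnj (b t)) * cnj (l2inner g (\<lambda>t. \<theta> t * cnj (b t)))"
    and f: "f \<in> K"
  shows "AE t in circ. S (T f) t = T (S f) t"
proof -
  define B where "B f g = l2inner (T f) (T g) - l2inner (S f) (S g)" for f g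
  have B_ST: "B f g = l2inner f (\<lambda>t. S (T g) t - T (S g) t)" if "f \<in> K" "g \<in> K" for f g
    using that by (simp add: B_def adjoint adjoint' TK SK l2inner_diff_right K_L2)
  have B_herm: "B f g = cnj (B g f)" for f g
    unfolding B_def using l2inner_commute[of "T f" "T g"] l2inner_commute[of "S f" "S g"] by simp
  have one: "(\<lambda>t. 1) \<in> K" by simp
  have B1: "B f (\<lambda>t. 1) = 0" if "f \<in> K" for f
  proof -
    have "l2inner f (\<lambda>t. S (T (\<lambda>t. 1)) t - T (S (\<lambda>t. 1)) t) = l2inner f (\<lambda>t. 0)"
    proof (rule l2inner_cong_AE)
      show "AE t in circ. S (T (\<lambda>t. 1)) t - T (S (\<lambda>t. 1)) t = 0"
        using commute_at_1[OF mod] by eventually_elim simp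
    qed (use that one in \<open>simp_all add: K_L2 TK SK L2_diff\<close>)
    then show ?thesis unfolding B_ST[OF that one] by simp
  qed
  have B_step: "B f g = B (bshift f) (bshift g)" if f: "f \<in> K" and g: "g \<in> K" for f g
  proof -
    define F where "F = (\<lambda>t. f t - l2inner f (ce 0))"
    define G where "G = (\<lambda>t. g t - l2inner g (ce 0))"
    have FK: "F \<in> K" "l2inner F (ce 0) = 0" and GK: "G \<in> K" "l2inner G (ce 0) = 0"
      unfolding F_def G_def using f g H2_diff_const diff_const_K K_H2 by auto
    have bF: "bshift F = bshift f" and bG: "bshift G = bshift g"
      using FK(2) GK(2) by (auto simp: bshift_def F_def G_def)
    \<comment> \<open>As \<open>B\<close> vanishes against 1, the second argument may lose its value
      at 0; hermitian symmetry then does the same for the first, and the recursion becomes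
      applicable.\<close>
    have drop: "B p h = B p (\<lambda>t. h t - l2inner h (ce 0))" if p: "p \<in> K" and h: "h \<in> K" for p h
    proof -
      let ?h0 = "l2inner h (ce 0)" and ?H = "\<lambda>t. h t - l2inner h (ce 0)"
      have HK: "?H \<in> K" by (rule diff_const_K[OF h])
      have AE: "AE t in circ. T h t = T ?H t + ?h0 * T (\<lambda>t. 1) t" "AE t in circ. S h t = S ?H t + ?h0 * S (\<lambda>t. 1) t"
        using weak_tto_linear[OF \<phi>_L2 T_weak HK one, of 1 ?h0]
          weak_tto_linear[OF L2_cnj[OF \<phi>_L2] S_weak HK one, of 1 ?h0] by simp_all
      have "l2inner (T p) (T h) = l2inner (T p) (\<lambda>t. T ?H t + ?h0 * T (\<lambda>t. 1) t)"
        by (rule l2inner_cong_AE[OF _ AE(1)]) (use p h HK one in \<open>simp_all add: K_L2 TK L2_add L2_cmult\<close>)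
      moreover have "l2inner (S p) (S h) = l2inner (S p) (\<lambda>t. S ?H t + ?h0 * S (\<lambda>t. 1) t)"
        by (rule l2inner_cong_AE[OF _ AE(2)]) (use p h HK one in \<open>simp_all add: K_L2 SK L2_add L2_cmult\<close>)
      ultimately have "B p h = B p ?H + cnj ?h0 * B p (\<lambda>t. 1)"
        using p HK one
        by (simp add: B_def l2inner_add_right l2inner_scale_right K_L2 TK SK L2_cmult algebra_simps)
      then show ?thesis using B1[OF p] by simp
    qed
    have "B f g = cnj (B G f)" unfolding drop[OF f g] G_def by (rule B_herm)
    also have "\<dots> = B F G" unfolding drop[OF GK(1) f] F_def by (rule B_herm[symmetric])
    also have "\<dots> = B (bshift F) (bshift G)
        + ((l2inner F b * cnj (l2inner G b) + l2inner F (\<lambda>t. \<theta> t * cnj (b t)) * cnj (l2inner G (\<lambda>t. \<theta> t * cnj (b t))))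
        - (l2inner F a * cnj (l2inner G a) + l2inner F (\<lambda>t. \<theta> t * cnj (a t)) * cnj (l2inner G (\<lambda>t. \<theta> t * cnj (a t)))))"
      unfolding B_def tto_inner_recursion[OF a b(1) \<phi> T_weak FK GK] tto_inner_recursion[OF b a(1) cnj_\<phi> S_weak FK GK]
      by simp
    also have "\<dots> = B (bshift F) (bshift G)" unfolding forms[OF FK(1) GK(1)] by simp
    finally show ?thesis by (simp add: bF bG)
  qed
  have iterK: "(bshift ^^ n) f \<in> K" if "f \<in> K" for f n
    using that by (induction n) (auto intro: bshift_K)
  have B_iter: "B f g = B ((bshift ^^ n) f) ((bshift ^^ n) g)" if "f \<in> K" "g \<in> K" for f g n
    using that by (induction n) (simp_all add: iterK B_step[symmetric])
  obtain C0 where C0: "\<And>f. f \<in> K \<Longrightarrow> l2norm (T f) \<le> C0 * l2norm f"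
    using ext unfolding tto_ext_def by blast
  define C where "C = max C0 0"
  have "C \<ge> 0" by (simp add: C_def)
  have CT: "l2norm (T f) \<le> C * l2norm f" if "f \<in> K" for f
    using C0[OF that] mult_right_mono[of C0 C "l2norm f"] by (simp add: C_def)
  \<comment> \<open>The bound for \<open>S\<close> is inherited from \<open>T\<close> through the
    pairing of \<open>T (S f)\<close> with \<open>f\<close>, which is the squared norm of
    \<open>S f\<close>.\<close>
  have CS: "l2norm (S f) \<le> C * l2norm f" if f: "f \<in> K" for f
  proof (cases "l2norm (S f) = 0")
    case True
    then show ?thesis using \<open>C \<ge> 0\<close> by simp
  next
    case False
    have "(l2norm (S f))\<^sup>2 = cmod (l2inner (T (S f)) f)"
      unfolding adjoint[OF SK[OF f] f] l2inner_self by (simp add: norm_power)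
    also have "\<dots> \<le> l2norm (T (S f)) * l2norm f"
      using f by (intro Cauchy_Schwarz K_L2 TK SK)
    also have "\<dots> \<le> (C * l2norm (S f)) * l2norm f"
      by (rule mult_right_mono[OF CT[OF SK[OF f]]]) simp
    finally have "l2norm (S f) * l2norm (S f) \<le> l2norm (S f) * (C * l2norm f)"
      by (simp add: power2_eq_square mult_ac)
    then show ?thesis using False by (simp add: less_le)
  qed
  have B_bound: "cmod (B f g) \<le> 2 * C\<^sup>2 * l2norm f * l2norm g" if f: "f \<in> K" and g: "g \<in> K" for f g
  proof -
    have "cmod (B f g) \<le> cmod (l2inner (T f) (T g)) + cmod (l2inner (S f) (S g))"
      unfolding B_def by (rule norm_triangle_ineq4)
    also have "\<dots> \<le> l2norm (T f) * l2norm (T g) + l2norm (S f) * l2norm (S g)"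
      using f g by (intro add_mono Cauchy_Schwarz K_L2 TK SK)
    also have "\<dots> \<le> (C * l2norm f) * (C * l2norm g) + (C * l2norm f) * (C * l2norm g)"
      using f g \<open>C \<ge> 0\<close> by (intro add_mono mult_mono CT CS) auto
    finally show ?thesis by (simp add: power2_eq_square mult_ac)
  qed
  \<comment> \<open>Under iteration the first argument tends to 0 in norm while the second never
    exceeds the norm of \<open>g\<close>.\<close>
  have B0: "B f g = 0" if f: "f \<in> K" and g: "g \<in> K" for f g
  proof -
    have "cmod (B f g) \<le> 0"
    proof (rule LIMSEQ_le_const)
      show "(\<lambda>n. 2 * C\<^sup>2 * l2norm ((bshift ^^ n) f) * l2norm g) \<longlonglongrightarrow> 0"
        using tendsto_mult_left_zero[OF tendsto_mult_right_zero[OF bshift_iter_tendsto_0[OF K_H2[OF f]]]] .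
      have "cmod (B f g) \<le> 2 * C\<^sup>2 * l2norm ((bshift ^^ n) f) * l2norm g" for n
      proof -
        have "cmod (B f g) \<le> 2 * C\<^sup>2 * l2norm ((bshift ^^ n) f) * l2norm ((bshift ^^ n) g)"
          unfolding B_iter[OF f g, of n] by (intro B_bound iterK f g)
        also have "\<dots> \<le> 2 * C\<^sup>2 * l2norm ((bshift ^^ n) f) * l2norm g"
          by (intro mult_left_mono l2norm_bshift_iter K_L2 g) simp
        finally show ?thesis .
      qed
      then show "\<exists>N. \<forall>n\<ge>N. cmod (B f g) \<le> 2 * C\<^sup>2 * l2norm ((bshift ^^ n) f) * l2norm g" by blast
    qed
    then show ?thesis by simp
  qed
  show ?thesis
  proof (rule K_eq_if_Kinf)
    show "S (T f) \<in> K" "T (S f) \<in> K" using f by (simp_all add: TK SK)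
    fix k assume "k \<in> Kinf"
    then have k: "k \<in> K" by simp
    have "l2inner (S (T f)) k - l2inner (T (S f)) k = B f k"
      using f k by (simp add: B_def adjoint adjoint' TK SK)
    then show "l2inner (S (T f)) k = l2inner (T (S f)) k" using B0[OF f k] by simp
  qed
qed

end

lemma normal_on_iff:
  assumes a: "a \<in> K" "l2inner a (ce 0) = 0" and b: "b \<in> K" "l2inner b (ce 0) = 0"
    and \<phi>: "\<phi> = (\<lambda>t. a t + cnj (b t) + c)" and ext: "tto_ext \<theta> \<phi> T"
  shows "normal_on K T \<longleftrightarrow> (\<exists>\<alpha>. cmod \<alpha> = 1 \<and>
    ((AE t in circ. b t = \<alpha> * a t) \<or> (AE t in circ. b t = \<alpha> * (\<theta> t * cnj (a t)))))"
    (is "_ \<longleftrightarrow> ?R")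
proof
  assume "normal_on K T"
  then show ?R
    unfolding normal_on_def using normal_imp_coefficients[OF a b \<phi> ext] by blast
next
  assume ?R
  \<comment> \<open>Both alternatives are treated together as one combination with a vanishing and a
    unimodular coefficient.\<close>
  then obtain x y where bxy: "AE t in circ. b t = x * a t + y * (\<theta> t * cnj (a t))"
    and xy: "cmod x = 1 \<and> y = 0 \<or> x = 0 \<and> cmod y = 1"
  proof (elim exE conjE disjE)
    fix \<alpha> assume "cmod \<alpha> = 1" "AE t in circ. b t = \<alpha> * a t"
    then show thesis by (intro that[of \<alpha> 0]) simp_all
  next
    fix \<alpha> assume "cmod \<alpha> = 1" "AE t in circ. b t = \<alpha> * (\<theta> t * cnj (a t))"
    then show thesis by (intro that[of 0 \<alpha>]) simp_all
  qed
  obtain S where adj: "is_adjoint_on K T S" using adjoint_exists[OF ext] by blast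
  have mod: "AE t in circ. cmod (a t) = cmod (b t)"
    using bxy theta_AE by eventually_elim (use xy in \<open>auto simp: norm_mult\<close>)
  have unit: "z * cnj z = 1" if "cmod z = 1" for z
    using complex_norm_square[of z] that by simp
  have "AE t in circ. S (T f) t = T (S f) t" if "f \<in> K" for f
  proof (rule coefficients_imp_normal[OF a b \<phi> ext adj mod _ that])
    fix f g assume f: "f \<in> K" and g: "g \<in> K"
    define p where "p = l2inner f a"
    define q where "q = l2inner g a"
    define p' where "p' = l2inner f (\<lambda>t. \<theta> t * cnj (a t))"
    define q' where "q' = l2inner g (\<lambda>t. \<theta> t * cnj (a t))"
    have "p * cnj q + p' * cnj q' = (cnj x * p + cnj y * p') * cnj (cnj x * q + cnj y * q')
        + (x * p' + y * p) * cnj (x * q' + y * q)"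
      using xy
    proof (elim disjE conjE)
      assume "cmod x = 1" "y = 0"
      have "(cnj x * p) * cnj (cnj x * q) + (x * p') * cnj (x * q') = (x * cnj x) * (p * cnj q + p' * cnj q')"
        by (simp add: algebra_simps)
      then show ?thesis unfolding unit[OF \<open>cmod x = 1\<close>] \<open>y = 0\<close> by simp
    next
      assume "x = 0" "cmod y = 1"
      have "(cnj y * p') * cnj (cnj y * q') + (y * p) * cnj (y * q) = (y * cnj y) * (p * cnj q + p' * cnj q')"
        by (simp add: algebra_simps)
      then show ?thesis unfolding unit[OF \<open>cmod y = 1\<close>] \<open>x = 0\<close> by simp
    qed
    then show "l2inner f a * cnj (l2inner g a) + l2inner f (\<lambda>t. \<theta> t * cnj (a t)) * cnj (l2inner g (\<lambda>t. \<theta> t * cnj (a t)))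
      = l2inner f b * cnj (l2inner g b) + l2inner f (\<lambda>t. \<theta> t * cnj (b t)) * cnj (l2inner g (\<lambda>t. \<theta> t * cnj (b t)))"
      unfolding conjugate_pairing[OF a(1) b(1) f bxy] conjugate_pairing[OF a(1) b(1) g bxy]
        p_def q_def p'_def q'_def .
  qed
  then show "normal_on K T" using adj unfolding normal_on_def by blast
qed

end

theorem theorem2p5:
  fixes \<theta> \<phi> \<phi>1 \<phi>2 :: "real \<Rightarrow> complex"
  assumes "inner_fun \<theta>"
    and "\<not> (\<exists>c. AE t in circ. \<theta> t = c)"
    and "fourier \<theta> 0 = 0"
    and "\<phi>1 \<in> model_space \<theta>" and "\<phi>2 \<in> model_space \<theta>"
    and "\<phi> = (\<lambda>t. \<phi>1 t + cnj (\<phi>2 t))"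
    and "tto_bounded \<theta> \<phi>"
  shows "(\<exists>T. tto_ext \<theta> \<phi> T) \<and>
    (\<forall>T. tto_ext \<theta> \<phi> T \<longrightarrow>
      (normal_on (model_space \<theta>) T \<longleftrightarrow>
        (\<exists>\<alpha>. cmod \<alpha> = 1 \<and>
          ((AE t in circ. \<phi>2 t - fourier \<phi>2 0 = \<alpha> * (\<phi>1 t - fourier \<phi>1 0)) \<or>
           (AE t in circ. \<phi>2 t - fourier \<phi>2 0 =
               \<alpha> * \<theta> t * (cnj (\<phi>1 t) - cnj (fourier \<phi>1 0)))))))"
proof -
  interpret inner_vanishing \<theta>
    using assms(1,3) by unfold_locales (simp_all add: fourier_eq)
  define a where "a = (\<lambda>t. \<phi>1 t - l2inner \<phi>1 (ce 0))"
  define b where "b = (\<lambda>t. \<phi>2 t - l2inner \<phi>2 (ce 0))"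
  have a: "a \<in> K" "l2inner a (ce 0) = 0" and b: "b \<in> K" "l2inner b (ce 0) = 0"
    unfolding a_def b_def using assms(4,5) K_H2 by (auto intro: diff_const_K H2_diff_const(2))
  \<comment> \<open>The two values at 0 merge into one constant, so that both analytic parts vanish
    at the origin.\<close>
  have \<phi>: "\<phi> = (\<lambda>t. a t + cnj (b t) + (l2inner \<phi>1 (ce 0) + cnj (l2inner \<phi>2 (ce 0))))"
    by (simp add: assms(6) a_def b_def)
  have "\<phi> \<in> L2" unfolding \<phi> by (intro symbol_L2 K_L2 a b)
  then have "\<exists>T. tto_ext \<theta> \<phi> T" using assms(7) by (rule tto_ext_exists)
  then show ?thesis
    using normal_on_iff[OF a b \<phi>] by (simp add: a_def b_def fourier_eq mult.assoc)
qed

end
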